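(* Let $r>0$, let $X$ be an affinoid subdomain of $\mathbb{A}$ with $r(X)<r$, let $u\in\mathcal{O}(X)^\times$ and let $d$ be a non-zero integer with $p\nmid d$. Then the automorphism $\theta_{u,d}$ of $\mathcal{D}(X)$ extends to a bounded $K$-algebra automorphism of $\mathcal{D}_r(X)$.
   Context: $K$ is a field containing a finite extension of $\mathbb{Q}_p$, complete for a non-archimedean absolute value with $|p|=1/p$. $\mathbb{A}$ is the rigid $K$-analytic affine line with coordinate $x$, $\partial_x=d/dx$, and $r(X)=\lim_n\|\partial_x^n\|^{1/n}$ is the spectral radius of $\partial_x$ acting on $\mathcal{O}(X)$ with its supremum norm. $\mathcal{D}(X)=\mathcal{O}(X)[\partial_x]$ is the ring of finite-order differential operators on $X$. For $r>r(X)$, $\mathcal{D}_r(X)$ is the $K$-Banach algebra of series $\sum_{j\ge0}a_j\partial^j$ with $a_j\in\mathcal{O}(X)$, $|a_j|_Xr^j\to0$, norm $\sup_j|a_j|_Xr^j$, and product $(\sum u_i\partial^i)(\sum v_j\partial^j)=\sum_k(\sum_iu_i\sum_{m\ge0}\binom{i}{m}\partial_x^m(v_{k-i+m}))\partial^k$; $\mathcal{D}(X)$ embeds into $\mathcal{D}_r(X)$ as a dense subalgebra via $\partial_x\mapsto\partial$. For $u\in\mathcal{O}(X)^\times$ and a non-zero integer $d$, $\theta_{u,d}$ is the unique $\mathcal{O}(X)$-linear ring automorphism of $\mathcal{D}(X)$ with $\theta_{u,d}(\partial_x)=\partial_x-\frac1d\frac{\partial_x(u)}{u}$ (morally, conjugation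 by a $d$-th root of $u$). *)

theory Defs
  imports
    "HOL-Analysis.Abstract_Metric_Spaces"
    "HOL-Algebra.Algebraic_Closure_Type"
begin

definition nonarch_abs :: "('a::field \<Rightarrow> real) \<Rightarrow> bool" where
  "nonarch_abs v \<longleftrightarrow>
     (\<forall>a. 0 \<le> v a) \<and> (\<forall>a. v a = 0 \<longleftrightarrow> a = 0) \<and>
     (\<forall>a b. v (a * b) = v a * v b) \<and> (\<forall>a b. v (a + b) \<le> max (v a) (v b))"

(* The type 'k is the ground field K and v is its absolute value.  A complete field with
   v p = 1/p contains the completion of its prime field, which is Q_p, so the requirement that
   K contain a finite extension of Q_p needs no separate clause.

   Points of the rigid line are handled through an algebraic closure of K: a maximal ideal of
   O(Y) is a Galois orbit of points with coordinates in the closure.  w is the absolute value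
   of the closure that extends v; since K is complete it exists and is unique. *)
definition ground_field ::
  "nat \<Rightarrow> ('k::field_char_0 \<Rightarrow> real) \<Rightarrow> ('k alg_closure \<Rightarrow> real) \<Rightarrow> bool" where
  "ground_field p v w \<longleftrightarrow>
     prime p \<and> nonarch_abs v \<and> v (of_nat p) = 1 / real p \<and>
     Metric_space.mcomplete UNIV (\<lambda>a b. v (a - b)) \<and>
     nonarch_abs w \<and> (\<forall>c. w (to_ac c) = v c)"

(* The functions on Y that are uniform limits of rational functions over K without poles in Y.
   For an affinoid subdomain Y of the line this is O(Y), regarded as functions on the geometric
   points of Y: O(Y) is reduced and complete for its supremum norm, and the rational functions
   without poles in Y are dense in it.  Functions are extended by 0 outside Y, so that equality
   of functions is equality on Y. *)
definition holo ::
  "('k::field_char_0 alg_closure \<Rightarrow> real) \<Rightarrow> 'k alg_closure set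
    \<Rightarrow> ('k alg_closure \<Rightarrow> 'k alg_closure) set" where
  "holo w Y = {f. (\<forall>a. a \<notin> Y \<longrightarrow> f a = 0) \<and>
     (\<forall>e>0. \<exists>P Q :: 'k poly. \<forall>a\<in>Y.
        poly (map_poly to_ac Q) a \<noteq> 0 \<and>
        w (f a - poly (map_poly to_ac P) a / poly (map_poly to_ac Q) a) < e)}"

definition holo_ring ::
  "('k::field_char_0 alg_closure \<Rightarrow> real) \<Rightarrow> 'k alg_closure set
    \<Rightarrow> ('k alg_closure \<Rightarrow> 'k alg_closure) ring" where
  "holo_ring w Y =
     \<lparr>carrier = holo w Y,
      monoid.mult = (\<lambda>f g a. f a * g a),
      one = (\<lambda>a. if a \<in> Y then 1 else 0),
      zero = (\<lambda>a. 0),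
      add = (\<lambda>f g a. f a + g a)\<rparr>"

definition closed_disc :: "('k::field_char_0 alg_closure \<Rightarrow> real) \<Rightarrow> 'k \<Rightarrow> 'k alg_closure set" where
  "closed_disc w c = {a. w a \<le> w (to_ac c)}"

(* F 0, ..., F n generate the unit ideal of O(D). *)
definition rational_subdomain ::
  "('k::field_char_0 alg_closure \<Rightarrow> real) \<Rightarrow> 'k alg_closure set \<Rightarrow> 'k alg_closure set \<Rightarrow> bool" where
  "rational_subdomain w D Z \<longleftrightarrow>
     (\<exists>(n::nat) F G. (\<forall>i\<le>n. F i \<in> holo w D \<and> G i \<in> holo w D) \<and>
        (\<forall>a\<in>D. (\<Sum>i\<le>n. G i a * F i a) = 1) \<and>
        Z = {a \<in> D. \<forall>i\<le>n. w (F i a) \<le> w (F 0 a)})"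

(* The line is the increasing union of the discs |x| <= |c| with c in K, and an affinoid
   subdomain, being quasi-compact, lies in one of them.  By the theorem of Gerritzen and Grauert
   the affinoid subdomains of a disc are finite unions of rational subdomains; conversely, in
   dimension one every finite union of affinoid subdomains of a disc is again affinoid. *)
definition affinoid_subdomain ::
  "('k::field_char_0 alg_closure \<Rightarrow> real) \<Rightarrow> 'k alg_closure set \<Rightarrow> bool" where
  "affinoid_subdomain w Y \<longleftrightarrow>
     (\<exists>c \<Z>. c \<noteq> 0 \<and> finite \<Z> \<and> (\<forall>Z\<in>\<Z>. rational_subdomain w (closed_disc w c) Z) \<and> Y = \<Union>\<Z>)"

(* 0 is inserted so that the supremum is also meaningful for empty Y. *)
definition sup_norm ::
  "('k::field_char_0 alg_closure \<Rightarrow> real) \<Rightarrow> 'k alg_closure set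
    \<Rightarrow> ('k alg_closure \<Rightarrow> 'k alg_closure) \<Rightarrow> real" where
  "sup_norm w Y f = Sup (insert 0 ((\<lambda>a. w (f a)) ` Y))"

definition ddx ::
  "('k::field_char_0 alg_closure \<Rightarrow> real) \<Rightarrow> 'k alg_closure set
    \<Rightarrow> ('k alg_closure \<Rightarrow> 'k alg_closure) \<Rightarrow> 'k alg_closure \<Rightarrow> 'k alg_closure" where
  "ddx w Y f a =
     (if a \<in> Y then
        (THE D. \<forall>e>0. \<exists>\<delta>>0. \<forall>b\<in>Y. b \<noteq> a \<and> w (b - a) < \<delta> \<longrightarrow>
           w ((f b - f a) / (b - a) - D) < e)
      else 0)"

(* For f = 0 the quotient is 0 / 0 = 0. *)
definition op_norm ::
  "('k::field_char_0 alg_closure \<Rightarrow> real) \<Rightarrow> 'k alg_closure set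
    \<Rightarrow> (('k alg_closure \<Rightarrow> 'k alg_closure) \<Rightarrow> ('k alg_closure \<Rightarrow> 'k alg_closure)) \<Rightarrow> real" where
  "op_norm w Y T = Sup ((\<lambda>f. sup_norm w Y (T f) / sup_norm w Y f) ` holo w Y)"

definition spectral_radius ::
  "('k::field_char_0 alg_closure \<Rightarrow> real) \<Rightarrow> 'k alg_closure set \<Rightarrow> real" where
  "spectral_radius w Y = lim (\<lambda>n. root n (op_norm w Y (ddx w Y ^^ n)))"

definition fin_symbols ::
  "('k::field_char_0 alg_closure \<Rightarrow> real) \<Rightarrow> 'k alg_closure set
    \<Rightarrow> (nat \<Rightarrow> 'k alg_closure \<Rightarrow> 'k alg_closure) set" where
  "fin_symbols w Y = {a. (\<forall>j. a j \<in> holo w Y) \<and> finite {j. a j \<noteq> (\<lambda>_. 0)}}"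

(* The differential operator sum_j a_j (d/dx)^j on O(Y). *)
definition diff_op ::
  "('k::field_char_0 alg_closure \<Rightarrow> real) \<Rightarrow> 'k alg_closure set
    \<Rightarrow> (nat \<Rightarrow> 'k alg_closure \<Rightarrow> 'k alg_closure)
    \<Rightarrow> (('k alg_closure \<Rightarrow> 'k alg_closure) \<Rightarrow> ('k alg_closure \<Rightarrow> 'k alg_closure))" where
  "diff_op w Y a =
     (\<lambda>f\<in>holo w Y. \<lambda>x. \<Sum>j | a j \<noteq> (\<lambda>_. 0). a j x * (ddx w Y ^^ j) f x)"

definition diff_ring ::
  "('k::field_char_0 alg_closure \<Rightarrow> real) \<Rightarrow> 'k alg_closure set
    \<Rightarrow> (('k alg_closure \<Rightarrow> 'k alg_closure) \<Rightarrow> ('k alg_closure \<Rightarrow> 'k alg_closure)) ring" where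
  "diff_ring w Y =
     \<lparr>carrier = diff_op w Y ` fin_symbols w Y,
      monoid.mult = compose (holo w Y),
      one = (\<lambda>f\<in>holo w Y. f),
      zero = (\<lambda>f\<in>holo w Y. \<lambda>x. 0),
      add = (\<lambda>S T. \<lambda>f\<in>holo w Y. \<lambda>x. S f x + T f x)\<rparr>"

definition mult_op ::
  "('k::field_char_0 alg_closure \<Rightarrow> real) \<Rightarrow> 'k alg_closure set
    \<Rightarrow> ('k alg_closure \<Rightarrow> 'k alg_closure)
    \<Rightarrow> (('k alg_closure \<Rightarrow> 'k alg_closure) \<Rightarrow> ('k alg_closure \<Rightarrow> 'k alg_closure))" where
  "mult_op w Y g = (\<lambda>f\<in>holo w Y. \<lambda>x. g x * f x)"

(* Uniqueness of theta is meant among maps defined on D(Y), hence the extensionality clause. *)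
definition theta ::
  "('k::field_char_0 alg_closure \<Rightarrow> real) \<Rightarrow> 'k alg_closure set
    \<Rightarrow> ('k alg_closure \<Rightarrow> 'k alg_closure) \<Rightarrow> int
    \<Rightarrow> (('k alg_closure \<Rightarrow> 'k alg_closure) \<Rightarrow> ('k alg_closure \<Rightarrow> 'k alg_closure))
    \<Rightarrow> (('k alg_closure \<Rightarrow> 'k alg_closure) \<Rightarrow> ('k alg_closure \<Rightarrow> 'k alg_closure))" where
  "theta w Y u d = (THE \<theta>.
     \<theta> \<in> extensional (carrier (diff_ring w Y)) \<and>
     \<theta> \<in> ring_iso (diff_ring w Y) (diff_ring w Y) \<and>
     (\<forall>g\<in>holo w Y. \<forall>P\<in>carrier (diff_ring w Y).
        \<theta> (mult_op w Y g \<otimes>\<^bsub>diff_ring w Y\<^esub> P) = mult_op w Y g \<otimes>\<^bsub>diff_ring w Y\<^esub> \<theta> P) \<and>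
     \<theta> (\<lambda>f\<in>holo w Y. ddx w Y f) =
       (\<lambda>f\<in>holo w Y. \<lambda>x. ddx w Y f x - 1 / of_int d * (ddx w Y u x / u x) * f x))"

(* The sum of a convergent series in O(Y) for the supremum norm. *)
definition holo_suminf ::
  "('k::field_char_0 alg_closure \<Rightarrow> real) \<Rightarrow> 'k alg_closure set
    \<Rightarrow> (nat \<Rightarrow> 'k alg_closure \<Rightarrow> 'k alg_closure) \<Rightarrow> 'k alg_closure \<Rightarrow> 'k alg_closure" where
  "holo_suminf w Y F = (THE g. g \<in> holo w Y \<and>
     (\<lambda>n. sup_norm w Y (\<lambda>x. (\<Sum>i<n. F i x) - g x)) \<longlonglongrightarrow> 0)"

(* Elements are the coefficient sequences of the series sum_j a_j \<partial>^j.  In the product, i choose m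
   vanishes for m > i, and v_{k-i+m} is understood as 0 when k - i + m < 0. *)
definition completed_diff_ring ::
  "('k::field_char_0 alg_closure \<Rightarrow> real) \<Rightarrow> 'k alg_closure set \<Rightarrow> real
    \<Rightarrow> (nat \<Rightarrow> 'k alg_closure \<Rightarrow> 'k alg_closure) ring" where
  "completed_diff_ring w Y r =
     \<lparr>carrier = {a. (\<forall>j. a j \<in> holo w Y) \<and> (\<lambda>j. sup_norm w Y (a j) * r ^ j) \<longlonglongrightarrow> 0},
      monoid.mult = (\<lambda>u v k. holo_suminf w Y (\<lambda>i x.
        u i x * (\<Sum>m | m \<le> i \<and> i \<le> k + m. of_nat (i choose m) * (ddx w Y ^^ m) (v (k + m - i)) x))),
      one = (\<lambda>j x. if j = 0 \<and> x \<in> Y then 1 else 0),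
      zero = (\<lambda>j x. 0),
      add = (\<lambda>u v j x. u j x + v j x)\<rparr>"

definition completed_norm ::
  "('k::field_char_0 alg_closure \<Rightarrow> real) \<Rightarrow> 'k alg_closure set \<Rightarrow> real
    \<Rightarrow> (nat \<Rightarrow> 'k alg_closure \<Rightarrow> 'k alg_closure) \<Rightarrow> real" where
  "completed_norm w Y r a = Sup (range (\<lambda>j. sup_norm w Y (a j) * r ^ j))"

definition bounded_algebra_automorphism ::
  "('k::field_char_0 alg_closure \<Rightarrow> real) \<Rightarrow> 'k alg_closure set \<Rightarrow> real
    \<Rightarrow> ((nat \<Rightarrow> 'k alg_closure \<Rightarrow> 'k alg_closure) \<Rightarrow> (nat \<Rightarrow> 'k alg_closure \<Rightarrow> 'k alg_closure))
    \<Rightarrow> bool" where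
  "bounded_algebra_automorphism w Y r \<Theta> \<longleftrightarrow>
     \<Theta> \<in> ring_iso (completed_diff_ring w Y r) (completed_diff_ring w Y r) \<and>
     (\<forall>c::'k. \<forall>a\<in>carrier (completed_diff_ring w Y r).
        \<Theta> (\<lambda>j x. to_ac c * a j x) = (\<lambda>j x. to_ac c * \<Theta> a j x)) \<and>
     (\<exists>C. \<forall>a\<in>carrier (completed_diff_ring w Y r).
        completed_norm w Y r (\<Theta> a) \<le> C * completed_norm w Y r a)"

(* The embedding of D(Y) in its completion: an operator is sent to its coefficient sequence. *)
definition diff_embed ::
  "('k::field_char_0 alg_closure \<Rightarrow> real) \<Rightarrow> 'k alg_closure set
    \<Rightarrow> (('k alg_closure \<Rightarrow> 'k alg_closure) \<Rightarrow> ('k alg_closure \<Rightarrow> 'k alg_closure))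
    \<Rightarrow> (nat \<Rightarrow> 'k alg_closure \<Rightarrow> 'k alg_closure)" where
  "diff_embed w Y P = (THE a. a \<in> fin_symbols w Y \<and> diff_op w Y a = P)"

end

(* Conjugation by a d-th root of u sends \<partial> to \<partial> + c with c = -(1/d) u'/u, and the n-th power of \<partial> to
   the sum of (n choose m) b_m \<partial>^(n-m), where b_0 = 1 and b_(m+1) = b_m' + c b_m; morally
   b_m = u^(1/d) (u^(-1/d))^(m).  The substitution extends continuously to D_r(X) as soon as
   |b_m| <= B r^m, and multiplicativity and invertibility then follow by density from the finite
   symbols, where they are identities between operators on O(X).

   For the growth of b_m, replace 1/d by a natural number n.  At a point x the numbers b_m / m! are
   the coefficients of the n-th power of the power series u(x) / u(x + z).  This series and its
   inverse converge to 0 coefficientwise at radius s = L / r1, where L = lim |m!|^(1/m) and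
   r(X) < r1 < r, and have constant term 1.  As the Gauss norm is multiplicative, both have Gauss
   norm 1, so |b_m| <= |m!| / s^m uniformly in n.  Since p does not divide d, 1/d is a p-adic limit of
   natural numbers, and the bound carries over to n = 1/d. *)

theory Submission
  imports Defs "HOL-Library.Function_Algebras"
begin

section \<open>Non-archimedean fields\<close>

text \<open>The obstacle is uniformity. The estimate |D^j f| <= C r0^j |f|, applied to f = u^(-n),
  would leave the factor |u^n| |u^(-n)|, which may be unbounded in n. The supremum norm of O(X) need
  not be multiplicative, so the Gauss norm argument runs at one geometric point at a time, with
  values in a field. The bound it yields involves neither the point nor n and so passes to the
  supremum and to the limit. There are two gaps r0 < r1 < r above r(X). The first makes the
  coefficients of both series tend to 0 at radius s; the second absorbs |m!| / L^m, whose m-th root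
  tends to 1. Identities of finite symbols can be tested on operators because the powers of x
  separate symbols in characteristic zero. A second obstacle: O(X) consists of functions on points
  of an algebraic closure that may be incomplete. Its completeness and its Cauchy estimates rest on
  two facts: values at a point stay in a finite extension of K, and X is bounded and contains the
  closed disc of one common radius |t| around each of its points.\<close>

lemma fekete_root:
  fixes a :: "nat \<Rightarrow> real"
  assumes nonneg: "\<And>n. 0 \<le> a n" and submult: "\<And>m n. a (m + n) \<le> a m * a n"
  obtains L where "0 \<le> L" "(\<lambda>n. root n (a n)) \<longlonglongrightarrow> L" "\<And>n. 0 < n \<Longrightarrow> L ^ n \<le> a n"
proof -
  define S where "S = (\<lambda>n. root n (a n)) ` {0<..}"
  define L where "L = Inf S"
  have S_ne: "S \<noteq> {}" by (auto simp: S_def)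
  have S_nn: "0 \<le> x" if "x \<in> S" for x
    using that nonneg by (auto simp: S_def)
  have bdd: "bdd_below S" using S_nn by (rule bdd_belowI)
  have L0: "0 \<le> L" unfolding L_def using S_ne S_nn by (intro cInf_greatest) auto
  have Lle: "L \<le> root n (a n)" if "0 < n" for n
    unfolding L_def using bdd that by (intro cInf_lower) (auto simp: S_def)
  have lim: "(\<lambda>n. root n (a n)) \<longlonglongrightarrow> L"
  proof (rule order_tendstoI)
    fix y assume "y < L"
    then show "\<forall>\<^sub>F n in sequentially. y < root n (a n)"
      using Lle by (intro eventually_sequentiallyI[of 1]) (auto intro: less_le_trans)
  next
    fix y assume y: "L < y"
    \<comment> \<open>Division with remainder: once \<open>a M\<close> is at most q^M, the value at
      k M + t is at most C q^(k M + t), where \<open>C\<close> covers the finitely many remainders t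
      < M. The n-th root of \<open>C\<close> tends to 1, and q < y leaves room for it.\<close>
    define q where "q = (L + y) / 2"
    have q: "L < q" "q < y" using y by (auto simp: q_def)
    have q0: "0 < q" using q L0 by linarith
    obtain M where M: "0 < M" "root M (a M) < q"
      using cInf_lessD[OF S_ne, of q] q by (auto simp: S_def L_def)
    have aM: "a M \<le> q ^ M"
    proof -
      have "a M = root M (a M) ^ M" using M nonneg by simp
      also have "\<dots> \<le> q ^ M" using M nonneg by (intro power_mono) auto
      finally show ?thesis .
    qed
    \<comment> \<open>The summand 1 keeps \<open>C\<close> positive, so that its roots tend to
      1.\<close>
    define C where "C = 1 + (\<Sum>t<M. a t / q ^ t)"
    have C1: "1 \<le> C" using nonneg q0 by (auto simp: C_def intro!: sum_nonneg)
    have at: "a t \<le> C * q ^ t" if "t < M" for t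
    proof -
      have "a t / q ^ t \<le> (\<Sum>t<M. a t / q ^ t)"
        using nonneg q0 that by (intro member_le_sum) auto
      then have "a t / q ^ t \<le> C" by (simp add: C_def)
      then show ?thesis using q0 by (simp add: divide_simps mult.commute)
    qed
    have akt: "a (k * M + t) \<le> C * q ^ (k * M + t)" if "t < M" for k t
    proof (induction k)
      case 0
      then show ?case using at[OF that] by simp
    next
      case (Suc k)
      have "a (Suc k * M + t) \<le> a M * a (k * M + t)"
        using submult[of M "k * M + t"] by (simp add: add.assoc)
      also have "\<dots> \<le> q ^ M * (C * q ^ (k * M + t))"
        using aM Suc nonneg q0 by (intro mult_mono) auto
      also have "\<dots> = C * q ^ (Suc k * M + t)" by (simp add: power_add)
      finally show ?case .
    qed
    have an: "a n \<le> C * q ^ n" for n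
      using akt[of "n mod M" "n div M"] M by simp
    have "(\<lambda>n. root n C * q) \<longlonglongrightarrow> 1 * q"
      using C1 by (intro tendsto_mult LIMSEQ_root_const) auto
    then have ev: "\<forall>\<^sub>F n in sequentially. root n C * q < y"
      using q by (intro order_tendstoD) auto
    show "\<forall>\<^sub>F n in sequentially. root n (a n) < y"
      using ev eventually_gt_at_top[of 0]
    proof eventually_elim
      case (elim n)
      have "root n (a n) \<le> root n (C * q ^ n)" using an elim by simp
      also have "\<dots> = root n C * q" using elim q0 by (simp add: real_root_mult real_root_power_cancel)
      finally show ?case using elim by simp
    qed
  qed
  have "L ^ n \<le> a n" if "0 < n" for n
  proof -
    have "L ^ n \<le> root n (a n) ^ n" using Lle[OF that] L0 by (intro power_mono)
    then show ?thesis using that nonneg by simp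
  qed
  then show ?thesis using that L0 lim by blast
qed

text \<open>The roots drop below q from some index on; the constant pays for the finitely many
  earlier terms.\<close>

lemma root_limit_growth:
  fixes a :: "nat \<Rightarrow> real"
  assumes nonneg: "\<And>n. 0 \<le> a n" and lim: "(\<lambda>n. root n (a n)) \<longlonglongrightarrow> L" and q: "L < q" "0 < q"
  shows "\<exists>C. \<forall>n. a n \<le> C * q ^ n"
proof -
  have "\<forall>\<^sub>F n in sequentially. root n (a n) < q" using lim q by (intro order_tendstoD)
  then obtain n0 where n0: "\<And>n. n0 \<le> n \<Longrightarrow> root n (a n) < q" by (auto simp: eventually_sequentially)
  define C where "C = 1 + (\<Sum>n\<le>n0. a n / q ^ n)"
  have C1: "1 \<le> C" using q nonneg by (auto simp: C_def intro!: sum_nonneg)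
  have "a n \<le> C * q ^ n" for n
  proof (cases "n \<le> n0")
    case True
    have "a n / q ^ n \<le> (\<Sum>n\<le>n0. a n / q ^ n)" using True q nonneg by (intro member_le_sum) auto
    then have "a n / q ^ n \<le> C" by (simp add: C_def)
    then show ?thesis using q by (simp add: pos_divide_le_eq)
  next
    case False
    then have n: "0 < n" "n0 \<le> n" by auto
    have "a n = root n (a n) ^ n" using n(1) nonneg by simp
    also have "\<dots> \<le> q ^ n" using n0[OF n(2)] n(1) nonneg by (intro power_mono) auto
    also have "\<dots> \<le> C * q ^ n" using C1 q by simp
    finally show ?thesis .
  qed
  then show ?thesis by blast
qed

lemma inverse_Suc_small:
  assumes "0 < e"
  shows "\<exists>n0. \<forall>n\<ge>n0. inverse (real (Suc n)) < e"
proof -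
  obtain n0 where n0: "inverse (real (Suc n0)) < e" using reals_Archimedean assms by blast
  have "inverse (real (Suc n)) < e" if "n \<ge> n0" for n
  proof -
    have "inverse (real (Suc n)) \<le> inverse (real (Suc n0))" using that by (simp add: divide_simps)
    then show ?thesis using n0 by linarith
  qed
  then show ?thesis by blast
qed

locale nonarch_field =
  fixes w :: "'a::field \<Rightarrow> real"
  assumes nonarch: "nonarch_abs w"
begin

lemma w_nonneg [simp]: "0 \<le> w a"
  and w_eq_0 [simp]: "w a = 0 \<longleftrightarrow> a = 0"
  and w_mult: "w (a * b) = w a * w b"
  and w_add: "w (a + b) \<le> max (w a) (w b)"
  using nonarch by (auto simp: nonarch_abs_def)

lemma w_0 [simp]: "w 0 = 0" by simp

lemma w_pos [simp]: "0 < w a \<longleftrightarrow> a \<noteq> 0"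
  using w_nonneg[of a] w_eq_0[of a] by linarith

lemma w_1 [simp]: "w 1 = 1"
  using w_mult[of 1 1] by simp

lemma w_minus [simp]: "w (- a) = w a"
proof -
  have "w (-1) * w (-1) = 1" using w_mult[of "-1" "-1"] by simp
  then have "w (-1) = 1" using w_nonneg[of "-1"]
    by (metis abs_of_nonneg abs_1 power2_eq_1_iff power2_eq_square zero_le_one
        add.inverse_inverse neg_equal_iff_equal abs_minus_cancel)
  then show ?thesis using w_mult[of "-1" a] by simp
qed

lemma w_diff: "w (a - b) \<le> max (w a) (w b)"
  using w_add[of a "- b"] by simp

lemma w_diff_commute: "w (a - b) = w (b - a)"
  using w_minus[of "a - b"] by simp

lemma w_add_le: "w a \<le> M \<Longrightarrow> w b \<le> M \<Longrightarrow> w (a + b) \<le> M"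
  using w_add[of a b] by simp

lemma w_diff_le: "w a \<le> M \<Longrightarrow> w b \<le> M \<Longrightarrow> w (a - b) \<le> M"
  using w_diff[of a b] by simp

lemma w_add_less: "w a < M \<Longrightarrow> w b < M \<Longrightarrow> w (a + b) < M"
  using w_add[of a b] by simp

lemma w_diff_less: "w a < M \<Longrightarrow> w b < M \<Longrightarrow> w (a - b) < M"
  using w_diff[of a b] by simp

lemma w_diff_trans_less: "w (a - b) < M \<Longrightarrow> w (b - c) < M \<Longrightarrow> w (a - c) < M"
  using w_add_less[of "a - b" M "b - c"] by simp

text \<open>Since b = (a + b) - a, \<open>w b\<close> is at most the maximum of
  \<open>w (a + b)\<close> and \<open>w a\<close>, and the hypothesis excludes the second.\<close>

lemma w_add_eq: "w a < w b \<Longrightarrow> w (a + b) = w b"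
  using w_add[of a b] w_diff[of "a + b" a] by simp

lemma w_sum_le: "0 \<le> M \<Longrightarrow> (\<And>i. i \<in> S \<Longrightarrow> w (f i) \<le> M) \<Longrightarrow> w (sum f S) \<le> M"
  by (induction S rule: infinite_finite_induct) (auto intro: w_add_le)

lemma w_sum_less: "0 < M \<Longrightarrow> (\<And>i. i \<in> S \<Longrightarrow> w (f i) < M) \<Longrightarrow> w (sum f S) < M"
  by (induction S rule: infinite_finite_induct) (auto intro: w_add_less)

lemma w_power: "w (a ^ n) = w a ^ n"
  by (induction n) (auto simp: w_mult)

lemma w_inverse: "w (inverse a) = inverse (w a)"
proof (cases "a = 0")
  case False
  then have "w a * w (inverse a) = 1" using w_mult[of a "inverse a"] by simp
  then show ?thesis by (metis inverse_unique)
qed simp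

lemma w_divide: "w (a / b) = w a / w b"
  by (simp add: divide_inverse w_mult w_inverse)

lemma w_of_nat: "w (of_nat n) \<le> 1"
  by (induction n) (auto intro: w_add_le)

lemma w_of_int: "w (of_int n) \<le> 1"
  by (cases n rule: int_cases2) (auto simp: w_of_nat)

section \<open>Gauss norms of power series\<close>

lemma fps_power_coeff_le_1:
  fixes f :: "'a fps"
  assumes s: "0 < s" and f: "\<And>j. w (fps_nth f j) * s ^ j \<le> 1"
  shows "w (fps_nth (f ^ n) j) * s ^ j \<le> 1"
proof (induction n arbitrary: j)
  case 0
  then show ?case using s by (auto simp: fps_one_def)
next
  case (Suc n)
  have "w (fps_nth f i * fps_nth (f ^ n) (j - i)) \<le> 1 / s ^ j" if "i \<in> {0..j}" for i
  proof -
    have "(w (fps_nth f i) * s ^ i) * (w (fps_nth (f ^ n) (j - i)) * s ^ (j - i)) \<le> 1 * 1"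
      using f Suc s by (intro mult_mono) auto
    moreover have "s ^ j = s ^ i * s ^ (j - i)" using that by (simp flip: power_add)
    ultimately show ?thesis using s by (simp add: w_mult field_simps)
  qed
  then have "w (fps_nth (f ^ Suc n) j) \<le> 1 / s ^ j"
    using s by (auto simp: fps_mult_nth intro!: w_sum_le)
  then show ?case using s by (simp add: field_simps)
qed

(* The Gauss norm of radius s is multiplicative; since both norms are at least 1, they are 1. *)
lemma fps_inverse_coeff_le_1:
  fixes f g :: "'a fps"
  assumes fg: "f * g = 1" and f0: "fps_nth f 0 = 1" and g0: "fps_nth g 0 = 1" and s: "0 < s"
    and f: "(\<lambda>j. w (fps_nth f j) * s ^ j) \<longlonglongrightarrow> 0"
    and g: "(\<lambda>j. w (fps_nth g j) * s ^ j) \<longlonglongrightarrow> 0"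
  shows "w (fps_nth f j) * s ^ j \<le> 1"
proof -
  \<comment> \<open>A null sequence that starts at 1 attains its maximum. The least such index is
    taken, so that all earlier entries are strictly smaller.\<close>
  have max_ex: "\<exists>i. (\<forall>j. a j \<le> a i) \<and> (\<forall>j<i. a j < a i)"
    if a: "a \<longlonglongrightarrow> 0" "a 0 = 1" for a :: "nat \<Rightarrow> real"
  proof -
    have "\<forall>\<^sub>F j in sequentially. a j < 1" using a by (intro order_tendstoD) auto
    then obtain J where J: "\<And>j. J \<le> j \<Longrightarrow> a j < 1" by (auto simp: eventually_sequentially)
    have "a 0 \<le> Max (a ` {..J})" by (intro Max_ge) auto
    then have M1: "1 \<le> Max (a ` {..J})" using a by simp
    have le: "a j \<le> Max (a ` {..J})" for j
    proof (cases "j \<le> J")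
      case False
      then show ?thesis using J[of j] M1 by auto
    qed auto
    have "Max (a ` {..J}) \<in> a ` {..J}" by (intro Max_in) auto
    then obtain i where i: "a i = Max (a ` {..J})" by (metis imageE)
    define k where "k = (LEAST i. a i = Max (a ` {..J}))"
    have k: "a k = Max (a ` {..J})" unfolding k_def using i by (rule LeastI)
    have "a j < a k" if "j < k" for j
      using le[of j] not_less_Least[OF that[unfolded k_def]] k by force
    then show ?thesis using k le by metis
  qed
  define a where "a j = w (fps_nth f j) * s ^ j" for j
  define b where "b j = w (fps_nth g j) * s ^ j" for j
  obtain i where i: "\<And>j. a j \<le> a i" "\<And>j. j < i \<Longrightarrow> a j < a i"
    using max_ex[of a] f f0 unfolding a_def by auto
  obtain k where k: "\<And>j. b j \<le> b k" "\<And>j. j < k \<Longrightarrow> b j < b k"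
    using max_ex[of b] g g0 unfolding b_def by auto
  have a1: "1 \<le> a i" using i(1)[of 0] by (simp add: a_def f0)
  have b1: "1 \<le> b k" using k(1)[of 0] by (simp add: b_def g0)
  have nn: "0 \<le> a j" "0 \<le> b j" for j using s by (auto simp: a_def b_def)
  \<comment> \<open>The coefficient of f * g at i + k contains the term f_i g_k. Any other term has
    an index below i in f or below k in g and is strictly smaller, so the coefficient is nonzero,
    while 1 has none in positive degree.\<close>
  have "i + k = 0"
  proof (rule ccontr)
    assume ik: "i + k \<noteq> 0"
    define h where "h l = fps_nth f l * fps_nth g (i + k - l)" for l
    have wh: "w (h l) * s ^ (i + k) = a l * b (i + k - l)" if "l \<le> i + k" for l
    proof -
      have "s ^ l * s ^ (i + k - l) = s ^ (i + k)" using that by (simp flip: power_add)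
      then show ?thesis by (simp add: h_def a_def b_def w_mult algebra_simps)
    qed
    have lt: "w (h l) < w (h i)" if "l \<in> {0..i + k} - {i}" for l
    proof -
      have "a l * b (i + k - l) < a i * b k"
      proof (cases "l < i")
        case True
        then show ?thesis using i(2)[OF True] k(1) nn a1 b1
          by (smt (verit) mult_left_mono mult_strict_right_mono)
      next
        case False
        then have "i + k - l < k" using that by auto
        then have "b (i + k - l) < b k" by (rule k(2))
        then have "a l * b (i + k - l) \<le> a i * b (i + k - l)" "a i * b (i + k - l) < a i * b k"
          using i(1)[of l] nn a1 by (auto intro!: mult_right_mono)
        then show ?thesis by linarith
      qed
      then have "w (h l) * s ^ (i + k) < w (h i) * s ^ (i + k)"
        using wh[of l] wh[of i] that by simp
      then show ?thesis using s by simp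
    qed
    have "w (h i) * s ^ (i + k) = a i * b k" using wh[of i] by simp
    then have "0 < w (h i) * s ^ (i + k)" using a1 b1 by simp
    then have hi: "0 < w (h i)" using s by (simp add: zero_less_mult_iff)
    have "w (sum h ({0..i + k} - {i})) < w (h i)"
      using lt hi by (intro w_sum_less) auto
    then have "w (sum h ({0..i + k} - {i}) + h i) = w (h i)" by (rule w_add_eq)
    moreover have "sum h ({0..i + k} - {i}) + h i = fps_nth (f * g) (i + k)"
      by (subst (2) add.commute) (simp add: fps_mult_nth h_def sum.remove[of _ i])
    moreover have "fps_nth (f * g) (i + k) = 0" using ik by (simp add: fg)
    ultimately show False using hi by simp
  qed
  then have "a j \<le> a 0" using i(1) by simp
  then show ?thesis by (simp add: a_def f0)
qed

end

section \<open>The p-adic size of factorials\<close>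

locale padic_field = nonarch_field w for w :: "'a::field_char_0 \<Rightarrow> real" +
  fixes p :: nat
  assumes prime: "prime p" and w_p: "w (of_nat p) = 1 / real p"
begin

lemma p_gt_1: "1 < real p"
  using prime_gt_1_nat[OF prime] by simp

text \<open>Bezout writes 1 = a p + b n. The first summand has absolute value below 1, so the second
  has absolute value at least 1, and integers never exceed 1.\<close>

lemma w_of_int_coprime:
  assumes "\<not> int p dvd n"
  shows "w (of_int n) = 1"
proof -
  have "coprime (int p) n" using assms prime by (intro prime_imp_coprime) auto
  then obtain a b where ab: "a * int p + b * n = 1"
    by (metis bezout_int coprime_iff_gcd_eq_1)
  have "1 = w (of_int (a * int p) + of_int (b * n))" using ab by (simp only: flip: of_int_add) simp
  also have "\<dots> \<le> max (w (of_int (a * int p))) (w (of_int (b * n)))" by (rule w_add)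
  also have "w (of_int (a * int p)) \<le> 1 * (1 / real p)"
    using w_of_int[of a] by (simp add: w_mult w_p mult_left_le_one_le divide_right_mono)
  finally have "1 \<le> max (1 / real p) (w (of_int (b * n)))" by simp
  then have "1 \<le> w (of_int (b * n))" using p_gt_1 by (auto simp: le_max_iff_disj)
  also have "\<dots> \<le> 1 * w (of_int n)" unfolding of_int_mult w_mult
    using w_of_int by (intro mult_right_mono) auto
  finally show ?thesis using w_of_int[of n] by simp
qed

lemma w_of_nat_coprime: "\<not> p dvd n \<Longrightarrow> w (of_nat n) = 1"
  using w_of_int_coprime[of "int n"] by simp

text \<open>The factors between two consecutive multiples of p are prime to p.\<close>

lemma w_fact_add: "k < p \<Longrightarrow> w (fact (p * m + k)) = w (fact (p * m))"
proof (induction k)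
  case (Suc k)
  have "\<not> p dvd Suc (p * m + k)"
    using Suc.prems nat_dvd_not_less[of "Suc k" p] dvd_add_right_iff[of p "p * m" "Suc k"] by simp
  then have "w (of_nat (Suc (p * m + k))) = 1" by (rule w_of_nat_coprime)
  moreover have "fact (p * m + Suc k) = (of_nat (Suc (p * m + k)) * fact (p * m + k) :: 'a)"
    by (simp add: fact_Suc)
  ultimately show ?case using Suc by (simp only: w_mult)
qed simp

text \<open>From p m to p (m + 1) the only new factor divisible by p is p (m + 1). This is
  Legendre's formula in recursive form.\<close>

lemma w_fact_mult: "w (fact (p * m)) = (1 / real p) ^ m * w (fact m)"
proof (induction m)
  case (Suc m)
  obtain q where q: "p = Suc q" using prime by (metis not0_implies_Suc not_prime_0)
  have "fact (p * Suc m) = (of_nat (p * Suc m) * fact (p * m + q) :: 'a)"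
    using fact_Suc[of "p * m + q", where ?'a = 'a] q by (simp add: algebra_simps)
  then have "w (fact (p * Suc m)) = w (of_nat p) * w (of_nat (Suc m)) * w (fact (p * m + q))"
    by (simp only: of_nat_mult w_mult)
  also have "w (fact (p * m + q)) = w (fact (p * m))" using q by (intro w_fact_add) simp
  finally show ?case using Suc by (simp add: w_mult w_p fact_Suc)
qed simp

text \<open>With m = n div p the recursion gives v_p(n!) = m + v_p(m!) <= 2 m <= n for the p-adic
  valuation v_p, the last step because p >= 2.\<close>

lemma w_fact_ge: "(1 / real p) ^ n \<le> w (fact n)"
proof (induction n rule: less_induct)
  case (less n)
  define m where "m = n div p"
  have p2: "2 \<le> p" using prime by (rule prime_ge_2_nat)
  show ?case
  proof (cases "n = 0")
    case False
    have "n div p \<le> n div 2" using p2 by (intro div_le_mono2) auto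
    then have m: "m + m \<le> n" "m < n" using False by (auto simp: m_def)
    have "w (fact n) = w (fact (p * m + n mod p))" by (simp add: m_def)
    also have "\<dots> = (1 / real p) ^ m * w (fact m)"
      using p2 by (simp add: w_fact_add w_fact_mult)
    finally have eq: "w (fact n) = (1 / real p) ^ m * w (fact m)" .
    have "(1 / real p) ^ n \<le> (1 / real p) ^ (m + m)" using m(1) p_gt_1 by (intro power_decreasing) auto
    also have "\<dots> = (1 / real p) ^ m * (1 / real p) ^ m" by (simp add: power_add)
    also have "\<dots> \<le> w (fact n)"
      unfolding eq using less[OF m(2)] by (intro mult_left_mono) auto
    finally show ?thesis .
  qed simp
qed

text \<open>Integrality of binomial coefficients makes |n!| submultiplicative, so the limit exists
  and bounds |n!| from below; \<open>w_fact_ge\<close> makes it positive. The limit is p^(-1/(p-1)),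
  the radius of convergence of the exponential series.\<close>

lemma fact_radius:
  obtains L where "0 < L" "(\<lambda>n. root n (w (fact n))) \<longlonglongrightarrow> L" "\<And>n. L ^ n \<le> w (fact n)"
proof -
  have sub: "w (fact (m + n)) \<le> w (fact m) * w (fact n)" for m n
  proof -
    have "fact (m + n) = (fact m * fact n * of_nat ((m + n) choose m) :: 'a)"
      using binomial_fact_lemma[of m "m + n"] by (metis add_diff_cancel_left' le_add1 of_nat_fact of_nat_mult)
    then have "w (fact (m + n)) = w (fact m) * w (fact n) * w (of_nat ((m + n) choose m))"
      by (simp only: w_mult)
    also have "\<dots> \<le> w (fact m) * w (fact n) * 1"
      using w_of_nat by (intro mult_left_mono) auto
    finally show ?thesis by simp
  qed
  obtain L where L: "0 \<le> L" "(\<lambda>n. root n (w (fact n))) \<longlonglongrightarrow> L" "\<And>n. 0 < n \<Longrightarrow> L ^ n \<le> w (fact n)"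
    using fekete_root[of "\<lambda>n. w (fact n)"] sub by auto
  have "1 / real p \<le> L"
  proof (rule tendsto_lowerbound[OF L(2)])
    show "\<forall>\<^sub>F n in sequentially. 1 / real p \<le> root n (w (fact n))"
      using eventually_gt_at_top[of 0]
    proof eventually_elim
      case (elim n)
      have "1 / real p = root n ((1 / real p) ^ n)" using elim by (simp add: real_root_power_cancel)
      also have "\<dots> \<le> root n (w (fact n))" using elim w_fact_ge by simp
      finally show ?case .
    qed
  qed simp
  moreover have "0 < 1 / real p" using p_gt_1 by simp
  ultimately have "0 < L" by linarith
  moreover have "L ^ n \<le> w (fact n)" for n using L(3)[of n] by (cases "n = 0") auto
  ultimately show ?thesis using that L(2) by blast
qed

end

section \<open>Non-archimedean differential algebras\<close>

lemma tendsto_0_le: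
  fixes f g :: "nat \<Rightarrow> real"
  assumes "g \<longlonglongrightarrow> 0" "\<And>n. 0 \<le> f n" "\<And>n. f n \<le> g n"
  shows "f \<longlonglongrightarrow> 0"
  using assms by (intro tendsto_sandwich[of "\<lambda>_. 0" f sequentially g]) (auto intro: always_eventually)

text \<open>An axiomatic O(X) with its supremum norm and derivative. The unit \<open>e\<close> is
  kept apart from the \<open>1\<close> of the type: functions on X are extended by zero, so the
  constant function 1 need not lie in \<open>A\<close>. \<open>D_bound\<close> is what r(X) < r
  provides, and \<open>faithful\<close> allows identities between symbols to be checked on
  operators.\<close>

locale nonarch_diff_algebra =
  fixes A :: "'a::comm_ring_1 set" and e :: 'a and N :: "'a \<Rightarrow> real" and D :: "'a \<Rightarrow> 'a" and r :: real
  assumes e_in [simp]: "e \<in> A"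
    and diff_in: "a \<in> A \<Longrightarrow> b \<in> A \<Longrightarrow> a - b \<in> A"
    and mult_in [simp]: "a \<in> A \<Longrightarrow> b \<in> A \<Longrightarrow> a * b \<in> A"
    and e_mult [simp]: "a \<in> A \<Longrightarrow> e * a = a"
    and N_nonneg [simp]: "a \<in> A \<Longrightarrow> 0 \<le> N a"
    and N_eq_0: "a \<in> A \<Longrightarrow> N a = 0 \<longleftrightarrow> a = 0"
    and N_diff: "a \<in> A \<Longrightarrow> b \<in> A \<Longrightarrow> N (a - b) \<le> max (N a) (N b)"
    and N_mult: "a \<in> A \<Longrightarrow> b \<in> A \<Longrightarrow> N (a * b) \<le> N a * N b"
    and complete: "(\<And>i. F i \<in> A) \<Longrightarrow> (\<lambda>i. N (F i)) \<longlonglongrightarrow> 0 \<Longrightarrow>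
      \<exists>g\<in>A. (\<lambda>n. N ((\<Sum>i<n. F i) - g)) \<longlonglongrightarrow> 0"
    and D_in [simp]: "a \<in> A \<Longrightarrow> D a \<in> A"
    and D_add: "a \<in> A \<Longrightarrow> b \<in> A \<Longrightarrow> D (a + b) = D a + D b"
    and D_mult: "a \<in> A \<Longrightarrow> b \<in> A \<Longrightarrow> D (a * b) = D a * b + a * D b"
    and r_pos: "0 < r"
    and D_bound: "\<exists>C. \<forall>a\<in>A. \<forall>m. N ((D ^^ m) a) \<le> C * r ^ m * N a"
    and faithful: "\<And>a j. (\<And>j. a j \<in> A) \<Longrightarrow> finite {j. a j \<noteq> 0} \<Longrightarrow>
      (\<And>f. f \<in> A \<Longrightarrow> (\<Sum>j | a j \<noteq> 0. a j * (D ^^ j) f) = 0) \<Longrightarrow> a j = 0"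
begin

lemma zero_in [simp]: "0 \<in> A"
  using diff_in[OF e_in e_in] by simp

lemma uminus_in: "a \<in> A \<Longrightarrow> - a \<in> A"
  using diff_in[of 0 a] by simp

lemma add_in [simp]: "a \<in> A \<Longrightarrow> b \<in> A \<Longrightarrow> a + b \<in> A"
  using diff_in[of a "- b"] uminus_in by simp

lemma sum_in [simp]: "(\<And>i. i \<in> S \<Longrightarrow> f i \<in> A) \<Longrightarrow> sum f S \<in> A"
  by (induction S rule: infinite_finite_induct) auto

lemma of_nat_mult_in [simp]: "a \<in> A \<Longrightarrow> of_nat n * a \<in> A"
  by (induction n) (auto simp: distrib_right)

lemma mult_e [simp]: "a \<in> A \<Longrightarrow> a * e = a"
  by (metis mult.commute e_mult)

lemma N_0 [simp]: "N 0 = 0"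
  by (simp add: N_eq_0)

lemma N_minus: "a \<in> A \<Longrightarrow> N (- a) = N a"
proof -
  have "N (- b) \<le> N b" if "b \<in> A" for b using N_diff[of 0 b] that by (simp add: max_def)
  from this[of a] this[of "- a"] show "N (- a) = N a" if "a \<in> A" using that uminus_in by simp
qed

lemma N_add: "a \<in> A \<Longrightarrow> b \<in> A \<Longrightarrow> N (a + b) \<le> max (N a) (N b)"
  using N_diff[of a "- b"] by (simp add: uminus_in N_minus)

lemma N_add_le: "a \<in> A \<Longrightarrow> b \<in> A \<Longrightarrow> N a \<le> M \<Longrightarrow> N b \<le> M \<Longrightarrow> N (a + b) \<le> M"
  using N_add[of a b] by simp

lemma N_diff_le: "a \<in> A \<Longrightarrow> b \<in> A \<Longrightarrow> N a \<le> M \<Longrightarrow> N b \<le> M \<Longrightarrow> N (a - b) \<le> M"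
  using N_diff[of a b] by simp

lemma N_of_nat_mult: "a \<in> A \<Longrightarrow> N (of_nat n * a) \<le> N a"
  by (induction n) (auto simp: distrib_right intro: N_add_le)

lemma N_sum_le: "0 \<le> M \<Longrightarrow> (\<And>i. i \<in> S \<Longrightarrow> f i \<in> A) \<Longrightarrow> (\<And>i. i \<in> S \<Longrightarrow> N (f i) \<le> M) \<Longrightarrow> N (sum f S) \<le> M"
  by (induction S rule: infinite_finite_induct) (auto intro: N_add_le)

lemma Dpow_in [simp]: "a \<in> A \<Longrightarrow> (D ^^ m) a \<in> A"
  by (induction m) auto

lemma D_0 [simp]: "D 0 = 0"
  using D_add[of 0 0] by simp

lemma Dpow_add: "a \<in> A \<Longrightarrow> b \<in> A \<Longrightarrow> (D ^^ m) (a + b) = (D ^^ m) a + (D ^^ m) b"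
  by (induction m) (auto simp: D_add)

lemma Dpow_0 [simp]: "(D ^^ m) 0 = 0"
  by (induction m) auto

lemma D_e [simp]: "D e = 0"
  using D_mult[of e e] by simp

subsection \<open>Convergent series\<close>

definition sums_to :: "(nat \<Rightarrow> 'a) \<Rightarrow> 'a \<Rightarrow> bool" where
  "sums_to F g \<longleftrightarrow> (\<forall>i. F i \<in> A) \<and> g \<in> A \<and> (\<lambda>n. N ((\<Sum>i<n. F i) - g)) \<longlonglongrightarrow> 0"

text \<open>Counterpart of \<open>holo_suminf\<close>, kept as a description so that the two can be
  identified by unfolding.\<close>

definition lsum :: "(nat \<Rightarrow> 'a) \<Rightarrow> 'a" where
  "lsum F = (THE g. g \<in> A \<and> (\<lambda>n. N ((\<Sum>i<n. F i) - g)) \<longlonglongrightarrow> 0)"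

lemma lsum_eq:
  assumes "sums_to F g"
  shows "lsum F = g"
  unfolding lsum_def
proof (rule the_equality)
  show "g \<in> A \<and> (\<lambda>n. N ((\<Sum>i<n. F i) - g)) \<longlonglongrightarrow> 0" using assms by (simp add: sums_to_def)
  fix h assume h: "h \<in> A \<and> (\<lambda>n. N ((\<Sum>i<n. F i) - h)) \<longlonglongrightarrow> 0"
  have g: "g \<in> A" "\<And>i. F i \<in> A" "(\<lambda>n. N ((\<Sum>i<n. F i) - g)) \<longlonglongrightarrow> 0"
    using assms by (auto simp: sums_to_def)
  have "(\<lambda>n. max (N ((\<Sum>i<n. F i) - g)) (N ((\<Sum>i<n. F i) - h))) \<longlonglongrightarrow> max 0 0"
    using g h by (intro tendsto_max) auto
  moreover have "N (h - g) \<le> max (N ((\<Sum>i<n. F i) - g)) (N ((\<Sum>i<n. F i) - h))" for n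
    using N_diff[of "(\<Sum>i<n. F i) - g" "(\<Sum>i<n. F i) - h"] g h by (simp add: diff_in)
  ultimately have "N (h - g) \<le> max 0 0"
    by (intro tendsto_lowerbound[of _ _ sequentially]) auto
  moreover have hg: "h - g \<in> A" using g h by (simp add: diff_in)
  ultimately have "N (h - g) = 0" using N_nonneg[OF hg] by simp
  then show "h = g" using N_eq_0[OF hg] by simp
qed

lemma sums_to_lsum:
  assumes "\<And>i. F i \<in> A" "(\<lambda>i. N (F i)) \<longlonglongrightarrow> 0"
  shows "sums_to F (lsum F)"
  using complete[OF assms] lsum_eq assms(1) unfolding sums_to_def by metis

lemma sums_to_mult:
  assumes "sums_to F g" "c \<in> A"
  shows "sums_to (\<lambda>i. c * F i) (c * g)"
proof -
  have A: "c \<in> A" "F i \<in> A" "g \<in> A" for i using assms by (auto simp: sums_to_def)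
  have "(\<lambda>n. N ((\<Sum>i<n. c * F i) - c * g)) \<longlonglongrightarrow> 0"
  proof (rule tendsto_0_le)
    show "(\<lambda>n. N c * N ((\<Sum>i<n. F i) - g)) \<longlonglongrightarrow> 0"
      using assms by (intro tendsto_mult_right_zero) (auto simp: sums_to_def)
    show "0 \<le> N ((\<Sum>i<n. c * F i) - c * g)" for n using A by (simp add: diff_in)
    show "N ((\<Sum>i<n. c * F i) - c * g) \<le> N c * N ((\<Sum>i<n. F i) - g)" for n
      using N_mult[of c "(\<Sum>i<n. F i) - g"] A
      by (simp add: diff_in sum_distrib_left right_diff_distrib)
  qed
  then show ?thesis using assms by (simp add: sums_to_def)
qed

lemma sums_to_add:
  assumes "sums_to F g" "sums_to G h"
  shows "sums_to (\<lambda>i. F i + G i) (g + h)"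
proof -
  have A: "F i \<in> A" "G i \<in> A" "g \<in> A" "h \<in> A" for i using assms by (auto simp: sums_to_def)
  have "(\<lambda>n. N ((\<Sum>i<n. F i + G i) - (g + h))) \<longlonglongrightarrow> 0"
  proof (rule tendsto_0_le)
    have "(\<lambda>n. max (N ((\<Sum>i<n. F i) - g)) (N ((\<Sum>i<n. G i) - h))) \<longlonglongrightarrow> max 0 0"
      using assms by (intro tendsto_max) (auto simp: sums_to_def)
    then show "(\<lambda>n. max (N ((\<Sum>i<n. F i) - g)) (N ((\<Sum>i<n. G i) - h))) \<longlonglongrightarrow> 0" by simp
    show "0 \<le> N ((\<Sum>i<n. F i + G i) - (g + h))" for n using A by (simp add: diff_in)
    show "N ((\<Sum>i<n. F i + G i) - (g + h)) \<le> max (N ((\<Sum>i<n. F i) - g)) (N ((\<Sum>i<n. G i) - h))" for n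
      using N_add[of "(\<Sum>i<n. F i) - g" "(\<Sum>i<n. G i) - h"] A
      by (simp add: diff_in sum.distrib add_diff_add)
  qed
  then show ?thesis using assms by (simp add: sums_to_def)
qed

lemma sums_to_finite:
  assumes "\<And>i. F i \<in> A" "\<And>i. n \<le> i \<Longrightarrow> F i = 0"
  shows "sums_to F (\<Sum>i<n. F i)"
proof -
  have "N ((\<Sum>i<k. F i) - (\<Sum>i<n. F i)) = 0" if "n \<le> k" for k
    using that assms sum.mono_neutral_right[of "{..<k}" "{..<n}" F] by auto
  then have "\<forall>\<^sub>F k in sequentially. N ((\<Sum>i<k. F i) - (\<Sum>i<n. F i)) = 0"
    by (rule eventually_sequentiallyI)
  then show ?thesis using assms by (simp add: sums_to_def tendsto_eventually)
qed

lemma sums_to_bound: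
  assumes "sums_to F g" "\<And>i. N (F i) \<le> M"
  shows "N g \<le> M"
proof -
  have M: "0 \<le> M"
  proof -
    have "F 0 \<in> A" using assms(1) by (simp add: sums_to_def)
    then show ?thesis using N_nonneg[of "F 0"] assms(2)[of 0] by linarith
  qed
  have "(\<lambda>n. max (N ((\<Sum>i<n. F i) - g)) M) \<longlonglongrightarrow> max 0 M"
    using assms by (intro tendsto_max) (auto simp: sums_to_def)
  moreover have "N g \<le> max (N ((\<Sum>i<n. F i) - g)) M" for n
  proof -
    have "N ((\<Sum>i<n. F i) - ((\<Sum>i<n. F i) - g)) \<le> max (N (\<Sum>i<n. F i)) (N ((\<Sum>i<n. F i) - g))"
      using assms by (intro N_diff) (auto simp: sums_to_def diff_in)
    moreover have "N (\<Sum>i<n. F i) \<le> M" using assms M by (intro N_sum_le) (auto simp: sums_to_def)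
    ultimately show ?thesis by (simp add: max_def split: if_splits)
  qed
  ultimately have "N g \<le> max 0 M"
    by (intro tendsto_lowerbound[of _ _ sequentially]) auto
  then show ?thesis using M by simp
qed

subsection \<open>Symbols\<close>

definition Car :: "(nat \<Rightarrow> 'a) set" where
  "Car = {a. (\<forall>j. a j \<in> A) \<and> (\<lambda>j. N (a j) * r ^ j) \<longlonglongrightarrow> 0}"

definition fin :: "(nat \<Rightarrow> 'a) set" where
  "fin = {a. (\<forall>j. a j \<in> A) \<and> finite {j. a j \<noteq> 0}}"

text \<open>A bound for the Banach norm is carried as a predicate with explicit \<open>M\<close>; it
  includes membership of the coefficients, and no supremum has to be known finite.\<close>

definition bnd :: "real \<Rightarrow> (nat \<Rightarrow> 'a) \<Rightarrow> bool" where
  "bnd M a \<longleftrightarrow> (\<forall>j. a j \<in> A \<and> N (a j) * r ^ j \<le> M)"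

lemma bnd_nonneg: "bnd M a \<Longrightarrow> 0 \<le> M"
proof -
  assume "bnd M a"
  then have a: "a 0 \<in> A" "N (a 0) * r ^ 0 \<le> M" unfolding bnd_def by blast+
  show ?thesis using order_trans[OF N_nonneg[OF a(1)], of M] a(2) by simp
qed

lemma bnd_iff: "bnd M a \<longleftrightarrow> (\<forall>j. a j \<in> A \<and> N (a j) \<le> M / r ^ j)"
  using r_pos by (simp add: bnd_def pos_le_divide_eq)

lemma bnd_diff: "bnd M a \<Longrightarrow> bnd M b \<Longrightarrow> bnd M (a - b)"
  unfolding bnd_iff by (simp add: N_diff_le diff_in)

lemma bnd_mono: "bnd M a \<Longrightarrow> M \<le> M' \<Longrightarrow> bnd M' a"
  unfolding bnd_def by (meson order_trans)

lemma fin_bound: "a \<in> fin \<Longrightarrow> \<exists>n. \<forall>j\<ge>n. a j = 0"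

proof -
  assume "a \<in> fin"
  then obtain n where "\<forall>j\<in>{j. a j \<noteq> 0}. j < n" using finite_nat_set_iff_bounded by (auto simp: fin_def)
  then show ?thesis by (intro exI[of _ n]) (auto simp flip: not_le)
qed

lemma finI: "(\<And>j. a j \<in> A) \<Longrightarrow> (\<And>j. n \<le> j \<Longrightarrow> a j = 0) \<Longrightarrow> a \<in> fin"
proof -
  assume a: "\<And>j. a j \<in> A" "\<And>j. n \<le> j \<Longrightarrow> a j = 0"
  have "{j. a j \<noteq> 0} \<subseteq> {..<n}" using a(2) by (auto simp flip: not_le)
  then show ?thesis using a(1) by (auto simp: fin_def intro: finite_subset)
qed

lemma fin_subset_Car: "a \<in> fin \<Longrightarrow> a \<in> Car"
proof -
  assume a: "a \<in> fin"
  then obtain n where n: "\<And>j. n \<le> j \<Longrightarrow> a j = 0" using fin_bound by blast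
  have "(\<lambda>j. N (a j) * r ^ j) \<longlonglongrightarrow> 0"
    using n by (intro tendsto_eventually eventually_sequentiallyI[of n]) simp
  then show ?thesis using a by (simp add: fin_def Car_def)
qed

lemma Car_bnd: "a \<in> Car \<Longrightarrow> \<exists>M. bnd M a"
proof -
  assume a: "a \<in> Car"
  then have "Bseq (\<lambda>j. N (a j) * r ^ j)"
    by (intro convergent_imp_Bseq convergentI[of _ 0]) (auto simp: Car_def)
  then obtain M where "\<And>j. norm (N (a j) * r ^ j) \<le> M" by (auto simp: Bseq_def)
  then have "bnd M a" using a unfolding bnd_def Car_def by (auto intro: order_trans[OF abs_ge_self])
  then show ?thesis ..
qed

lemma fin_add: "a \<in> fin \<Longrightarrow> b \<in> fin \<Longrightarrow> a + b \<in> fin"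
proof -
  assume a: "a \<in> fin" and b: "b \<in> fin"
  then obtain n m where "\<forall>j\<ge>n. a j = 0" "\<forall>j\<ge>m. b j = 0" using fin_bound by metis
  then show ?thesis using a b by (intro finI[of _ "max n m"]) (auto simp: fin_def)
qed

text \<open>Truncation: the tail is small because the weighted norms tend to 0, so finite symbols
  are dense.\<close>

lemma Car_approx:
  assumes a: "a \<in> Car" and d: "0 < \<delta>"
  obtains a1 a2 where "a1 \<in> fin" "a2 \<in> Car" "bnd \<delta> a2" "a = a1 + a2"
proof -
  have "\<forall>\<^sub>F j in sequentially. N (a j) * r ^ j < \<delta>"
    using a d by (intro order_tendstoD) (auto simp: Car_def)
  then obtain n where n: "\<And>j. n \<le> j \<Longrightarrow> N (a j) * r ^ j < \<delta>" by (auto simp: eventually_sequentially)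
  define a1 where "a1 j = (if j < n then a j else 0)" for j
  define a2 where "a2 j = (if j < n then 0 else a j)" for j
  have aA: "a j \<in> A" for j using a by (auto simp: Car_def)
  have "a1 \<in> fin" using aA by (intro finI[of _ n]) (auto simp: a1_def)
  moreover have "bnd \<delta> a2" using n d aA by (auto simp: bnd_def a2_def less_imp_le)
  moreover have "(\<lambda>j. N (a2 j) * r ^ j) \<longlonglongrightarrow> 0"
  proof (rule Lim_transform_eventually)
    show "(\<lambda>j. N (a j) * r ^ j) \<longlonglongrightarrow> 0" using a by (simp add: Car_def)
    show "\<forall>\<^sub>F j in sequentially. N (a j) * r ^ j = N (a2 j) * r ^ j"
      by (intro eventually_sequentiallyI[of n]) (auto simp: a2_def)
  qed
  then have "a2 \<in> Car" using aA by (auto simp: Car_def a2_def)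
  moreover have "a = a1 + a2" by (auto simp: a1_def a2_def fun_eq_iff)
  ultimately show ?thesis using that by blast
qed

text \<open>The class of maps for which density arguments work: on \<open>Car\<close> they are
  determined by their values on \<open>fin\<close>. The image is only required to be bounded, since
  its membership in \<open>Car\<close> is itself obtained by density.\<close>

definition bounded_additive :: "((nat \<Rightarrow> 'a) \<Rightarrow> (nat \<Rightarrow> 'a)) \<Rightarrow> bool" where
  "bounded_additive F \<longleftrightarrow> (\<forall>a\<in>Car. \<forall>b\<in>Car. F (a + b) = F a + F b) \<and>
     (\<exists>C. \<forall>a\<in>Car. \<forall>M. bnd M a \<longrightarrow> bnd (C * M) (F a))"

lemma bounded_additive_in: "bounded_additive F \<Longrightarrow> a \<in> Car \<Longrightarrow> F a j \<in> A"
  unfolding bounded_additive_def using Car_bnd[of a] by (metis bnd_def)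

lemma bounded_additive_small:
  assumes "bounded_additive F" "0 < \<epsilon>"
  obtains \<delta> where "0 < \<delta>" "\<And>a. a \<in> Car \<Longrightarrow> bnd \<delta> a \<Longrightarrow> bnd \<epsilon> (F a)"
proof -
  obtain C where C: "\<And>a M. a \<in> Car \<Longrightarrow> bnd M a \<Longrightarrow> bnd (C * M) (F a)"
    using assms unfolding bounded_additive_def by blast
  define \<delta> where "\<delta> = \<epsilon> / (\<bar>C\<bar> + 1)"
  have d: "0 < \<delta>" using assms by (simp add: \<delta>_def)
  have "C * \<delta> \<le> (\<bar>C\<bar> + 1) * \<delta>" using d by (intro mult_right_mono) auto
  also have "\<dots> = \<epsilon>" by (simp add: \<delta>_def)
  finally have "C * \<delta> \<le> \<epsilon>" .
  then show ?thesis using that[OF d] C bnd_mono by blast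
qed

text \<open>Null sequences are closed among bounded ones: up to an error of norm at most
  \<epsilon>/2, \<open>F a\<close> is the image of a truncation.\<close>

lemma bounded_additive_Car:
  assumes F: "bounded_additive F" and fin: "\<And>a. a \<in> fin \<Longrightarrow> F a \<in> Car" and a: "a \<in> Car"
  shows "F a \<in> Car"
proof -
  have "\<forall>\<^sub>F j in sequentially. N (F a j) * r ^ j < \<epsilon>" if e: "0 < \<epsilon>" for \<epsilon>
  proof -
    obtain \<delta> where d: "0 < \<delta>" "\<And>a. a \<in> Car \<Longrightarrow> bnd \<delta> a \<Longrightarrow> bnd (\<epsilon> / 2) (F a)"
      using bounded_additive_small[OF F, of "\<epsilon> / 2"] e by auto
    obtain a1 a2 where a12: "a1 \<in> fin" "a2 \<in> Car" "bnd \<delta> a2" "a = a1 + a2" using Car_approx[OF a d(1)] .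
    have Fa: "F a = F a1 + F a2" using F a12 fin_subset_Car by (auto simp: bounded_additive_def)
    have "\<forall>\<^sub>F j in sequentially. N (F a1 j) * r ^ j < \<epsilon>"
      using fin[OF a12(1)] e by (intro order_tendstoD) (auto simp: Car_def)
    then show ?thesis
    proof eventually_elim
      case (elim j)
      have b: "F a2 j \<in> A" "N (F a2 j) * r ^ j \<le> \<epsilon> / 2" using d(2) a12 by (auto simp: bnd_def)
      have "N (F a j) \<le> max (N (F a1 j)) (N (F a2 j))"
        unfolding Fa using b fin[OF a12(1)] by (auto simp: Car_def intro: N_add)
      then have "N (F a j) * r ^ j \<le> max (N (F a1 j)) (N (F a2 j)) * r ^ j"
        using r_pos by (intro mult_right_mono) auto
      then show ?case using b e elim by (auto simp: max_def split: if_splits)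
    qed
  qed
  moreover have "F a j \<in> A" for j using F a by (rule bounded_additive_in)
  moreover from this have "0 \<le> N (F a j) * r ^ j" for j using r_pos by simp
  then have "(\<forall>\<^sub>F j in sequentially. y < N (F a j) * r ^ j)" if "y < 0" for y
    using that by (intro always_eventually) (auto intro: less_le_trans)
  ultimately show ?thesis by (auto simp: Car_def intro: order_tendstoI)
qed

lemma bounded_additive_eqI:
  assumes F: "bounded_additive F" and G: "bounded_additive G"
    and fin: "\<And>a. a \<in> fin \<Longrightarrow> F a = G a" and a: "a \<in> Car"
  shows "F a = G a"
proof
  fix j
  have "N (F a j - G a j) * r ^ j \<le> \<epsilon>" if e: "0 < \<epsilon>" for \<epsilon>
  proof -
    obtain \<delta>1 where d1: "0 < \<delta>1" "\<And>a. a \<in> Car \<Longrightarrow> bnd \<delta>1 a \<Longrightarrow> bnd \<epsilon> (F a)"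
      using bounded_additive_small[OF F e] by blast
    obtain \<delta>2 where d2: "0 < \<delta>2" "\<And>a. a \<in> Car \<Longrightarrow> bnd \<delta>2 a \<Longrightarrow> bnd \<epsilon> (G a)"
      using bounded_additive_small[OF G e] by blast
    obtain a1 a2 where a12: "a1 \<in> fin" "a2 \<in> Car" "bnd (min \<delta>1 \<delta>2) a2" "a = a1 + a2"
      using Car_approx[OF a, of "min \<delta>1 \<delta>2"] d1 d2 by auto
    have "F a = F a1 + F a2" "G a = G a1 + G a2"
      using F G a12 fin_subset_Car by (auto simp: bounded_additive_def)
    then have "F a - G a = F a2 - G a2" using fin[OF a12(1)] by simp
    moreover have "bnd \<epsilon> (F a2 - G a2)"
      using d1 d2 a12 bnd_mono[OF a12(3)] by (intro bnd_diff) auto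
    ultimately have "bnd \<epsilon> (F a - G a)" by simp
    then show ?thesis by (simp add: bnd_def)
  qed
  then have "N (F a j - G a j) * r ^ j \<le> 0" by (rule field_le_epsilon) simp
  moreover have "F a j \<in> A" "G a j \<in> A" using F G a by (auto intro: bounded_additive_in)
  moreover from this have nn: "0 \<le> N (F a j - G a j)" by (intro N_nonneg diff_in)
  moreover have "0 < r ^ j" using r_pos by simp
  ultimately have "N (F a j - G a j) = 0" by (auto simp: mult_le_0_iff)
  then show "F a j = G a j" using \<open>F a j \<in> A\<close> \<open>G a j \<in> A\<close> by (simp add: N_eq_0 diff_in)
qed

subsection \<open>The product\<close>

text \<open>The coefficient of \<partial>^k in \<partial>^i v. By Leibniz, \<partial>^i v_l
  \<partial>^l contains (i choose m) D^m(v_l) \<partial>^(i-m+l), and i-m+l = k means l = k+m-i; the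
  side condition makes this natural subtraction exact.\<close>

definition prod_term :: "(nat \<Rightarrow> 'a) \<Rightarrow> nat \<Rightarrow> nat \<Rightarrow> 'a" where
  "prod_term v k i = (\<Sum>m | m \<le> i \<and> i \<le> k + m. of_nat (i choose m) * (D ^^ m) (v (k + m - i)))"

definition prod :: "(nat \<Rightarrow> 'a) \<Rightarrow> (nat \<Rightarrow> 'a) \<Rightarrow> nat \<Rightarrow> 'a" where
  "prod u v = (\<lambda>k. lsum (\<lambda>i. u i * prod_term v k i))"

lemma prod_term_in: "(\<And>j. v j \<in> A) \<Longrightarrow> prod_term v k i \<in> A"
  unfolding prod_term_def by (intro sum_in of_nat_mult_in Dpow_in)

lemma prod_term_add: "(\<And>j. v j \<in> A) \<Longrightarrow> (\<And>j. v' j \<in> A) \<Longrightarrow> prod_term (v + v') k i = prod_term v k i + prod_term v' k i"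
  unfolding prod_term_def by (simp add: Dpow_add distrib_left sum.distrib)

lemma prod_term_bound:
  obtains C where "0 \<le> C"
    "\<And>u v M' k i. bnd M' v \<Longrightarrow> (\<And>j. u j \<in> A) \<Longrightarrow> N (u i * prod_term v k i) * r ^ k \<le> (N (u i) * r ^ i) * (C * M')"
proof -
  obtain C0 where C0: "\<And>a m. a \<in> A \<Longrightarrow> N ((D ^^ m) a) \<le> C0 * r ^ m * N a" using D_bound by blast
  \<comment> \<open>The constant of \<open>D_bound\<close> has no prescribed sign.\<close>
  define C where "C = max C0 0"
  have C: "N ((D ^^ m) a) \<le> C * r ^ m * N a" if "a \<in> A" for a m
  proof -
    have "C0 * r ^ m * N a \<le> C * r ^ m * N a"
      using that r_pos by (intro mult_right_mono) (auto simp: C_def)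
    then show ?thesis using C0[OF that, of m] by simp
  qed
  have C_nn: "0 \<le> C" by (simp add: C_def)
  have inner: "N (prod_term v k i) \<le> C * M' * r ^ i / r ^ k" if v: "bnd M' v" for v M' k i
    unfolding prod_term_def
  proof (intro N_sum_le)
    have vA: "v j \<in> A" for j using v by (simp add: bnd_def)
    show "0 \<le> C * M' * r ^ i / r ^ k" using C_nn bnd_nonneg[OF v] r_pos by simp
    fix m assume "m \<in> {m. m \<le> i \<and> i \<le> k + m}"
    then have m: "m \<le> i" "i \<le> k + m" by auto
    show "of_nat (i choose m) * (D ^^ m) (v (k + m - i)) \<in> A" using vA by simp
    have "N (of_nat (i choose m) * (D ^^ m) (v (k + m - i))) \<le> N ((D ^^ m) (v (k + m - i)))"
      using vA by (simp add: N_of_nat_mult)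
    also have "\<dots> \<le> C * r ^ m * N (v (k + m - i))" using vA by (rule C)
    also have "\<dots> \<le> C * r ^ m * (M' / r ^ (k + m - i))"
      using v C_nn r_pos by (intro mult_left_mono) (auto simp: bnd_def pos_le_divide_eq)
    \<comment> \<open>The exponent m of the derivative and the exponent -(k+m-i) of the coefficient
      add up to i-k whatever m is, so the bound is uniform over the inner sum.\<close>
    also have "\<dots> = C * M' * r ^ i / r ^ k"
    proof -
      have "r ^ k * r ^ m = r ^ i * r ^ (k + m - i)" using m by (simp flip: power_add)
      then show ?thesis using r_pos by (simp add: field_simps)
    qed
    finally show "N (of_nat (i choose m) * (D ^^ m) (v (k + m - i))) \<le> C * M' * r ^ i / r ^ k" .
  qed
  have "N (u i * prod_term v k i) * r ^ k \<le> (N (u i) * r ^ i) * (C * M')"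
    if v: "bnd M' v" and u: "\<And>j. u j \<in> A" for u v M' k i
  proof -
    have "N (u i * prod_term v k i) \<le> N (u i) * N (prod_term v k i)"
      using u v by (intro N_mult prod_term_in) (auto simp: bnd_def)
    also have "\<dots> \<le> N (u i) * (C * M' * r ^ i / r ^ k)" using inner[OF v] u by (intro mult_left_mono) auto
    finally show ?thesis using r_pos by (simp add: field_simps)
  qed
  then show ?thesis using that[OF C_nn] by blast
qed

lemma prod_sums:
  assumes u: "u \<in> Car" and v: "bnd M v"
  shows "sums_to (\<lambda>i. u i * prod_term v k i) (prod u v k)"
  unfolding prod_def
proof (rule sums_to_lsum)
  have uA: "u i \<in> A" for i using u by (simp add: Car_def)
  show A: "u i * prod_term v k i \<in> A" for i using uA v by (intro mult_in prod_term_in) (auto simp: bnd_def)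
  obtain C where C: "0 \<le> C"
    "\<And>u v M' k i. bnd M' v \<Longrightarrow> (\<And>j. u j \<in> A) \<Longrightarrow> N (u i * prod_term v k i) * r ^ k \<le> (N (u i) * r ^ i) * (C * M')"
    using prod_term_bound by metis
  show "(\<lambda>i. N (u i * prod_term v k i)) \<longlonglongrightarrow> 0"
  proof (rule tendsto_0_le)
    show "(\<lambda>i. (N (u i) * r ^ i) * (C * M / r ^ k)) \<longlonglongrightarrow> 0"
      using u by (intro tendsto_mult_left_zero) (auto simp: Car_def)
    show "0 \<le> N (u i * prod_term v k i)" for i using A by simp
    show "N (u i * prod_term v k i) \<le> (N (u i) * r ^ i) * (C * M / r ^ k)" for i
      using C(2)[of M v u i k] v uA r_pos by (simp add: field_simps)
  qed
qed

lemma prod_bnd: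
  obtains C where "0 \<le> C" "\<And>u v M M'. u \<in> Car \<Longrightarrow> bnd M u \<Longrightarrow> bnd M' v \<Longrightarrow> bnd (C * M * M') (prod u v)"
proof -
  obtain C where C: "0 \<le> C"
    "\<And>u v M' k i. bnd M' v \<Longrightarrow> (\<And>j. u j \<in> A) \<Longrightarrow> N (u i * prod_term v k i) * r ^ k \<le> (N (u i) * r ^ i) * (C * M')"
    using prod_term_bound by metis
  have "bnd (C * M * M') (prod u v)" if "u \<in> Car" "bnd M u" "bnd M' v" for u v M M'
    unfolding bnd_def
  proof safe
    fix k
    have s: "sums_to (\<lambda>i. u i * prod_term v k i) (prod u v k)" using that by (intro prod_sums)
    then show "prod u v k \<in> A" by (simp add: sums_to_def)
    have "N (u i * prod_term v k i) \<le> C * M * M' / r ^ k" for i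
    proof -
      have "N (u i * prod_term v k i) * r ^ k \<le> (N (u i) * r ^ i) * (C * M')"
        using that by (intro C(2)) (auto simp: bnd_def)
      also have "\<dots> \<le> M * (C * M')"
        using that(2) C(1) bnd_nonneg[OF that(3)] by (intro mult_right_mono) (auto simp: bnd_def)
      finally show ?thesis using r_pos by (simp add: pos_le_divide_eq mult_ac)
    qed
    then have "N (prod u v k) \<le> C * M * M' / r ^ k" by (rule sums_to_bound[OF s])
    then show "N (prod u v k) * r ^ k \<le> C * M * M'" using r_pos by (simp add: field_simps)
  qed
  then show ?thesis using that C(1) by blast
qed

lemma bounded_additive_prod_left:
  assumes v: "v \<in> Car"
  shows "bounded_additive (\<lambda>u. prod u v)"
  unfolding bounded_additive_def
proof safe
  obtain M' where M': "bnd M' v" using Car_bnd[OF v] ..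
  obtain C where C: "\<And>u v M M'. u \<in> Car \<Longrightarrow> bnd M u \<Longrightarrow> bnd M' v \<Longrightarrow> bnd (C * M * M') (prod u v)"
    using prod_bnd by metis
  show "\<exists>C. \<forall>a\<in>Car. \<forall>M. bnd M a \<longrightarrow> bnd (C * M) (prod a v)"
    using C[OF _ _ M'] by (intro exI[of _ "C * M'"]) (auto simp: mult_ac)
  fix a b assume ab: "a \<in> Car" "b \<in> Car"
  show "prod (a + b) v = prod a v + prod b v"
  proof
    fix k
    have "sums_to (\<lambda>i. a i * prod_term v k i + b i * prod_term v k i) (prod a v k + prod b v k)"
      using ab M' by (intro sums_to_add prod_sums)
    then have "lsum (\<lambda>i. (a + b) i * prod_term v k i) = prod a v k + prod b v k"
      by (intro lsum_eq) (simp add: distrib_right)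
    then show "prod (a + b) v k = (prod a v + prod b v) k" by (simp add: prod_def)
  qed
qed

lemma bounded_additive_prod_right:
  assumes u: "u \<in> Car"
  shows "bounded_additive (prod u)"
  unfolding bounded_additive_def
proof safe
  obtain M where M: "bnd M u" using Car_bnd[OF u] ..
  obtain C where C: "\<And>u v M M'. u \<in> Car \<Longrightarrow> bnd M u \<Longrightarrow> bnd M' v \<Longrightarrow> bnd (C * M * M') (prod u v)"
    using prod_bnd by metis
  show "\<exists>C. \<forall>a\<in>Car. \<forall>M. bnd M a \<longrightarrow> bnd (C * M) (prod u a)"
    using C[OF u M] by blast
  fix a b assume ab: "a \<in> Car" "b \<in> Car"
  obtain Ma Mb where Mab: "bnd Ma a" "bnd Mb b" using Car_bnd ab by metis
  have in_A: "a j \<in> A" "b j \<in> A" for j using ab by (auto simp: Car_def)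
  show "prod u (a + b) = prod u a + prod u b"
  proof
    fix k
    have "sums_to (\<lambda>i. u i * prod_term a k i + u i * prod_term b k i) (prod u a k + prod u b k)"
      using u Mab by (intro sums_to_add prod_sums)
    then have "lsum (\<lambda>i. u i * prod_term (a + b) k i) = prod u a k + prod u b k"
      by (intro lsum_eq) (simp add: distrib_left prod_term_add in_A)
    then show "prod u (a + b) k = (prod u a + prod u b) k" by (simp add: prod_def)
  qed
qed

lemma prod_fin_eq:
  assumes u: "\<And>i. n \<le> i \<Longrightarrow> u i = 0" "\<And>i. u i \<in> A" and v: "\<And>i. v i \<in> A"
  shows "prod u v k = (\<Sum>i<n. u i * prod_term v k i)"
  unfolding prod_def using assms by (intro lsum_eq sums_to_finite mult_in prod_term_in) auto

lemma prod_fin_0: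
  assumes u: "\<And>i. n \<le> i \<Longrightarrow> u i = 0" "\<And>i. u i \<in> A" and v: "\<And>i. n \<le> i \<Longrightarrow> v i = 0" "\<And>i. v i \<in> A"
    and k: "2 * n \<le> k"
  shows "prod u v k = 0"
proof -
  have "prod_term v k i = 0" if "i < n" for i
    unfolding prod_term_def using that k v by (intro sum.neutral) auto
  then show ?thesis using prod_fin_eq[OF u v(2)] by simp
qed

lemma fin_common_bound:
  assumes "u \<in> fin" "v \<in> fin"
  obtains n where "\<And>i. n \<le> i \<Longrightarrow> u i = 0" "\<And>i. n \<le> i \<Longrightarrow> v i = 0"
proof -
  obtain n m where "\<forall>j\<ge>n. u j = 0" "\<forall>j\<ge>m. v j = 0" using fin_bound assms by metis
  then show ?thesis using that[of "max n m"] by simp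
qed

lemma prod_fin: "u \<in> fin \<Longrightarrow> v \<in> fin \<Longrightarrow> prod u v \<in> fin"
proof -
  assume uv: "u \<in> fin" "v \<in> fin"
  obtain n where n: "\<And>i. n \<le> i \<Longrightarrow> u i = 0" "\<And>i. n \<le> i \<Longrightarrow> v i = 0" using fin_common_bound[OF uv] by blast
  have A: "u i \<in> A" "v i \<in> A" for i using uv by (auto simp: fin_def)
  show ?thesis
  proof (rule finI[of _ "2 * n"])
    show "prod u v j \<in> A" for j
      using prod_fin_eq[OF n(1) A(1) A(2)] A by (simp add: prod_term_in)
    show "prod u v j = 0" if "2 * n \<le> j" for j using prod_fin_0[OF n(1) A(1) n(2) A(2) that] .
  qed
qed

text \<open>Density twice, once in each argument.\<close>

lemma prod_Car: "u \<in> Car \<Longrightarrow> v \<in> Car \<Longrightarrow> prod u v \<in> Car"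
  using bounded_additive_Car[OF bounded_additive_prod_right] bounded_additive_Car[OF bounded_additive_prod_left]
    prod_fin fin_subset_Car by metis

subsection \<open>Operators defined by finite symbols\<close>

text \<open>These operators have commutator [L, g] = D g, as D + c does. The relation determines how
  powers of L move past functions, so the product formula for symbols holds with any such
  \<open>L\<close> in place of D.\<close>

definition twisted :: "('a \<Rightarrow> 'a) \<Rightarrow> bool" where
  "twisted L \<longleftrightarrow> (\<forall>f\<in>A. L f \<in> A) \<and> (\<forall>f\<in>A. \<forall>g\<in>A. L (f + g) = L f + L g) \<and>
     (\<forall>g\<in>A. \<forall>f\<in>A. L (g * f) = D g * f + g * L f)"

lemma twisted_D: "twisted D"
  by (simp add: twisted_def D_add D_mult)

lemma twisted_shift: "twisted L \<Longrightarrow> c \<in> A \<Longrightarrow> twisted (\<lambda>f. L f + c * f)"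
  by (simp add: twisted_def algebra_simps)

lemma twisted_pow_in [simp]: "twisted L \<Longrightarrow> f \<in> A \<Longrightarrow> (L ^^ n) f \<in> A"
  by (induction n) (auto simp: twisted_def)

lemma twisted_0: "twisted L \<Longrightarrow> L 0 = 0"
  unfolding twisted_def by (metis add_cancel_right_left zero_in)

lemma twisted_sum: "twisted L \<Longrightarrow> (\<And>i. i \<in> S \<Longrightarrow> f i \<in> A) \<Longrightarrow> L (sum f S) = (\<Sum>i\<in>S. L (f i))"
proof (induction S rule: infinite_finite_induct)
  case (insert x S)
  then have "L (f x + sum f S) = L (f x) + L (sum f S)" by (simp add: twisted_def)
  then show ?case using insert by simp
qed (auto simp: twisted_0)

lemma twisted_of_nat: "twisted L \<Longrightarrow> f \<in> A \<Longrightarrow> L (of_nat n * f) = of_nat n * L f"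
proof (induction n)
  case (Suc n)
  then have "L (f + of_nat n * f) = L f + L (of_nat n * f)" by (simp add: twisted_def)
  then show ?case using Suc by (simp add: distrib_right)
qed (auto simp: twisted_0)

lemma twisted_pow_add: "twisted L \<Longrightarrow> f \<in> A \<Longrightarrow> g \<in> A \<Longrightarrow> (L ^^ n) (f + g) = (L ^^ n) f + (L ^^ n) g"
  by (induction n) (auto simp: twisted_def twisted_pow_in)

lemma twisted_pow_0: "twisted L \<Longrightarrow> (L ^^ n) 0 = 0"
  by (induction n) (auto simp: twisted_0)

lemma twisted_pow_sum: "twisted L \<Longrightarrow> (\<And>i. i \<in> S \<Longrightarrow> f i \<in> A) \<Longrightarrow> (L ^^ n) (sum f S) = (\<Sum>i\<in>S. (L ^^ n) (f i))"
  by (induction S rule: infinite_finite_induct) (auto simp: twisted_pow_0 twisted_pow_add)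

text \<open>Pascal's rule for a family on which the operator raises either index. It serves twice:
  the terms D^m(g) L^k(f) give the Leibniz formula, and the terms b_m L^k(f), with L + c as the
  operator, give the expansion of (L + c)^n.\<close>

lemma twisted_binomial:
  assumes L: "twisted L" and T: "\<And>m k. T m k \<in> A" "\<And>m k. L (T m k) = T (Suc m) k + T m (Suc k)"
  shows "(L ^^ n) (T 0 0) = (\<Sum>m\<le>n. of_nat (n choose m) * T m (n - m))"
proof (induction n)
  case (Suc n)
  have "(L ^^ Suc n) (T 0 0) = L (\<Sum>m\<le>n. of_nat (n choose m) * T m (n - m))" using Suc by simp
  also have "\<dots> = (\<Sum>m\<le>n. of_nat (n choose m) * L (T m (n - m)))"
    using L T(1) by (simp add: twisted_sum twisted_of_nat)
  also have "\<dots> = (\<Sum>m\<le>n. of_nat (n choose m) * T (Suc m) (n - m)) + (\<Sum>m\<le>n. of_nat (n choose m) * T m (Suc n - m))"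
    by (simp add: T(2) distrib_left sum.distrib Suc_diff_le)
  \<comment> \<open>The added term contains n choose n+1 = 0; it aligns the range with that of the
    goal.\<close>
  also have "(\<Sum>m\<le>n. of_nat (n choose m) * T m (Suc n - m)) = (\<Sum>m\<le>Suc n. of_nat (n choose m) * T m (Suc n - m))"
    by (simp only: sum.atMost_Suc binomial_eq_0[OF lessI]) (simp only: of_nat_0 mult_zero_left add_0_right)
  also have "\<dots> = T 0 (Suc n) + (\<Sum>m\<le>n. of_nat (n choose Suc m) * T (Suc m) (n - m))"
    by (subst sum.atMost_Suc_shift) (simp only: binomial_n_0 of_nat_1 mult_1 diff_zero diff_Suc_Suc)
  also have "(\<Sum>m\<le>n. of_nat (n choose m) * T (Suc m) (n - m)) + (T 0 (Suc n) + (\<Sum>m\<le>n. of_nat (n choose Suc m) * T (Suc m) (n - m)))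
     = T 0 (Suc n) + (\<Sum>m\<le>n. of_nat (Suc n choose Suc m) * T (Suc m) (n - m))"
    by (simp add: distrib_right sum.distrib)
  also have "\<dots> = (\<Sum>m\<le>Suc n. of_nat (Suc n choose m) * T m (Suc n - m))"
    by (simp only: sum.atMost_Suc_shift[of _ n] binomial_n_0 of_nat_1 mult_1 diff_zero diff_Suc_Suc)
  finally show ?case .
qed simp

lemma twisted_leibniz:
  assumes "twisted L" "g \<in> A" "f \<in> A"
  shows "(L ^^ n) (g * f) = (\<Sum>m\<le>n. of_nat (n choose m) * ((D ^^ m) g * (L ^^ (n - m)) f))"
  using twisted_binomial[of L "\<lambda>m k. (D ^^ m) g * (L ^^ k) f" n] assms by (simp add: twisted_def)

text \<open>A finite symbol evaluated at \<open>L\<close> in place of \<partial>. The sum runs over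
  the support; \<open>opL_eq\<close> trades it for any range that is long enough.\<close>

definition opL :: "('a \<Rightarrow> 'a) \<Rightarrow> (nat \<Rightarrow> 'a) \<Rightarrow> 'a \<Rightarrow> 'a" where
  "opL L a f = (\<Sum>j | a j \<noteq> 0. a j * (L ^^ j) f)"

lemma opL_eq: "(\<And>j. n \<le> j \<Longrightarrow> a j = 0) \<Longrightarrow> opL L a f = (\<Sum>j<n. a j * (L ^^ j) f)"
  unfolding opL_def by (intro sum.mono_neutral_left) (auto simp flip: not_le)

lemma opL_in [simp]: "twisted L \<Longrightarrow> a \<in> fin \<Longrightarrow> f \<in> A \<Longrightarrow> opL L a f \<in> A"
  unfolding opL_def by (intro sum_in mult_in) (auto simp: fin_def)

lemma opL_add:
  assumes "a \<in> fin" "b \<in> fin"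
  shows "opL L (a + b) f = opL L a f + opL L b f"
proof -
  obtain n where n: "\<And>i. n \<le> i \<Longrightarrow> a i = 0" "\<And>i. n \<le> i \<Longrightarrow> b i = 0" using fin_common_bound[OF assms] by blast
  then have "opL L (a + b) f = (\<Sum>j<n. (a + b) j * (L ^^ j) f)" by (intro opL_eq) auto
  then show ?thesis using opL_eq[OF n(1)] opL_eq[OF n(2)] by (simp add: distrib_right sum.distrib)
qed

lemma opL_faithful:
  assumes ab: "a \<in> fin" "b \<in> fin" and eq: "\<And>f. f \<in> A \<Longrightarrow> opL D a f = opL D b f"
  shows "a = b"
proof
  fix j
  have ub: "(\<lambda>j. - b j) \<in> fin" using ab by (simp add: fin_def uminus_in)
  have c: "a + (\<lambda>j. - b j) \<in> fin" using ab ub by (intro fin_add)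
  have "opL D (\<lambda>j. - b j) f = - opL D b f" for f by (simp add: opL_def sum_negf)
  then have "opL D (a + (\<lambda>j. - b j)) f = 0" if "f \<in> A" for f using eq[OF that] ab ub by (simp add: opL_add)
  then have z: "(\<Sum>i | (a + (\<lambda>j. - b j)) i \<noteq> 0. (a + (\<lambda>j. - b j)) i * (D ^^ i) f) = 0" if "f \<in> A" for f
    using that unfolding opL_def by blast
  have "(a + (\<lambda>j. - b j)) j = 0"
  proof (rule faithful)
    show "(a + (\<lambda>j. - b j)) j \<in> A" for j using c by (simp add: fin_def)
    show "finite {j. (a + (\<lambda>j. - b j)) j \<noteq> 0}" using c unfolding fin_def by blast
  qed (rule z)
  then show "a j = b j" by simp
qed

text \<open>Both symbols have degree below n, so the product lives below 2 n and all sums are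
  finite. What remains is the Leibniz formula for L^i (v_l L^l f), summed over l.\<close>

lemma opL_prod:
  assumes L: "twisted L" and u: "u \<in> fin" and v: "v \<in> fin" and f: "f \<in> A"
  shows "opL L (prod u v) f = opL L u (opL L v f)"
proof -
  obtain n where n: "\<And>i. n \<le> i \<Longrightarrow> u i = 0" "\<And>i. n \<le> i \<Longrightarrow> v i = 0" using fin_common_bound[OF u v] by blast
  have A: "u i \<in> A" "v i \<in> A" for i using u v by (auto simp: fin_def)
  define t where "t k m i = of_nat (i choose m) * (D ^^ m) (v (k + m - i)) * (L ^^ k) f" for k m i
  have inner: "(\<Sum>k<2*n. prod_term v k i * (L ^^ k) f) = (L ^^ i) (opL L v f)" if i: "i < n" for i
  proof -
    have "(\<Sum>k<2*n. prod_term v k i * (L ^^ k) f) = (\<Sum>k<2*n. \<Sum>m | m \<le> i \<and> i \<le> k + m. t k m i)"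
      by (simp add: prod_term_def sum_distrib_right t_def)
    also have "\<dots> = (\<Sum>k<2*n. \<Sum>m\<le>i. if i \<le> k + m then t k m i else 0)"
      by (intro sum.cong refl sum.mono_neutral_cong_left) auto
    also have "\<dots> = (\<Sum>m\<le>i. \<Sum>k<2*n. if i \<le> k + m then t k m i else 0)"
      by (rule sum.swap)
    also have "\<dots> = (\<Sum>m\<le>i. \<Sum>l<n. of_nat (i choose m) * ((D ^^ m) (v l) * (L ^^ (i - m)) ((L ^^ l) f)))"
    proof (rule sum.cong[OF refl])
      fix m assume m: "m \<in> {..i}"
      \<comment> \<open>Substitute k = l + (i - m), so that l becomes the index of v. As i < n,
        every l < n gives k < 2 n; any other k either violates i <= k + m or carries a coefficient
        of v with index at least n.\<close>
      have "(\<Sum>k<2*n. if i \<le> k + m then t k m i else 0) = (\<Sum>k\<in>(\<lambda>l. l + (i - m)) ` {..<n}. t k m i)"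
      proof (rule sum.mono_neutral_cong_right)
        show "\<forall>k\<in>{..<2 * n} - (\<lambda>l. l + (i - m)) ` {..<n}. (if i \<le> k + m then t k m i else 0) = 0"
        proof
          fix k assume k: "k \<in> {..<2 * n} - (\<lambda>l. l + (i - m)) ` {..<n}"
          show "(if i \<le> k + m then t k m i else 0) = 0"
          proof (cases "i \<le> k + m")
            case True
            then have "k = (k + m - i) + (i - m)" using m by auto
            then have "\<not> k + m - i < n" using k by blast
            then show ?thesis using n(2) by (simp add: t_def)
          qed simp
        qed
      qed (use i m in auto)
      also have "\<dots> = (\<Sum>l<n. t (l + (i - m)) m i)"
        by (subst sum.reindex) (auto simp: inj_on_def)
      also have "\<dots> = (\<Sum>l<n. of_nat (i choose m) * ((D ^^ m) (v l) * (L ^^ (i - m)) ((L ^^ l) f)))"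
      proof (intro sum.cong refl)
        fix l :: nat
        have "(L ^^ (l + (i - m))) f = (L ^^ (i - m)) ((L ^^ l) f)"
          by (subst add.commute) (simp add: funpow_add)
        then show "t (l + (i - m)) m i = of_nat (i choose m) * ((D ^^ m) (v l) * (L ^^ (i - m)) ((L ^^ l) f))"
          using m by (simp add: t_def mult.assoc)
      qed
      finally show "(\<Sum>k<2*n. if i \<le> k + m then t k m i else 0)
        = (\<Sum>l<n. of_nat (i choose m) * ((D ^^ m) (v l) * (L ^^ (i - m)) ((L ^^ l) f)))" .
    qed
    also have "\<dots> = (\<Sum>l<n. \<Sum>m\<le>i. of_nat (i choose m) * ((D ^^ m) (v l) * (L ^^ (i - m)) ((L ^^ l) f)))"
      by (rule sum.swap)
    also have "\<dots> = (\<Sum>l<n. (L ^^ i) (v l * (L ^^ l) f))"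
      using L A f by (simp add: twisted_leibniz)
    also have "\<dots> = (L ^^ i) (opL L v f)"
      using L A f by (simp only: opL_eq[OF n(2)]) (subst twisted_pow_sum; simp)
    finally show ?thesis .
  qed
  have "opL L (prod u v) f = (\<Sum>k<2*n. prod u v k * (L ^^ k) f)"
    by (intro opL_eq prod_fin_0[OF n(1) A(1) n(2) A(2)])
  also have "\<dots> = (\<Sum>k<2*n. \<Sum>i<n. u i * (prod_term v k i * (L ^^ k) f))"
    using prod_fin_eq[OF n(1) A(1) A(2)] by (simp add: sum_distrib_right mult.assoc)
  also have "\<dots> = (\<Sum>i<n. \<Sum>k<2*n. u i * (prod_term v k i * (L ^^ k) f))" by (rule sum.swap)
  also have "\<dots> = (\<Sum>i<n. u i * (L ^^ i) (opL L v f))"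
    by (intro sum.cong refl) (simp add: inner flip: sum_distrib_left)
  also have "\<dots> = opL L u (opL L v f)" by (simp add: opL_eq[OF n(1)])
  finally show ?thesis .
qed

subsection \<open>Shifting the derivation\<close>

text \<open>The coefficient of \<partial>^k after the substitution: the power \<partial>^n
  contributes its term with n - m = k, that is n = k + m.\<close>

definition conj :: "(nat \<Rightarrow> 'a) \<Rightarrow> (nat \<Rightarrow> 'a) \<Rightarrow> nat \<Rightarrow> 'a" where
  "conj \<beta> a = (\<lambda>k. lsum (\<lambda>m. of_nat ((k + m) choose m) * (a (k + m) * \<beta> m)))"

(* The b_m of the opening comment. *)
primrec bet :: "'a \<Rightarrow> nat \<Rightarrow> 'a" where
  "bet c 0 = e"
| "bet c (Suc m) = D (bet c m) + c * bet c m"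

lemma bet_in [simp]: "c \<in> A \<Longrightarrow> bet c m \<in> A"
  by (induction m) auto

lemma twisted_shift_pow:
  assumes L: "twisted L" and c: "c \<in> A" and f: "f \<in> A"
  shows "((\<lambda>f. L f + c * f) ^^ n) f = (\<Sum>m\<le>n. of_nat (n choose m) * (bet c m * (L ^^ (n - m)) f))"
proof -
  have "twisted (\<lambda>f. L f + c * f)" using L c by (rule twisted_shift)
  then have "((\<lambda>f. L f + c * f) ^^ n) (bet c 0 * (L ^^ 0) f) = (\<Sum>m\<le>n. of_nat (n choose m) * (bet c m * (L ^^ (n - m)) f))"
  proof (rule twisted_binomial)
    show "bet c m * (L ^^ k) f \<in> A" for m k using assms by simp
    show "L (bet c m * (L ^^ k) f) + c * (bet c m * (L ^^ k) f) = bet c (Suc m) * (L ^^ k) f + bet c m * (L ^^ (Suc k)) f" for m k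
    proof -
      have "L (bet c m * (L ^^ k) f) = D (bet c m) * (L ^^ k) f + bet c m * L ((L ^^ k) f)"
        using assms twisted_pow_in[OF L f, of k] unfolding twisted_def by (metis bet_in)
      then show ?thesis by (simp add: algebra_simps)
    qed
  qed
  then show ?thesis using f by simp
qed

lemma conj_fin_eq:
  assumes a: "\<And>i. n \<le> i \<Longrightarrow> a i = 0" "\<And>i. a i \<in> A" and c: "c \<in> A"
  shows "conj (bet c) a k = (\<Sum>m<n. of_nat ((k + m) choose m) * (a (k + m) * bet c m))"
  unfolding conj_def using assms by (intro lsum_eq sums_to_finite) auto

lemma conj_fin:
  assumes a: "a \<in> fin" and c: "c \<in> A"
  shows "conj (bet c) a \<in> fin"
proof -
  obtain n where n: "\<And>i. n \<le> i \<Longrightarrow> a i = 0" using fin_bound[OF a] by blast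
  have A: "a i \<in> A" for i using a by (simp add: fin_def)
  show ?thesis using n A c by (intro finI[of _ n]) (auto simp: conj_fin_eq[OF n A c])
qed

text \<open>The double sum over k and m is regrouped by j = k + m, which produces the binomial
  expansion of (L + c)^j. \<open>L\<close> stays general because \<open>conj_conj_fin\<close> also
  applies this to D - c.\<close>

lemma opL_conj:
  assumes L: "twisted L" and a: "a \<in> fin" and c: "c \<in> A" and f: "f \<in> A"
  shows "opL L (conj (bet c) a) f = opL (\<lambda>f. L f + c * f) a f"
proof -
  obtain n where n: "\<And>i. n \<le> i \<Longrightarrow> a i = 0" using fin_bound[OF a] by blast
  have A: "a i \<in> A" for i using a by (simp add: fin_def)
  define t where "t j m = of_nat (j choose m) * (a j * bet c m) * (L ^^ (j - m)) f" for j m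
  have "opL L (conj (bet c) a) f = (\<Sum>k<n. conj (bet c) a k * (L ^^ k) f)"
    by (intro opL_eq) (simp add: conj_fin_eq[OF n A c] n)
  also have "\<dots> = (\<Sum>k<n. \<Sum>m<n. t (k + m) m)"
    by (simp add: conj_fin_eq[OF n A c] sum_distrib_right t_def)
  also have "\<dots> = (\<Sum>(k,m)\<in>{..<n}\<times>{..<n}. t (k + m) m)" by (simp add: sum.cartesian_product)
  also have "\<dots> = (\<Sum>(j,m)\<in>Sigma {..<n} (\<lambda>j. {..j}). t j m)"
  \<comment> \<open>Pairs with k + m >= n drop out, since \<open>a\<close> vanishes there.\<close>
  proof (rule sum.reindex_bij_witness_not_neutral[where S' = "{(k, m). n \<le> k + m} \<inter> {..<n}\<times>{..<n}" and T' = "{}"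
        and j = "\<lambda>(k,m). (k + m, m)" and i = "\<lambda>(j,m). (j - m, m)"])
  qed (auto simp: t_def n)
  also have "\<dots> = (\<Sum>j<n. \<Sum>m\<le>j. t j m)" by (simp add: sum.Sigma)
  also have "\<dots> = (\<Sum>j<n. a j * ((\<lambda>f. L f + c * f) ^^ j) f)"
    unfolding twisted_shift_pow[OF L c f] t_def sum_distrib_left
    by (intro sum.cong refl) (simp add: mult_ac)
  also have "\<dots> = opL (\<lambda>f. L f + c * f) a f" by (simp add: opL_eq[OF n])
  finally show ?thesis .
qed

text \<open>Both sides act as the composite of u and v evaluated at D + c; faithfulness turns this
  into an identity of symbols.\<close>

lemma conj_prod_fin:
  assumes "u \<in> fin" "v \<in> fin" "c \<in> A"
  shows "conj (bet c) (prod u v) = prod (conj (bet c) u) (conj (bet c) v)"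
proof (rule opL_faithful)
  fix f assume f: "f \<in> A"
  show "opL D (conj (bet c) (prod u v)) f = opL D (prod (conj (bet c) u) (conj (bet c) v)) f"
    using assms f twisted_D twisted_shift[OF twisted_D, of c]
    by (simp add: opL_conj opL_prod prod_fin conj_fin)
qed (use assms in \<open>auto intro: conj_fin prod_fin\<close>)

text \<open>Evaluated at D, the left side is \<open>a\<close> evaluated at (D - c) + c.\<close>

lemma conj_conj_fin:
  assumes "a \<in> fin" "c \<in> A"
  shows "conj (bet (- c)) (conj (bet c) a) = a"
proof (rule opL_faithful)
  fix f assume f: "f \<in> A"
  have "twisted (\<lambda>f. D f + - c * f)" using assms by (intro twisted_shift twisted_D uminus_in)
  then show "opL D (conj (bet (- c)) (conj (bet c) a)) f = opL D a f"
    using assms f twisted_D uminus_in[OF assms(2)] opL_conj[of D "conj (bet c) a" "- c" f]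
      opL_conj[of "\<lambda>f. D f + - c * f" a c f]
    by (simp add: conj_fin)
qed (use assms in \<open>auto intro: conj_fin uminus_in\<close>)

end

section \<open>Bounded substitutions in the completed algebra\<close>

locale bounded_shift = nonarch_diff_algebra +
  fixes c :: 'a and B :: real
  assumes c_in: "c \<in> A"
    and bet_bound: "\<And>m. N (bet c m) \<le> B * r ^ m"
begin

lemma B_nonneg: "0 \<le> B"
  using order_trans[OF N_nonneg[OF e_in], of B] bet_bound[of 0] by simp

text \<open>The factor r^m bounding b_m completes |a_(k+m)| r^k to the weighted norm at k + m. The
  first form gives convergence in m, the second a bound independent of m.\<close>

lemma conj_term_bound:
  assumes "bnd M a"
  shows "N (of_nat ((k + m) choose m) * (a (k + m) * bet c m)) \<le> B * (N (a (k + m)) * r ^ (k + m)) / r ^ k"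
    "N (of_nat ((k + m) choose m) * (a (k + m) * bet c m)) \<le> B * M / r ^ k"
proof -
  have A: "a (k + m) \<in> A" using assms by (simp add: bnd_def)
  have "N (of_nat ((k + m) choose m) * (a (k + m) * bet c m)) \<le> N (a (k + m) * bet c m)"
    using A c_in by (simp add: N_of_nat_mult)
  also have "\<dots> \<le> N (a (k + m)) * N (bet c m)" using A c_in by (simp add: N_mult)
  also have "\<dots> \<le> N (a (k + m)) * (B * r ^ m)" using A by (intro mult_left_mono bet_bound) simp
  also have "\<dots> = B * (N (a (k + m)) * r ^ (k + m)) / r ^ k" using r_pos by (simp add: power_add field_simps)
  finally show *: "N (of_nat ((k + m) choose m) * (a (k + m) * bet c m)) \<le> B * (N (a (k + m)) * r ^ (k + m)) / r ^ k" .
  also have "\<dots> \<le> B * M / r ^ k" using assms B_nonneg r_pos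
    by (intro divide_right_mono mult_left_mono) (auto simp: bnd_def)
  finally show "N (of_nat ((k + m) choose m) * (a (k + m) * bet c m)) \<le> B * M / r ^ k" .
qed

lemma conj_sums:
  assumes a: "a \<in> Car"
  shows "sums_to (\<lambda>m. of_nat ((k + m) choose m) * (a (k + m) * bet c m)) (conj (bet c) a k)"
  unfolding conj_def
proof (rule sums_to_lsum)
  obtain M where M: "bnd M a" using Car_bnd[OF a] ..
  have A: "a i \<in> A" for i using a by (simp add: Car_def)
  show in_A: "of_nat ((k + m) choose m) * (a (k + m) * bet c m) \<in> A" for m using A c_in by simp
  show "(\<lambda>m. N (of_nat ((k + m) choose m) * (a (k + m) * bet c m))) \<longlonglongrightarrow> 0"
  proof (rule tendsto_0_le)
    have "(\<lambda>m. N (a (m + k)) * r ^ (m + k)) \<longlonglongrightarrow> 0"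
      using a by (intro LIMSEQ_ignore_initial_segment) (simp add: Car_def)
    then have "(\<lambda>m. (B / r ^ k) * (N (a (k + m)) * r ^ (k + m))) \<longlonglongrightarrow> 0"
      by (intro tendsto_mult_right_zero) (simp add: add.commute)
    then show "(\<lambda>m. B * (N (a (k + m)) * r ^ (k + m)) / r ^ k) \<longlonglongrightarrow> 0" by simp
  qed (use conj_term_bound(1)[OF M] in_A in auto)
qed

lemma conj_bnd:
  assumes a: "a \<in> Car" and M: "bnd M a"
  shows "bnd (B * M) (conj (bet c) a)"
  unfolding bnd_iff
proof safe
  fix k
  have s: "sums_to (\<lambda>m. of_nat ((k + m) choose m) * (a (k + m) * bet c m)) (conj (bet c) a k)"
    using a by (rule conj_sums)
  then show "conj (bet c) a k \<in> A" by (simp add: sums_to_def)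
  show "N (conj (bet c) a k) \<le> B * M / r ^ k" using s conj_term_bound(2)[OF M] by (rule sums_to_bound)
qed

lemma conj_add:
  assumes "a \<in> Car" "b \<in> Car"
  shows "conj (bet c) (a + b) = conj (bet c) a + conj (bet c) b"
proof
  fix k
  have "sums_to (\<lambda>m. of_nat ((k + m) choose m) * (a (k + m) * bet c m) + of_nat ((k + m) choose m) * (b (k + m) * bet c m))
     (conj (bet c) a k + conj (bet c) b k)"
    using assms by (intro sums_to_add conj_sums)
  then show "conj (bet c) (a + b) k = (conj (bet c) a + conj (bet c) b) k"
    unfolding conj_def[of _ "a + b"] by (subst lsum_eq) (auto simp: algebra_simps)
qed

lemma conj_mult:
  assumes "a \<in> Car" "s \<in> A"
  shows "conj (bet c) (\<lambda>j. s * a j) = (\<lambda>j. s * conj (bet c) a j)"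
proof
  fix k
  have "sums_to (\<lambda>m. s * (of_nat ((k + m) choose m) * (a (k + m) * bet c m))) (s * conj (bet c) a k)"
    using assms by (intro sums_to_mult conj_sums)
  then show "conj (bet c) (\<lambda>j. s * a j) k = s * conj (bet c) a k"
    unfolding conj_def[of _ "\<lambda>j. s * a j"] by (subst lsum_eq) (auto simp: algebra_simps)
qed

lemma bounded_additive_conj: "bounded_additive (conj (bet c))"
  unfolding bounded_additive_def using conj_add conj_bnd by blast

lemma conj_Car: "a \<in> Car \<Longrightarrow> conj (bet c) a \<in> Car"
  using bounded_additive_Car[OF bounded_additive_conj] conj_fin[OF _ c_in] fin_subset_Car by blast

end

context nonarch_diff_algebra
begin

lemma bounded_additive_comp:
  assumes F: "bounded_additive F" and G: "bounded_additive G" and FC: "\<And>a. a \<in> Car \<Longrightarrow> F a \<in> Car"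
  shows "bounded_additive (\<lambda>a. G (F a))"
proof -
  obtain CF where CF: "\<And>a M. a \<in> Car \<Longrightarrow> bnd M a \<Longrightarrow> bnd (CF * M) (F a)" using F unfolding bounded_additive_def by blast
  obtain CG where CG: "\<And>a M. a \<in> Car \<Longrightarrow> bnd M a \<Longrightarrow> bnd (CG * M) (G a)" using G unfolding bounded_additive_def by blast
  have "bnd (CG * CF * M) (G (F a))" if "a \<in> Car" "bnd M a" for a M
    using CG[OF FC[OF that(1)] CF[OF that]] by (simp add: mult.assoc)
  then show ?thesis using F G FC unfolding bounded_additive_def by metis
qed

lemma bounded_additive_id: "bounded_additive (\<lambda>a. a)"
  unfolding bounded_additive_def by (metis mult_1)

end

context bounded_shift
begin

lemma conj_prod:
  assumes u: "u \<in> Car" and v: "v \<in> Car"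
  shows "conj (bet c) (prod u v) = prod (conj (bet c) u) (conj (bet c) v)"
proof -
  \<comment> \<open>\<open>bounded_additive\<close> concerns one variable, so the identity is
    extended in u while v is finite, and afterwards in v.\<close>
  have fin_right: "conj (bet c) (prod u v) = prod (conj (bet c) u) (conj (bet c) v)" if v: "v \<in> fin" and u: "u \<in> Car" for u v
  proof (rule bounded_additive_eqI[OF _ _ _ u, of "\<lambda>u. conj (bet c) (prod u v)" "\<lambda>u. prod (conj (bet c) u) (conj (bet c) v)"])
    have v': "v \<in> Car" "conj (bet c) v \<in> Car" using v fin_subset_Car conj_Car by auto
    show "bounded_additive (\<lambda>u. conj (bet c) (prod u v))"
      using v' by (intro bounded_additive_comp[of "\<lambda>u. prod u v" "conj (bet c)"]
          bounded_additive_prod_left bounded_additive_conj prod_Car)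
    show "bounded_additive (\<lambda>u. prod (conj (bet c) u) (conj (bet c) v))"
      using v' by (intro bounded_additive_comp[of "conj (bet c)" "\<lambda>u. prod u (conj (bet c) v)"]
          bounded_additive_prod_left bounded_additive_conj conj_Car)
  qed (use v c_in conj_prod_fin in auto)
  show ?thesis
  proof (rule bounded_additive_eqI[OF _ _ _ v, of "\<lambda>v. conj (bet c) (prod u v)" "\<lambda>v. prod (conj (bet c) u) (conj (bet c) v)"])
    show "bounded_additive (\<lambda>v. conj (bet c) (prod u v))"
      using u by (intro bounded_additive_comp[of "\<lambda>v. prod u v" "conj (bet c)"]
          bounded_additive_prod_right bounded_additive_conj prod_Car)
    show "bounded_additive (\<lambda>v. prod (conj (bet c) u) (conj (bet c) v))"
      using u by (intro bounded_additive_comp[of "conj (bet c)" "\<lambda>v. prod (conj (bet c) u) v"]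
          bounded_additive_prod_right bounded_additive_conj conj_Car)
  qed (use u fin_right in auto)
qed

lemma conj_conj:
  assumes "bounded_shift A e N D r (- c) B'" "a \<in> Car"
  shows "conj (bet (- c)) (conj (bet c) a) = a"
proof -
  interpret neg: bounded_shift A e N D r "- c" B' by (rule assms)
  show ?thesis
    by (rule bounded_additive_eqI[OF _ _ _ assms(2), of "\<lambda>a. conj (bet (- c)) (conj (bet c) a)" "\<lambda>a. a"])
      (use c_in in \<open>auto intro!: bounded_additive_comp[of "conj (bet c)" "conj (bet (- c))"] bounded_additive_id
        bounded_additive_conj neg.bounded_additive_conj conj_Car conj_conj_fin\<close>)
qed

end

section \<open>Polynomials and rational functions over a p-adic field\<close>

locale padic_closed_field = padic_field w p for w :: "'a::{field_char_0,alg_closed_field} \<Rightarrow> real" and p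
begin

text \<open>A root of 1 + x + ... + x^(q-1); it differs from 1 because the sum at 1 is q, nonzero in
  characteristic zero.\<close>

lemma ex_prime_root_of_unity:
  assumes "prime q"
  obtains \<zeta> :: 'a where "\<zeta> \<noteq> 1" "\<zeta> ^ q = 1"
proof -
  have q: "2 \<le> q" using assms by (rule prime_ge_2_nat)
  obtain x :: 'a where x: "(\<Sum>k\<le>q - 1. 1 * x ^ k) = 0"
    using alg_closed[of "q - 1" "\<lambda>_. 1 :: 'a"] q by auto
  have "{..q - 1} = {..<q}" using q by auto
  then have s: "(\<Sum>k<q. x ^ k) = 0" using x by simp
  then have "x \<noteq> 1" using q by auto
  moreover have "x ^ q = 1" using power_diff_1_eq[of x q] s by simp
  ultimately show ?thesis using that by blast
qed

(* Averaging over the N-th roots of unity, for a large prime N different from p, isolates a single coefficient. *)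
lemma poly_coeff_bound:
  fixes f :: "'a poly"
  assumes M: "\<And>s. w s \<le> w t \<Longrightarrow> w (poly f s) \<le> M"
  shows "w (coeff f k) * w t ^ k \<le> M"
proof (cases "k \<le> degree f")
  case False
  have "0 \<le> w (poly f 0)" by simp
  also have "\<dots> \<le> M" by (rule M) simp
  finally show ?thesis using False by (simp add: coeff_eq_0)
next
  case k: True
  \<comment> \<open>q exceeds the degree, so exponents up to the degree are distinct modulo q; q
    exceeds p, so |q| = 1 and dividing by q costs nothing.\<close>
  obtain q where q: "prime q" "max (degree f) p < q" using bigger_prime by blast
  obtain \<zeta> :: 'a where \<zeta>: "\<zeta> \<noteq> 1" "\<zeta> ^ q = 1" using ex_prime_root_of_unity[OF q(1)] .
  have w\<zeta>: "w \<zeta> = 1"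
  proof -
    have "w \<zeta> ^ q = 1" using \<zeta> by (simp flip: w_power)
    then show ?thesis using q by (intro power_eq_imp_eq_base[of _ q 1]) auto
  qed
  have wq: "w (of_nat q) = 1"
  proof (rule w_of_nat_coprime)
    show "\<not> p dvd q" using q(2) primes_dvd_imp_eq[OF prime q(1)] by auto
  qed
  have pow_ne: "\<zeta> ^ l \<noteq> 1" if "\<not> q dvd l" for l
  proof
    assume l: "\<zeta> ^ l = 1"
    have "l \<noteq> 0" using that by (metis dvd_0_right)
    then obtain x y where "l * x = q * y + gcd l q" using bezout_nat by blast
    moreover have "gcd l q = 1" using q that by (metis coprime_commute coprime_imp_gcd_eq_1 prime_imp_coprime)
    ultimately have "(\<zeta> ^ l) ^ x = (\<zeta> ^ q) ^ y * \<zeta>" by (simp flip: power_mult)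
    then show False using l \<zeta> by simp
  qed
  have sum0: "(\<Sum>i<q. (\<zeta> ^ l) ^ i) = (if q dvd l then of_nat q else 0)" for l
  proof (cases "q dvd l")
    case True
    then have "\<zeta> ^ l = 1" using \<zeta> by (auto simp: power_mult)
    then show ?thesis using True by simp
  next
    case False
    have "(\<zeta> ^ l - 1) * (\<Sum>i<q. (\<zeta> ^ l) ^ i) = (\<zeta> ^ l) ^ q - 1" by (rule power_diff_1_eq[symmetric])
    also have "(\<zeta> ^ l) ^ q = 1" using \<zeta> by (metis mult.commute power_mult power_one)
    finally show ?thesis using pow_ne[OF False] False by simp
  qed
  \<comment> \<open>The weight \<zeta>^(i (q - k)) stands for \<zeta>^(-i k), with a natural
    exponent.\<close>
  define S where "S = (\<Sum>i<q. \<zeta> ^ (i * (q - k)) * poly f (\<zeta> ^ i * t))"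
  have "S = (\<Sum>i<q. \<Sum>j\<le>degree f. coeff f j * t ^ j * (\<zeta> ^ (q - k + j)) ^ i)"
    unfolding S_def poly_altdef sum_distrib_left
    by (intro sum.cong refl) (simp add: power_mult_distrib power_add mult_ac flip: power_mult)
  also have "\<dots> = (\<Sum>j\<le>degree f. coeff f j * t ^ j * (\<Sum>i<q. (\<zeta> ^ (q - k + j)) ^ i))"
    by (subst sum.swap) (simp add: sum_distrib_left)
  also have "\<dots> = (\<Sum>j\<le>degree f. if j = k then coeff f j * t ^ j * of_nat q else 0)"
  proof (intro sum.cong refl)
    fix j assume j: "j \<in> {..degree f}"
    \<comment> \<open>The number q - k + j lies strictly between 0 and 2 q, so it is divisible by q
      only if it equals q.\<close>
    have "q dvd q - k + j \<longleftrightarrow> j = k"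
    proof
      assume "q dvd q - k + j"
      then obtain c where c: "q - k + j = q * c" by (elim dvdE)
      have "q - k + j < q * 2" "0 < q - k + j" using q k j by auto
      then have "q * c < q * 2" "0 < q * c" using c by auto
      then have "c < 2" "0 < c" by auto
      then have "c = 1" by simp
      then have "q - k + j = q" using c by simp
      then show "j = k" using q(2) k by linarith
    qed (use q k in simp)
    then show "coeff f j * t ^ j * (\<Sum>i<q. (\<zeta> ^ (q - k + j)) ^ i) = (if j = k then coeff f j * t ^ j * of_nat q else 0)"
      by (simp add: sum0)
  qed
  also have "\<dots> = coeff f k * t ^ k * of_nat q" using k by simp
  finally have S: "S = coeff f k * t ^ k * of_nat q" .
  have "w S \<le> M"
    unfolding S_def
  proof (rule w_sum_le)
    show "0 \<le> M" using M[of 0] order_trans[OF w_nonneg] by simp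
    show "w (\<zeta> ^ (i * (q - k)) * poly f (\<zeta> ^ i * t)) \<le> M" for i
      using M[of "\<zeta> ^ i * t"] by (simp add: w_mult w_power w\<zeta>)
  qed
  then show ?thesis by (simp add: S w_mult w_power wq)
qed

lemma poly_bound:
  assumes "\<And>k. w (coeff f k) * w t ^ k \<le> M" "w h \<le> w t"
  shows "w (poly f h) \<le> M"
  unfolding poly_altdef
proof (rule w_sum_le)
  show "0 \<le> M" using assms(1)[of 0] order_trans[OF w_nonneg] by simp
  fix i
  have "w (coeff f i) * w h ^ i \<le> w (coeff f i) * w t ^ i" using assms(2) by (intro mult_left_mono power_mono) auto
  then show "w (coeff f i * h ^ i) \<le> M" using assms(1)[of i] by (simp add: w_mult w_power)
qed

text \<open>Cauchy estimates hold for the coefficients of f(a + s) as a polynomial in s. Splitting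
  off the first two with \<open>pCons\<close> leaves polynomials whose coefficients obey the same
  estimate divided by |t| and by |t|^2.\<close>

lemma poly_taylor:
  fixes f :: "'a poly"
  assumes t: "t \<noteq> 0" and M: "\<And>s. w s \<le> w t \<Longrightarrow> w (poly f (a + s)) \<le> M" and h: "w h \<le> w t"
  shows "w (poly f (a + h) - poly f a) \<le> M * (w h / w t)"
    "w (poly (pderiv f) a) \<le> M / w t"
    "w (poly f (a + h) - poly f a - poly (pderiv f) a * h) \<le> M * (w h / w t)\<^sup>2"
proof -
  define g where "g = pcompose f [:a, 1:]"
  have g: "poly g s = poly f (a + s)" for s by (simp add: g_def poly_pcompose)
  have cg: "w (coeff g k) * w t ^ k \<le> M" for k using M by (intro poly_coeff_bound) (simp add: g)
  obtain c0 g1 where g1: "g = pCons c0 g1" by (metis pCons_cases)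
  obtain c1 g2 where g2: "g1 = pCons c1 g2" by (metis pCons_cases)
  have c0: "c0 = poly f a" using g[of 0] g1 by simp
  have "poly (pderiv g) 0 = poly (pderiv f) a"
    by (simp add: g_def pderiv_pcompose poly_pcompose pderiv_pCons)
  then have c1: "c1 = poly (pderiv f) a" by (simp add: g1 g2 pderiv_pCons)
  have b1: "w (poly g1 h) \<le> M / w t"
  proof (rule poly_bound[OF _ h])
    show "w (coeff g1 k) * w t ^ k \<le> M / w t" for k
      using cg[of "Suc k"] t by (simp add: g1 field_simps)
  qed
  have b2: "w (poly g2 h) \<le> M / (w t)\<^sup>2"
  proof (rule poly_bound[OF _ h])
    show "w (coeff g2 k) * w t ^ k \<le> M / (w t)\<^sup>2" for k
      using cg[of "Suc (Suc k)"] t by (simp add: g1 g2 field_simps power2_eq_square)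
  qed
  have "poly g h = c0 + h * poly g1 h" by (simp add: g1)
  then have "poly f (a + h) - poly f a = h * poly g1 h" by (simp add: g c0)
  moreover have "w h * w (poly g1 h) \<le> w h * (M / w t)" using b1 by (intro mult_left_mono) auto
  ultimately show "w (poly f (a + h) - poly f a) \<le> M * (w h / w t)" by (simp add: w_mult field_simps)
  show "w (poly (pderiv f) a) \<le> M / w t" using cg[of 1] t c1 by (simp add: g1 g2 field_simps)
  have "poly f (a + h) - poly f a - poly (pderiv f) a * h = h * h * poly g2 h"
    using g[of h] c0 c1 g1 g2 by (simp add: algebra_simps)
  moreover have "w h * w h * w (poly g2 h) \<le> w h * w h * (M / (w t)\<^sup>2)" using b2 by (intro mult_left_mono) auto
  ultimately show "w (poly f (a + h) - poly f a - poly (pderiv f) a * h) \<le> M * (w h / w t)\<^sup>2"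
    by (simp add: w_mult power_divide power2_eq_square mult_ac)
qed

text \<open>A root z within |t| of a point a of Y would be a + s with s = z - a. Over an
  algebraically closed field f is thus built from roots far from Y.\<close>

lemma poly_far_roots:
  fixes f :: "'a poly"
  assumes Y: "Y \<noteq> {}" and f: "\<And>a s. a \<in> Y \<Longrightarrow> w s \<le> w t \<Longrightarrow> poly f (a + s) \<noteq> 0"
  obtains A where "f = smult (lead_coeff f) (\<Prod>x\<in>#A. [:-x, 1:])" "lead_coeff f \<noteq> 0"
    "\<And>z a. z \<in># A \<Longrightarrow> a \<in> Y \<Longrightarrow> w t < w (a - z)"
proof -
  have "f \<noteq> 0" using Y f[of _ 0] by auto
  then obtain A where A: "f = smult (lead_coeff f) (\<Prod>x\<in>#A. [:-x, 1:])"
    using alg_closed_imp_factorization by blast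
  have far: "w t < w (a - z)" if "z \<in># A" "a \<in> Y" for z a
  proof (rule ccontr)
    assume "\<not> w t < w (a - z)"
    then have "poly f z \<noteq> 0" using f[of a "z - a"] that by (simp add: w_diff_commute)
    moreover have "poly (\<Prod>x\<in>#A. [:-x, 1:]) z = 0" using that by (auto simp: poly_prod_mset)
    ultimately show False by (subst (asm) A) simp
  qed
  have "lead_coeff f \<noteq> 0" using \<open>f \<noteq> 0\<close> by simp
  with A show ?thesis using far by (rule that)
qed

lemma poly_root_factor:
  "poly (\<Prod>x\<in>#add_mset z A. [:-x, 1:]) b = (b - z) * poly (\<Prod>x\<in>#A. [:-x, 1:]) b"
  for z :: 'a
  by (simp add: algebra_simps)

text \<open>Each linear factor keeps its absolute value: |h| is smaller than |a - z|, so |a + h - z|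
  = |a - z|.\<close>

lemma poly_no_root_ball:
  fixes f :: "'a poly"
  assumes f: "\<And>s. w s \<le> w t \<Longrightarrow> poly f (a + s) \<noteq> 0" and h: "w h \<le> w t"
  shows "w (poly f (a + h)) = w (poly f a)"
proof -
  obtain A where A: "f = smult (lead_coeff f) (\<Prod>x\<in>#A. [:-x, 1:])"
    and far: "\<And>z. z \<in># A \<Longrightarrow> w t < w (a - z)"
    by (rule poly_far_roots[of "{a}" t f]) (use f in auto)
  from far have "w (poly (\<Prod>x\<in>#A. [:-x, 1:]) (a + h)) = w (poly (\<Prod>x\<in>#A. [:-x, 1:]) a)"
  proof (induction A)
    case (add z A)
    have "w h < w (a - z)" using add.prems[of z] h by simp
    then have "w (h + (a - z)) = w (a - z)" by (rule w_add_eq)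
    then have "w (a + h - z) = w (a - z)" by (simp add: algebra_simps)
    then show ?case using add by (simp only: poly_root_factor w_mult) simp
  qed simp
  then show ?thesis by (subst (1 2) A) (simp add: w_mult)
qed

text \<open>Each linear factor exceeds |t| on Y, so the leading coefficient and a power of |t| give
  the constant.\<close>

lemma poly_lower_bound:
  fixes f :: "'a poly"
  assumes f: "\<And>a s. a \<in> Y \<Longrightarrow> w s \<le> w t \<Longrightarrow> poly f (a + s) \<noteq> 0" and t: "t \<noteq> 0"
  shows "\<exists>m>0. \<forall>a\<in>Y. m \<le> w (poly f a)"
proof (cases "Y = {}")
  case False
  obtain A where A: "f = smult (lead_coeff f) (\<Prod>x\<in>#A. [:-x, 1:])" and lc: "lead_coeff f \<noteq> 0"
    and far: "\<And>z a. z \<in># A \<Longrightarrow> a \<in> Y \<Longrightarrow> w t < w (a - z)"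
    by (rule poly_far_roots[OF False f]) blast+
  have "w t ^ size A \<le> w (poly (\<Prod>x\<in>#A. [:-x, 1:]) a)" if "a \<in> Y" for a
    using far[OF _ that]
  proof (induction A)
    case (add z A)
    have "w t * w t ^ size A \<le> w (a - z) * w (poly (\<Prod>x\<in>#A. [:-x, 1:]) a)"
      using add by (intro mult_mono) (auto simp: less_imp_le)
    then show ?case by (simp only: poly_root_factor w_mult) simp
  qed simp
  then have "w (lead_coeff f) * w t ^ size A \<le> w (poly f a)" if "a \<in> Y" for a
    using that by (subst (2) A) (simp add: w_mult mult_left_mono)
  moreover have "0 < w (lead_coeff f) * w t ^ size A" using lc t by simp
  ultimately show ?thesis by blast
qed (auto intro: exI[of _ 1])

text \<open>|Q| is constant on the disc, so a bound for P/Q becomes one for P; the polynomial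
  estimates apply to P and Q, and dividing by Q restores the constant \<open>M\<close>.
  \<open>d\<close> is the derivative by the quotient rule.\<close>

lemma rat_taylor:
  fixes P Q :: "'a poly"
  assumes t: "t \<noteq> 0" and Q: "\<And>s. w s \<le> w t \<Longrightarrow> poly Q (a + s) \<noteq> 0"
    and M: "\<And>s. w s \<le> w t \<Longrightarrow> w (poly P (a + s) / poly Q (a + s)) \<le> M" and h: "w h \<le> w t"
  defines "R \<equiv> \<lambda>x. poly P x / poly Q x"
    and "d \<equiv> poly (pderiv P * Q - P * pderiv Q) a / poly (Q * Q) a"
  shows "w d \<le> M / w t" "w (R (a + h) - R a - d * h) \<le> M * (w h / w t)\<^sup>2"
proof -
  define q where "q = w (poly Q a)"
  have Qa: "poly Q a \<noteq> 0" "poly Q (a + h) \<noteq> 0" using Q[of 0] Q[OF h] by auto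
  have q: "0 < q" using Qa by (simp add: q_def)
  have wQ: "w (poly Q (a + s)) = q" if "w s \<le> w t" for s
    unfolding q_def using Q that by (rule poly_no_root_ball)
  have wP: "w (poly P (a + s)) \<le> M * q" if "w s \<le> w t" for s
    using M[OF that] wQ[OF that] q by (simp add: w_divide pos_divide_le_eq)
  have M0: "0 \<le> M" using M[of 0] order_trans[OF w_nonneg] by simp
  note P' = poly_taylor[OF t wP h]
  note Q' = poly_taylor[OF t eq_refl[OF wQ] h]
  have wRa: "w (R a) \<le> M" using M[of 0] by (simp add: R_def)
  have wRh: "w (R (a + h)) \<le> M" using M[OF h] by (simp add: R_def)
  define \<rho> where "\<rho> = w h / w t"
  have \<rho>: "0 \<le> \<rho>" using t by (simp add: \<rho>_def)
  have d: "d * poly Q a = poly (pderiv P) a - R a * poly (pderiv Q) a"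
    using Qa by (simp add: d_def R_def field_simps)
  have "w (R a) * w (poly (pderiv Q) a) \<le> M * (q / w t)"
    using wRa Q'(2) M0 by (intro mult_mono) auto
  then have "w (d * poly Q a) \<le> M * q / w t"
    unfolding d using P'(2) by (intro w_diff_le) (auto simp: w_mult)
  then have "w d * q \<le> M / w t * q" by (simp add: w_mult q_def)
  then show "w d \<le> M / w t" using q by (rule mult_right_le_imp_le)
  have RQ: "R a * poly Q a = poly P a" "R (a + h) * poly Q (a + h) = poly P (a + h)"
    using Qa by (auto simp: R_def)
  have e1: "w (R a * (poly Q (a + h) - poly Q a)) \<le> M * q * \<rho>"
    using mult_mono[OF wRa Q'(1) M0] by (simp add: w_mult \<rho>_def)
  have "(R (a + h) - R a) * poly Q (a + h) = (poly P (a + h) - poly P a) - R a * (poly Q (a + h) - poly Q a)"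
    using RQ by (simp add: algebra_simps)
  then have "w ((R (a + h) - R a) * poly Q (a + h)) \<le> M * q * \<rho>"
    using P'(1) e1 by (auto intro: w_diff_le simp: \<rho>_def)
  then have lip: "w (R (a + h) - R a) \<le> M * \<rho>" using wQ[OF h] q by (simp add: w_mult)
  \<comment> \<open>Multiplied by Q(a), the remainder of the quotient is the remainder of P, minus
    R(a) times the remainder of Q, minus a product of two increments, each of first order in
    h.\<close>
  have "(R (a + h) - R a - d * h) * poly Q a = (poly P (a + h) - poly P a - poly (pderiv P) a * h)
      - R a * (poly Q (a + h) - poly Q a - poly (pderiv Q) a * h) - (R (a + h) - R a) * (poly Q (a + h) - poly Q a)"
  proof -
    have P': "poly (pderiv P) a = d * poly Q a + R a * poly (pderiv Q) a" using d by simp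
    show ?thesis unfolding P' RQ[symmetric] by (simp add: algebra_simps)
  qed
  moreover have "w (R a * (poly Q (a + h) - poly Q a - poly (pderiv Q) a * h)) \<le> M * q * \<rho>\<^sup>2"
    using mult_mono[OF wRa Q'(3) M0] by (simp add: w_mult \<rho>_def mult_ac)
  moreover have "w ((R (a + h) - R a) * (poly Q (a + h) - poly Q a)) \<le> M * q * \<rho>\<^sup>2"
    using mult_mono[OF lip Q'(1)] M0 \<rho> by (simp add: w_mult \<rho>_def power2_eq_square mult_ac)
  moreover have "w (poly P (a + h) - poly P a - poly (pderiv P) a * h) \<le> M * q * \<rho>\<^sup>2"
    using P'(3) by (simp add: \<rho>_def)
  ultimately have "w ((R (a + h) - R a - d * h) * poly Q a) \<le> M * q * \<rho>\<^sup>2"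
    by (simp add: w_diff_le)
  then have "w (R (a + h) - R a - d * h) * q \<le> M * \<rho>\<^sup>2 * q" by (simp add: w_mult q_def mult_ac)
  then show "w (R (a + h) - R a - d * h) \<le> M * (w h / w t)\<^sup>2"
    unfolding \<rho>_def using q by (rule mult_right_le_imp_le)
qed

end

subsection \<open>Completeness\<close>

text \<open>The absolute value is a locale parameter, so convergence is spelled out for it; the
  notions serve both K with \<open>v\<close> and its closure with \<open>w\<close>.\<close>

definition (in nonarch_field) cauchy :: "(nat \<Rightarrow> 'a) \<Rightarrow> bool" where
  "cauchy F \<longleftrightarrow> (\<forall>\<epsilon>>0. \<exists>n0. \<forall>m\<ge>n0. \<forall>n\<ge>n0. w (F m - F n) < \<epsilon>)"

definition (in nonarch_field) conv :: "(nat \<Rightarrow> 'a) \<Rightarrow> 'a \<Rightarrow> bool" where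
  "conv F l \<longleftrightarrow> (\<forall>\<epsilon>>0. \<exists>n0. \<forall>n\<ge>n0. w (F n - l) < \<epsilon>)"

context nonarch_field
begin

lemma conv_cauchy:
  assumes "conv F l"
  shows "cauchy F"
  unfolding cauchy_def
proof (intro allI impI)
  fix \<epsilon> :: real assume "0 < \<epsilon>"
  then obtain n0 where n0: "\<And>n. n \<ge> n0 \<Longrightarrow> w (F n - l) < \<epsilon>" using assms unfolding conv_def by blast
  have "w (F m - F n) < \<epsilon>" if "m \<ge> n0" "n \<ge> n0" for m n
    using w_diff_trans_less[of "F m" l \<epsilon> "F n"] n0[OF that(1)] n0[OF that(2)] by (simp add: w_diff_commute)
  then show "\<exists>n0. \<forall>m\<ge>n0. \<forall>n\<ge>n0. w (F m - F n) < \<epsilon>" by blast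
qed

lemma convI_inverse_Suc:
  assumes "\<And>k. w (F k - l) < inverse (real (Suc k))"
  shows "conv F l"
  unfolding conv_def
proof (intro allI impI)
  fix \<epsilon> :: real assume "0 < \<epsilon>"
  then show "\<exists>n0. \<forall>k\<ge>n0. w (F k - l) < \<epsilon>"
    using inverse_Suc_small[of \<epsilon>] assms by (meson less_trans)
qed

lemma conv_unique:
  assumes "conv F l" "conv F l'"
  shows "l = l'"
proof (rule ccontr)
  assume "l \<noteq> l'"
  then have e: "0 < w (l - l')" by simp
  obtain n0 where n0: "\<And>n. n \<ge> n0 \<Longrightarrow> w (F n - l) < w (l - l')" using assms(1) e unfolding conv_def by blast
  obtain n1 where n1: "\<And>n. n \<ge> n1 \<Longrightarrow> w (F n - l') < w (l - l')" using assms(2) e unfolding conv_def by blast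
  have "w (l - l') < w (l - l')"
    using w_diff_trans_less[of l "F (max n0 n1)" "w (l - l')" l'] n0[of "max n0 n1"] n1[of "max n0 n1"]
    by (simp add: w_diff_commute)
  then show False by simp
qed

lemma conv_diff:
  assumes "conv F l" "conv G l'"
  shows "conv (\<lambda>n. F n - G n) (l - l')"
  unfolding conv_def
proof (intro allI impI)
  fix \<epsilon> :: real assume e: "0 < \<epsilon>"
  obtain n0 where n0: "\<And>n. n \<ge> n0 \<Longrightarrow> w (F n - l) < \<epsilon>" using assms(1) e unfolding conv_def by blast
  obtain n1 where n1: "\<And>n. n \<ge> n1 \<Longrightarrow> w (G n - l') < \<epsilon>" using assms(2) e unfolding conv_def by blast
  have "w (F n - G n - (l - l')) < \<epsilon>" if "n \<ge> max n0 n1" for n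
    using w_diff_less[of "F n - l" \<epsilon> "G n - l'"] n0[of n] n1[of n] that by (simp add: algebra_simps)
  then show "\<exists>n0. \<forall>n\<ge>n0. w (F n - G n - (l - l')) < \<epsilon>" by blast
qed

lemma conv_mult:
  assumes "conv F l"
  shows "conv (\<lambda>n. F n * c) (l * c)"
  unfolding conv_def
proof (intro allI impI)
  fix \<epsilon> :: real assume e: "0 < \<epsilon>"
  have wc: "0 < w c + 1" by (simp add: add_nonneg_pos)
  then obtain n0 where n0: "\<And>n. n \<ge> n0 \<Longrightarrow> w (F n - l) < \<epsilon> / (w c + 1)" using assms e unfolding conv_def by (meson divide_pos_pos)
  have "w (F n * c - l * c) < \<epsilon>" if "n \<ge> n0" for n
  proof -
    have "w (F n * c - l * c) = w (F n - l) * w c" by (simp flip: w_mult left_diff_distrib)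
    also have "\<dots> \<le> w (F n - l) * (w c + 1)" by (intro mult_left_mono) auto
    also have "\<dots> < \<epsilon>" using n0[OF that] wc by (simp add: pos_less_divide_eq)
    finally show ?thesis .
  qed
  then show "\<exists>n0. \<forall>n\<ge>n0. w (F n * c - l * c) < \<epsilon>" by blast
qed

lemma cauchy_diff:
  assumes "cauchy F" "cauchy G"
  shows "cauchy (\<lambda>n. F n - G n)"
  unfolding cauchy_def
proof (intro allI impI)
  fix \<epsilon> :: real assume e: "0 < \<epsilon>"
  obtain n0 where n0: "\<And>m n. m \<ge> n0 \<Longrightarrow> n \<ge> n0 \<Longrightarrow> w (F m - F n) < \<epsilon>" using assms(1) e unfolding cauchy_def by blast
  obtain n1 where n1: "\<And>m n. m \<ge> n1 \<Longrightarrow> n \<ge> n1 \<Longrightarrow> w (G m - G n) < \<epsilon>" using assms(2) e unfolding cauchy_def by blast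
  have "w (F m - G m - (F n - G n)) < \<epsilon>" if "m \<ge> max n0 n1" "n \<ge> max n0 n1" for m n
    using w_diff_less[of "F m - F n" \<epsilon> "G m - G n"] n0[of m n] n1[of m n] that by (simp add: algebra_simps)
  then show "\<exists>n0. \<forall>m\<ge>n0. \<forall>n\<ge>n0. w (F m - G m - (F n - G n)) < \<epsilon>" by blast
qed

end

section \<open>Finite-dimensional K-subspaces of the algebraic closure\<close>

locale ground =
  fixes p :: nat and v :: "'k::field_char_0 \<Rightarrow> real" and w :: "'k alg_closure \<Rightarrow> real"
  assumes ground: "ground_field p v w"

sublocale ground \<subseteq> padic_closed_field w p
proof
  show "nonarch_abs w" "prime p" using ground by (auto simp: ground_field_def)
  have "w (to_ac (of_nat p)) = v (of_nat p)" "v (of_nat p) = 1 / real p"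
    using ground unfolding ground_field_def by blast+
  then show "w (of_nat p) = 1 / real p" by simp
qed

sublocale ground \<subseteq> base: nonarch_field v
  using ground by unfold_locales (simp add: ground_field_def)

context ground
begin

lemma w_to_ac [simp]: "w (to_ac c) = v c"
  using ground by (simp add: ground_field_def)

lemma base_complete:
  assumes "base.cauchy F"
  shows "\<exists>l. base.conv F l"
proof -
  interpret Metric_space UNIV "\<lambda>a b. v (a - b)"
  proof
    fix a b c :: 'k
    show "0 \<le> v (a - b)" "v (a - b) = v (b - a)" "v (a - b) = 0 \<longleftrightarrow> a = b"
      by (auto simp: base.w_diff_commute)
    show "v (a - c) \<le> v (a - b) + v (b - c)"
      using base.w_add[of "a - b" "b - c", simplified] base.w_nonneg[of "a - b"] base.w_nonneg[of "b - c"]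
      by (smt (verit))
  qed
  have "mcomplete" using ground by (simp add: ground_field_def)
  moreover have "MCauchy F" using assms by (simp add: MCauchy_def base.cauchy_def)
  ultimately obtain l where "limitin mtopology F l sequentially" unfolding mcomplete_def by blast
  then show ?thesis by (auto simp: limitin_metric eventually_sequentially base.conv_def)
qed

definition kspan :: "(nat \<Rightarrow> 'k alg_closure) \<Rightarrow> nat \<Rightarrow> 'k alg_closure set" where
  "kspan b n = {\<Sum>i<n. to_ac (c i) * b i | c. True}"

lemma kspan_comb:
  assumes "x \<in> kspan b n" "y \<in> kspan b n"
  shows "to_ac s * x + to_ac s' * y \<in> kspan b n"
proof -
  obtain c c' where "x = (\<Sum>i<n. to_ac (c i) * b i)" "y = (\<Sum>i<n. to_ac (c' i) * b i)"
    using assms by (auto simp: kspan_def)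
  then have "to_ac s * x + to_ac s' * y = (\<Sum>i<n. to_ac (s * c i + s' * c' i) * b i)"
    by (simp add: sum_distrib_left sum.distrib algebra_simps)
  then show ?thesis unfolding kspan_def by (intro CollectI exI[of _ "\<lambda>i. s * c i + s' * c' i"]) auto
qed

lemma kspan_Suc: "x \<in> kspan b (Suc n) \<longleftrightarrow> (\<exists>y\<in>kspan b n. \<exists>c. x = y + to_ac c * b n)"
proof
  assume "x \<in> kspan b (Suc n)"
  then show "\<exists>y\<in>kspan b n. \<exists>c. x = y + to_ac c * b n" by (auto simp: kspan_def)
next
  assume "\<exists>y\<in>kspan b n. \<exists>c. x = y + to_ac c * b n"
  then obtain f c where "x = (\<Sum>i<n. to_ac (f i) * b i) + to_ac c * b n" by (auto simp: kspan_def)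
  then have "x = (\<Sum>i<Suc n. to_ac ((f(n := c)) i) * b i)" by simp
  then show "x \<in> kspan b (Suc n)" unfolding kspan_def by blast
qed

text \<open>By induction the span of the earlier vectors is complete, hence closed, so a vector
  outside it has positive distance from it. This bounds the last coordinate by the norm and makes it
  Cauchy in K. The lemma stands in for completeness of the closure, which may fail.\<close>

lemma kspan_complete:
  assumes "\<And>k. F k \<in> kspan b n" "cauchy F"
  shows "\<exists>l\<in>kspan b n. conv F l"
  using assms
proof (induction n arbitrary: F)
  case 0
  then have "F k = 0" for k by (simp add: kspan_def)
  then show ?case by (auto simp: kspan_def conv_def)
next
  case (Suc n)
  show ?case
  proof (cases "b n \<in> kspan b n")
    case True
    have "F k \<in> kspan b n" for k
    proof -
      obtain y c where "y \<in> kspan b n" "F k = y + to_ac c * b n" using Suc.prems(1) kspan_Suc by blast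
      then show ?thesis using kspan_comb[of y b n "b n" 1 c] True by simp
    qed
    then obtain l where "l \<in> kspan b n" "conv F l" using Suc by blast
    moreover have "l \<in> kspan b (Suc n)" using calculation kspan_Suc[of l b n] by (metis add.right_neutral mult_zero_left to_ac_0)
    ultimately show ?thesis by blast
  next
    case False
    have "\<exists>\<delta>>0. \<forall>x\<in>kspan b n. \<delta> \<le> w (x - b n)"
    proof (rule ccontr)
      assume "\<not> ?thesis"
      then have "\<forall>k. \<exists>x. x \<in> kspan b n \<and> w (x - b n) < inverse (real (Suc k))"
        by (metis not_le inverse_positive_iff_positive of_nat_0_less_iff zero_less_Suc)
      then obtain G where G: "\<And>k. G k \<in> kspan b n" "\<And>k. w (G k - b n) < inverse (real (Suc k))" by metis
      have "conv G (b n)" using G(2) by (rule convI_inverse_Suc)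
      moreover obtain l where "l \<in> kspan b n" "conv G l" using Suc.IH[OF G(1) conv_cauchy[OF \<open>conv G (b n)\<close>]] by blast
      ultimately show False using False conv_unique by blast
    qed
    then obtain \<delta> where \<delta>: "0 < \<delta>" "\<And>x. x \<in> kspan b n \<Longrightarrow> \<delta> \<le> w (x - b n)" by blast
    \<comment> \<open>Scaling by -1/c reduces the estimate to the distance of \<open>b n\<close>
      from the span.\<close>
    have dist: "v c * \<delta> \<le> w (x + to_ac c * b n)" if "x \<in> kspan b n" for x c
    proof (cases "c = 0")
      case c: False
      have "to_ac (- (1 / c)) * x \<in> kspan b n" using kspan_comb[OF that that, of "- (1 / c)" 0] by simp
      then have "v c * \<delta> \<le> w (- to_ac c) * w (to_ac (- (1 / c)) * x - b n)" using \<delta>(2) by (simp add: mult_left_mono)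
      also have "\<dots> = w (- to_ac c * (to_ac (- (1 / c)) * x - b n))" by (simp only: w_mult)
      also have "- to_ac c * (to_ac (- (1 / c)) * x - b n) = x + to_ac c * b n" using c by (simp add: algebra_simps)
      finally show ?thesis .
    qed simp
    have "\<forall>k. \<exists>y c. y \<in> kspan b n \<and> F k = y + to_ac c * b n" using Suc.prems(1) kspan_Suc by blast
    then obtain y c where yc: "\<And>k. y k \<in> kspan b n" "\<And>k. F k = y k + to_ac (c k) * b n" by metis
    have "base.cauchy c"
      unfolding base.cauchy_def
    proof (intro allI impI)
      fix \<epsilon> :: real assume "0 < \<epsilon>"
      then obtain n0 where n0: "\<And>m k. m \<ge> n0 \<Longrightarrow> k \<ge> n0 \<Longrightarrow> w (F m - F k) < \<epsilon> * \<delta>"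
        using Suc.prems(2) \<delta>(1) unfolding cauchy_def by (meson mult_pos_pos)
      have "v (c m - c k) < \<epsilon>" if "m \<ge> n0" "k \<ge> n0" for m k
      proof -
        have "y m - y k \<in> kspan b n" using kspan_comb[OF yc(1)[of m] yc(1)[of k], of 1 "-1"] by simp
        then have "v (c m - c k) * \<delta> \<le> w (F m - F k)"
          using dist[of "y m - y k" "c m - c k"] yc(2) by (simp add: algebra_simps)
        then show ?thesis using n0[OF that] \<delta>(1) by (smt (verit) mult_right_less_imp_less)
      qed
      then show "\<exists>n0. \<forall>m\<ge>n0. \<forall>k\<ge>n0. v (c m - c k) < \<epsilon>" by blast
    qed
    then obtain c0 where "base.conv c c0" using base_complete by blast
    then have "conv (\<lambda>k. to_ac (c k)) (to_ac c0)"
      unfolding conv_def base.conv_def by (simp flip: to_ac_diff)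
    then have cb: "conv (\<lambda>k. to_ac (c k) * b n) (to_ac c0 * b n)" by (rule conv_mult)
    have "cauchy (\<lambda>k. F k - to_ac (c k) * b n)" using Suc.prems(2) conv_cauchy[OF cb] by (rule cauchy_diff)
    moreover have "F k - to_ac (c k) * b n = y k" for k using yc(2) by simp
    ultimately have "cauchy y" by simp
    then obtain l where l: "l \<in> kspan b n" "conv y l" using Suc.IH[of y] yc(1) by blast
    have "conv (\<lambda>k. 0 - to_ac (c k) * b n) (0 - to_ac c0 * b n)"
      by (rule conv_diff[OF _ cb]) (simp add: conv_def)
    from conv_diff[OF l(2) this]
    have "conv (\<lambda>k. y k - (0 - to_ac (c k) * b n)) (l - (0 - to_ac c0 * b n))" .
    moreover have "y k - (0 - to_ac (c k) * b n) = F k" for k using yc(2) by simp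
    ultimately have "conv F (l + to_ac c0 * b n)" by simp
    moreover have "l + to_ac c0 * b n \<in> kspan b (Suc n)" using l(1) kspan_Suc by blast
    ultimately show ?thesis by blast
  qed
qed

abbreviation pol :: "'k poly \<Rightarrow> 'k alg_closure \<Rightarrow> 'k alg_closure" where
  "pol P \<equiv> poly (map_poly to_ac P)"

lemma map_poly_to_ac_add: "map_poly to_ac (P + Q) = map_poly to_ac P + (map_poly to_ac Q :: 'k alg_closure poly)"
  by (rule poly_eqI) (simp add: coeff_map_poly)

lemma map_poly_to_ac_diff: "map_poly to_ac (P - Q) = map_poly to_ac P - (map_poly to_ac Q :: 'k alg_closure poly)"
  by (rule poly_eqI) (simp add: coeff_map_poly)

lemma map_poly_to_ac_mult: "map_poly to_ac (P * Q) = map_poly to_ac P * (map_poly to_ac Q :: 'k alg_closure poly)"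
  by (rule poly_eqI) (simp add: coeff_map_poly coeff_mult to_ac_sum)

lemma map_poly_to_ac_pderiv: "map_poly to_ac (pderiv P) = pderiv (map_poly to_ac P :: 'k alg_closure poly)"
  by (rule poly_eqI) (simp add: coeff_map_poly coeff_pderiv)

lemma pol_add: "pol (P + Q) a = pol P a + pol Q a"
  by (simp add: map_poly_to_ac_add)

lemma pol_diff: "pol (P - Q) a = pol P a - pol Q a"
  by (simp add: map_poly_to_ac_diff)

lemma pol_mult: "pol (P * Q) a = pol P a * pol Q a"
  by (simp add: map_poly_to_ac_mult)

lemma pol_pCons: "pol (pCons c P) a = to_ac c + a * pol P a"
  by (simp add: map_poly_pCons)

lemma pol_pcompose: "pol (pcompose P Q) a = pol P (pol Q a)"
  by (induction P) (auto simp: pcompose_pCons pol_add pol_mult pol_pCons)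

text \<open>Division with remainder by a polynomial that kills \<open>a\<close>. The dimension
  depends on \<open>a\<close> alone and serves for every \<open>P\<close> at once.\<close>

lemma pol_kspan:
  obtains n where "\<And>P. pol P a \<in> kspan (\<lambda>i. a ^ i) n"
proof -
  obtain q :: "'k poly" where q: "q \<noteq> 0" "pol q a = 0" using alg_closure_algebraic by blast
  have dq: "degree q \<noteq> 0"
  proof
    assume "degree q = 0"
    then obtain c where "q = [:c:]" by (elim degree_eq_zeroE)
    then show False using q by (simp add: map_poly_pCons)
  qed
  have "pol P a \<in> kspan (\<lambda>i. a ^ i) (degree q)" for P
  proof -
    have "P = q * (P div q) + P mod q" by simp
    then have "pol P a = pol (q * (P div q) + P mod q) a" by simp
    then have eq: "pol P a = pol (P mod q) a" using q by (simp only: pol_add pol_mult) simp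
    have d: "degree (P mod q) < degree q" using q dq by (metis degree_mod_less' degree_0 neq0_conv)
    have "pol (P mod q) a = (\<Sum>i\<le>degree (map_poly to_ac (P mod q)). to_ac (coeff (P mod q) i) * a ^ i)"
      by (simp add: poly_altdef coeff_map_poly)
    also have "\<dots> = (\<Sum>i<degree q. to_ac (coeff (P mod q) i) * a ^ i)"
      using d by (intro sum.mono_neutral_left) (auto simp: degree_map_poly coeff_eq_0)
    finally show ?thesis unfolding eq kspan_def by blast
  qed
  then show ?thesis using that by blast
qed

lemma pol_inverse:
  assumes "pol Q a \<noteq> 0"
  shows "\<exists>P. inverse (pol Q a) = pol P a"
proof -
  define y where "y = pol Q a"
  obtain S :: "'k poly" where S: "S \<noteq> 0" "pol S y = 0" using alg_closure_algebraic by blast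
  \<comment> \<open>Removing the highest power of X from the annihilating polynomial leaves a
    nonzero constant term s0. As y is nonzero, the relation becomes y S1(y) = -s0, which inverts y
    inside K[a].\<close>
  obtain S' where S': "S = [:- 0, 1:] ^ order 0 S * S'" "\<not> [:- 0, 1:] dvd S'"
    using order_decomp[OF S(1)] by blast
  obtain s0 S1 where S1: "S' = pCons s0 S1" by (metis pCons_cases)
  have s0: "s0 \<noteq> 0" using S'(2) S1 poly_eq_0_iff_dvd[of S' 0] by simp
  have pw: "pol ([:0, 1:] ^ n) y = y ^ n" for n
    by (induction n) (auto simp: pol_mult pol_pCons)
  have "pol S y = y ^ order 0 S * pol S' y" by (subst S'(1)) (simp add: pol_mult pw)
  then have "pol S' y = 0" using S(2) assms by (simp add: y_def)
  then have "to_ac s0 + y * pol S1 y = 0" by (simp add: S1 pol_pCons)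
  then have "y * pol S1 y = - to_ac s0" by (simp add: eq_neg_iff_add_eq_0 add.commute)
  then have "y * (to_ac (- (1 / s0)) * pol S1 y) = 1" using s0 by simp
  then have "inverse y = to_ac (- (1 / s0)) * pol S1 y" by (rule inverse_unique)
  also have "\<dots> = pol ([:- (1 / s0):] * pcompose S1 Q) a"
    by (simp only: pol_mult pol_pcompose y_def) (simp add: pol_pCons)
  finally show ?thesis unfolding y_def by blast
qed

end

section \<open>Functions on a uniformly open bounded set\<close>

text \<open>The geometry behind all estimates on O(Y): one radius |t| serves for every point of Y.
  It is given by an element \<open>t\<close> because the averaging in
  \<open>poly_coeff_bound\<close> evaluates at multiples of \<open>t\<close>.\<close>

locale good_domain = ground p v w for p v and w :: "'k::field_char_0 alg_closure \<Rightarrow> real" +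
  fixes Y :: "'k alg_closure set" and t :: "'k alg_closure"
  assumes t0: "t \<noteq> 0"
    and bounded_domain: "\<exists>B. \<forall>a\<in>Y. w a \<le> B"
    and ball: "a \<in> Y \<Longrightarrow> w (b - a) \<le> w t \<Longrightarrow> b \<in> Y"
begin

lemma ball_add: "a \<in> Y \<Longrightarrow> w h \<le> w t \<Longrightarrow> a + h \<in> Y"
  using ball[of a "a + h"] by simp

lemma wt: "0 < w t"
  using t0 by simp

definition ratfun :: "('k alg_closure \<Rightarrow> 'k alg_closure) \<Rightarrow> bool" where
  "ratfun f \<longleftrightarrow> (\<exists>P Q. (\<forall>a\<in>Y. pol Q a \<noteq> 0) \<and> f = (\<lambda>a. if a \<in> Y then pol P a / pol Q a else 0))"

lemma ratfunI: "(\<And>a. a \<in> Y \<Longrightarrow> pol Q a \<noteq> 0 \<and> f a = pol P a / pol Q a) \<Longrightarrow> (\<And>a. a \<notin> Y \<Longrightarrow> f a = 0) \<Longrightarrow> ratfun f"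
  unfolding ratfun_def by (intro exI[of _ P] exI[of _ Q]) auto

lemma ratfunE:
  assumes "ratfun f"
  obtains P Q where "\<forall>a\<in>Y. pol Q a \<noteq> 0" "\<forall>a\<in>Y. f a = pol P a / pol Q a" "\<forall>a. a \<notin> Y \<longrightarrow> f a = 0"
proof -
  obtain P Q where "\<forall>a\<in>Y. pol Q a \<noteq> 0" "f = (\<lambda>a. if a \<in> Y then pol P a / pol Q a else 0)"
    using assms unfolding ratfun_def by blast
  then show ?thesis by (intro that[of Q P]) auto
qed

lemma ratfun_diff:
  assumes "ratfun f" "ratfun g"
  shows "ratfun (f - g)"
proof -
  obtain P Q where f: "\<forall>a\<in>Y. pol Q a \<noteq> 0" "\<forall>a\<in>Y. f a = pol P a / pol Q a" "\<forall>a. a \<notin> Y \<longrightarrow> f a = 0"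
    using ratfunE[OF assms(1)] .
  obtain P' Q' where g: "\<forall>a\<in>Y. pol Q' a \<noteq> 0" "\<forall>a\<in>Y. g a = pol P' a / pol Q' a" "\<forall>a. a \<notin> Y \<longrightarrow> g a = 0"
    using ratfunE[OF assms(2)] .
  show ?thesis
    by (rule ratfunI[of "Q * Q'" _ "P * Q' - P' * Q"]) (auto simp: f g pol_mult pol_diff field_simps)
qed

lemma ratfun_mult:
  assumes "ratfun f" "ratfun g"
  shows "ratfun (f * g)"
proof -
  obtain P Q where f: "\<forall>a\<in>Y. pol Q a \<noteq> 0" "\<forall>a\<in>Y. f a = pol P a / pol Q a" "\<forall>a. a \<notin> Y \<longrightarrow> f a = 0"
    using ratfunE[OF assms(1)] .
  obtain P' Q' where g: "\<forall>a\<in>Y. pol Q' a \<noteq> 0" "\<forall>a\<in>Y. g a = pol P' a / pol Q' a" "\<forall>a. a \<notin> Y \<longrightarrow> g a = 0"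
    using ratfunE[OF assms(2)] .
  show ?thesis
    by (rule ratfunI[of "Q * Q'" _ "P * P'"]) (auto simp: f g pol_mult)
qed

lemma ratfun_poly: "ratfun (\<lambda>a. if a \<in> Y then pol P a else 0)"
  by (rule ratfunI[of 1 _ P]) auto

text \<open>The numerator is bounded because Y is, and the denominator is bounded below because its
  roots keep distance |t| from Y.\<close>

lemma ratfun_bounded:
  assumes "ratfun f"
  shows "\<exists>M. \<forall>a\<in>Y. w (f a) \<le> M"
proof -
  obtain P Q where f: "\<And>a. a \<in> Y \<Longrightarrow> pol Q a \<noteq> 0" "\<And>a. a \<in> Y \<Longrightarrow> f a = pol P a / pol Q a"
    by (rule ratfunE[OF assms]) blast
  obtain B where B: "\<And>a. a \<in> Y \<Longrightarrow> w a \<le> B" using bounded_domain by blast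
  have "\<exists>M\<ge>0. \<forall>a\<in>Y. w (poly F a) \<le> M" for F :: "'k alg_closure poly"
  proof (induction F)
    case (pCons c F)
    then obtain M where M: "0 \<le> M" "\<And>a. a \<in> Y \<Longrightarrow> w (poly F a) \<le> M" by blast
    have "w (poly (pCons c F) a) \<le> max (w c) (B * M)" if "a \<in> Y" for a
    proof -
      have "w a * w (poly F a) \<le> B * M"
        using B[OF that] M(2)[OF that] order_trans[OF w_nonneg B[OF that]] by (intro mult_mono) auto
      then show ?thesis using w_add[of c "a * poly F a"] by (auto simp: w_mult)
    qed
    then show ?case by (intro exI[of _ "max (w c) (B * M)"]) (auto simp: le_max_iff_disj)
  qed (auto intro: exI[of _ 0])
  then obtain M where M: "0 \<le> M" "\<And>a. a \<in> Y \<Longrightarrow> w (pol P a) \<le> M" by blast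
  obtain m where m: "0 < m" "\<And>a. a \<in> Y \<Longrightarrow> m \<le> w (pol Q a)"
    using poly_lower_bound[of Y t "map_poly to_ac Q"] f(1) ball_add t0 by blast
  have "w (f a) \<le> M / m" if "a \<in> Y" for a
    unfolding f(2)[OF that] w_divide using M(1) M(2)[OF that] m(2)[OF that] m(1) by (intro frac_le)
  then show ?thesis by blast
qed

text \<open>A Cauchy estimate and a second-order Taylor estimate, linear in every bound
  \<open>M\<close> of f on Y. Being uniform in the point and linear in \<open>M\<close>, they
  survive uniform limits; applied to differences of approximants they make the derivatives
  converge.\<close>

definition taylor :: "('k alg_closure \<Rightarrow> 'k alg_closure) \<Rightarrow> ('k alg_closure \<Rightarrow> 'k alg_closure) \<Rightarrow> bool" where
  "taylor f g \<longleftrightarrow> (\<forall>M. (\<forall>a\<in>Y. w (f a) \<le> M) \<longrightarrow> (\<forall>a\<in>Y. w (g a) \<le> M / w t \<and>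
     (\<forall>h. w h \<le> w t \<longrightarrow> w (f (a + h) - f a - g a * h) \<le> M * (w h / w t)\<^sup>2)))"

lemma taylorI:
  assumes "\<And>M a. (\<And>a. a \<in> Y \<Longrightarrow> w (f a) \<le> M) \<Longrightarrow> a \<in> Y \<Longrightarrow> w (g a) \<le> M / w t"
    "\<And>M a h. (\<And>a. a \<in> Y \<Longrightarrow> w (f a) \<le> M) \<Longrightarrow> a \<in> Y \<Longrightarrow> w h \<le> w t \<Longrightarrow> w (f (a + h) - f a - g a * h) \<le> M * (w h / w t)\<^sup>2"
  shows "taylor f g"
  unfolding taylor_def using assms by (intro allI impI ballI conjI) simp_all

lemma taylorD:
  assumes "taylor f g" "\<And>a. a \<in> Y \<Longrightarrow> w (f a) \<le> M" "a \<in> Y"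
  shows "w (g a) \<le> M / w t" "w h \<le> w t \<Longrightarrow> w (f (a + h) - f a - g a * h) \<le> M * (w h / w t)\<^sup>2"
  using assms by (simp_all add: taylor_def)

lemma ratfun_taylor:
  assumes "ratfun f"
  shows "\<exists>g. ratfun g \<and> taylor f g"
proof -
  obtain P Q where f: "\<And>a. a \<in> Y \<Longrightarrow> pol Q a \<noteq> 0" "\<And>a. a \<in> Y \<Longrightarrow> f a = pol P a / pol Q a"
    by (rule ratfunE[OF assms]) blast
  define g where "g a = (if a \<in> Y then pol (pderiv P * Q - P * pderiv Q) a / pol (Q * Q) a else 0)" for a
  have "ratfun g"
    by (rule ratfunI[of "Q * Q" _ "pderiv P * Q - P * pderiv Q"]) (auto simp: g_def pol_mult f)
  moreover have T: "w (g a) \<le> M / w t \<and> w (f (a + h) - f a - g a * h) \<le> M * (w h / w t)\<^sup>2"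
    if M: "\<And>a. a \<in> Y \<Longrightarrow> w (f a) \<le> M" and a: "a \<in> Y" and h: "w h \<le> w t" for M a h
  proof -
    have "w (pol P (a + s) / pol Q (a + s)) \<le> M" if "w s \<le> w t" for s
      using M[OF ball_add[OF a that]] f(2)[OF ball_add[OF a that]] by simp
    note T = rat_taylor[OF t0 f(1)[OF ball_add[OF a]] this h]
    have "g a = poly (pderiv (map_poly to_ac P) * map_poly to_ac Q - map_poly to_ac P * pderiv (map_poly to_ac Q)) a
        / poly (map_poly to_ac Q * map_poly to_ac Q) a"
      using a by (simp add: g_def map_poly_to_ac_mult map_poly_to_ac_diff map_poly_to_ac_pderiv)
    then show ?thesis using T f(2)[OF a] f(2)[OF ball_add[OF a h]] by simp
  qed
  have "taylor f g"
  proof (rule taylorI)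
    fix M a assume "\<And>a. a \<in> Y \<Longrightarrow> w (f a) \<le> M" "a \<in> Y"
    then show "w (g a) \<le> M / w t" using T[of M a 0] by simp
  qed (use T in blast)
  ultimately show ?thesis by blast
qed

lemma holo_iff: "f \<in> holo w Y \<longleftrightarrow> (\<forall>a. a \<notin> Y \<longrightarrow> f a = 0) \<and> (\<forall>e>0. \<exists>g. ratfun g \<and> (\<forall>a\<in>Y. w (f a - g a) < e))"
proof -
  have "(\<exists>g. ratfun g \<and> (\<forall>a\<in>Y. w (f a - g a) < e)) \<longleftrightarrow>
    (\<exists>P Q. \<forall>a\<in>Y. pol Q a \<noteq> 0 \<and> w (f a - pol P a / pol Q a) < e)" for e
  proof
    assume "\<exists>g. ratfun g \<and> (\<forall>a\<in>Y. w (f a - g a) < e)"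
    then obtain g where g: "ratfun g" "\<forall>a\<in>Y. w (f a - g a) < e" by blast
    show "\<exists>P Q. \<forall>a\<in>Y. pol Q a \<noteq> 0 \<and> w (f a - pol P a / pol Q a) < e"
      using ratfunE[OF g(1)] g(2) by metis
  next
    assume "\<exists>P Q. \<forall>a\<in>Y. pol Q a \<noteq> 0 \<and> w (f a - pol P a / pol Q a) < e"
    then obtain P Q where PQ: "\<forall>a\<in>Y. pol Q a \<noteq> 0 \<and> w (f a - pol P a / pol Q a) < e" by blast
    then show "\<exists>g. ratfun g \<and> (\<forall>a\<in>Y. w (f a - g a) < e)"
      by (intro exI[of _ "\<lambda>a. if a \<in> Y then pol P a / pol Q a else 0"]) (auto simp: ratfun_def)
  qed
  then show ?thesis by (simp add: holo_def)
qed

lemma holo_outside: "f \<in> holo w Y \<Longrightarrow> a \<notin> Y \<Longrightarrow> f a = 0"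
  by (simp add: holo_iff)

lemma holo_approx:
  assumes "f \<in> holo w Y" "0 < e"
  obtains g where "ratfun g" "\<And>a. a \<in> Y \<Longrightarrow> w (f a - g a) < e"
proof -
  have "\<exists>g. ratfun g \<and> (\<forall>a\<in>Y. w (f a - g a) < e)" using assms by (simp only: holo_iff)
  then show ?thesis using that by blast
qed

lemma ratfun_holo:
  assumes "ratfun f"
  shows "f \<in> holo w Y"
  unfolding holo_iff
proof (intro conjI allI impI)
  show "f a = 0" if "a \<notin> Y" for a using assms that by (auto simp: ratfun_def)
  show "\<exists>g. ratfun g \<and> (\<forall>a\<in>Y. w (f a - g a) < e)" if "0 < e" for e
    using assms that by (intro exI[of _ f]) simp
qed

lemma holo_bounded:
  assumes "f \<in> holo w Y"
  shows "\<exists>M>0. \<forall>a\<in>Y. w (f a) \<le> M"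
proof -
  obtain g where g: "ratfun g" "\<And>a. a \<in> Y \<Longrightarrow> w (f a - g a) < 1" using holo_approx[OF assms, of 1] by auto
  obtain M where M: "\<And>a. a \<in> Y \<Longrightarrow> w (g a) \<le> M" using ratfun_bounded[OF g(1)] by blast
  have "w (f a) \<le> max 1 M" if "a \<in> Y" for a
    using w_add[of "f a - g a" "g a"] g(2)[OF that] M[OF that] by simp
  then show ?thesis by (intro exI[of _ "max 1 M"]) auto
qed

lemma holo_diff:
  assumes "f \<in> holo w Y" "g \<in> holo w Y"
  shows "f - g \<in> holo w Y"
  unfolding holo_iff
proof (intro conjI allI impI)
  fix e :: real assume e: "0 < e"
  obtain f' where f': "ratfun f'" "\<And>a. a \<in> Y \<Longrightarrow> w (f a - f' a) < e" using holo_approx[OF assms(1) e] by blast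
  obtain g' where g': "ratfun g'" "\<And>a. a \<in> Y \<Longrightarrow> w (g a - g' a) < e" using holo_approx[OF assms(2) e] by blast
  have "w ((f - g) a - (f' - g') a) < e" if "a \<in> Y" for a
    using w_diff_less[OF f'(2)[OF that] g'(2)[OF that]] by (simp add: algebra_simps)
  then show "\<exists>h. ratfun h \<and> (\<forall>a\<in>Y. w ((f - g) a - h a) < e)" using ratfun_diff[OF f'(1) g'(1)] by blast
qed (use assms in \<open>simp add: holo_outside\<close>)

lemma holo_mult:
  assumes f: "f \<in> holo w Y" and g: "g \<in> holo w Y"
  shows "f * g \<in> holo w Y"
  unfolding holo_iff
proof (intro conjI allI impI)
  fix e :: real assume e: "0 < e"
  obtain A where A: "0 < A" "\<And>a. a \<in> Y \<Longrightarrow> w (f a) \<le> A" using holo_bounded[OF f] by blast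
  have eA: "0 < e / A" using e A(1) by simp
  \<comment> \<open>g is approximated before f, because the precision required of f' depends on a
    bound for g'.\<close>
  obtain g' where g': "ratfun g'" "\<And>a. a \<in> Y \<Longrightarrow> w (g a - g' a) < e / A" using holo_approx[OF g eA] by blast
  obtain B where B: "0 < B" "\<And>a. a \<in> Y \<Longrightarrow> w (g' a) \<le> B" using holo_bounded[OF ratfun_holo[OF g'(1)]] by blast
  have eB: "0 < e / B" using e B(1) by simp
  obtain f' where f': "ratfun f'" "\<And>a. a \<in> Y \<Longrightarrow> w (f a - f' a) < e / B" using holo_approx[OF f eB] by blast
  have "w ((f * g) a - (f' * g') a) < e" if a: "a \<in> Y" for a
  proof -
    have "w (f a) * w (g a - g' a) \<le> A * w (g a - g' a)" using A(2)[OF a] by (intro mult_right_mono) auto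
    also have "\<dots> < e" using g'(2)[OF a] A(1) by (simp add: pos_less_divide_eq mult.commute)
    finally have 1: "w (f a * (g a - g' a)) < e" by (simp add: w_mult)
    have "w (f a - f' a) * w (g' a) \<le> w (f a - f' a) * B" using B(2)[OF a] by (intro mult_left_mono) auto
    also have "\<dots> < e" using f'(2)[OF a] B(1) by (simp add: pos_less_divide_eq)
    finally have 2: "w ((f a - f' a) * g' a) < e" by (simp add: w_mult)
    show ?thesis using w_add_less[OF 1 2] by (simp add: algebra_simps)
  qed
  then show "\<exists>h. ratfun h \<and> (\<forall>a\<in>Y. w ((f * g) a - h a) < e)" using ratfun_mult[OF f'(1) g'(1)] by blast
qed (use assms in \<open>simp add: holo_outside\<close>)

text \<open>At each point a all values lie in the finite-dimensional, hence complete, space K[a]: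
  rational functions take values there, and their limits stay there. The pointwise limit obtained in
  this way is uniform, so it is again approximated by rational functions.\<close>

lemma holo_complete:
  assumes F: "\<And>n::nat. F n \<in> holo w Y"
    and C: "\<And>e. 0 < e \<Longrightarrow> \<exists>n0. \<forall>m\<ge>n0. \<forall>n\<ge>n0. \<forall>a\<in>Y. w (F m a - F n a) < e"
  shows "\<exists>g\<in>holo w Y. \<forall>e>0. \<exists>n0. \<forall>n\<ge>n0. \<forall>a\<in>Y. w (F n a - g a) < e"
proof -
  have "\<exists>l. conv (\<lambda>n. F n a) l" if a: "a \<in> Y" for a
  proof -
    have "\<exists>d. \<forall>P. pol P a \<in> kspan (\<lambda>i. a ^ i) d" by (rule pol_kspan[of a]) blast
    then obtain d where d: "\<And>P. pol P a \<in> kspan (\<lambda>i. a ^ i) d" by blast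
    have rat: "g a \<in> kspan (\<lambda>i. a ^ i) d" if g: "ratfun g" for g
    proof -
      obtain P Q where "\<forall>a\<in>Y. pol Q a \<noteq> 0" "\<forall>a\<in>Y. g a = pol P a / pol Q a" "\<forall>a. a \<notin> Y \<longrightarrow> g a = 0"
        using ratfunE[OF g] .
      then have PQ: "pol Q a \<noteq> 0" "g a = pol P a / pol Q a" using a by auto
      obtain S where "inverse (pol Q a) = pol S a" using pol_inverse[OF PQ(1)] by blast
      then have "g a = pol (P * S) a" using PQ(2) by (simp add: pol_mult divide_inverse)
      then show ?thesis using d by simp
    qed
    have "f a \<in> kspan (\<lambda>i. a ^ i) d" if f: "f \<in> holo w Y" for f
    proof -
      have "\<forall>k. \<exists>g. ratfun g \<and> w (f a - g a) < inverse (real (Suc k))"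
        using holo_approx[OF f] a by (metis inverse_positive_iff_positive of_nat_0_less_iff zero_less_Suc)
      then obtain G where G: "\<And>k. ratfun (G k)" "\<And>k. w (f a - G k a) < inverse (real (Suc k))" by metis
      have cv: "conv (\<lambda>k. G k a) (f a)"
        using G(2) by (intro convI_inverse_Suc) (simp only: w_diff_commute)
      obtain l where "l \<in> kspan (\<lambda>i. a ^ i) d" "conv (\<lambda>k. G k a) l"
        using kspan_complete[OF rat[OF G(1)] conv_cauchy[OF cv]] by blast
      then show ?thesis using conv_unique[OF cv] by simp
    qed
    moreover have "cauchy (\<lambda>n. F n a)" unfolding cauchy_def using C a by blast
    ultimately show ?thesis using kspan_complete[of "\<lambda>n. F n a"] F by blast
  qed
  then obtain l where l: "\<And>a. a \<in> Y \<Longrightarrow> conv (\<lambda>n. F n a) (l a)" by metis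
  define g where "g a = (if a \<in> Y then l a else 0)" for a
  have lim: "\<exists>n0. \<forall>n\<ge>n0. \<forall>a\<in>Y. w (F n a - g a) < e" if e: "0 < e" for e
  proof -
    obtain n0 where n0: "\<And>m n a. m \<ge> n0 \<Longrightarrow> n \<ge> n0 \<Longrightarrow> a \<in> Y \<Longrightarrow> w (F m a - F n a) < e" using C[OF e] by blast
    have "w (F n a - g a) < e" if n: "n \<ge> n0" and a: "a \<in> Y" for n a
    proof -
      obtain n1 where "\<And>n. n \<ge> n1 \<Longrightarrow> w (F n a - l a) < e" using l[OF a] e unfolding conv_def by blast
      then have "w (F (max n0 n1) a - g a) < e" using a by (simp add: g_def)
      moreover have "w (F n a - F (max n0 n1) a) < e" using n0 n a by simp
      ultimately show ?thesis using w_diff_trans_less by blast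
    qed
    then show ?thesis by blast
  qed
  have "g \<in> holo w Y"
    unfolding holo_iff
  proof (intro conjI allI impI)
    fix e :: real assume e: "0 < e"
    obtain n where n: "\<And>a. a \<in> Y \<Longrightarrow> w (F n a - g a) < e" using lim[OF e] by blast
    obtain f where f: "ratfun f" "\<And>a. a \<in> Y \<Longrightarrow> w (F n a - f a) < e" using holo_approx[OF F e] by blast
    have "w (g a - f a) < e" if "a \<in> Y" for a
      using w_diff_trans_less[of "g a" "F n a" e "f a"] n[OF that] f(2)[OF that] by (simp add: w_diff_commute)
    then show "\<exists>h. ratfun h \<and> (\<forall>a\<in>Y. w (g a - h a) < e)" using f(1) by blast
  qed (simp add: g_def)
  then show ?thesis using lim by blast
qed

subsection \<open>Differentiation\<close>

text \<open>Differentiability with a quadratic remainder. It implies the limit in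
  \<open>ddx\<close>, and the algebra of remainders replaces the handling of limits.\<close>

definition has_d :: "('k alg_closure \<Rightarrow> 'k alg_closure) \<Rightarrow> 'k alg_closure \<Rightarrow> 'k alg_closure \<Rightarrow> bool" where
  "has_d f a d \<longleftrightarrow> (\<exists>M. \<forall>h. w h \<le> w t \<longrightarrow> w (f (a + h) - f a - d * h) \<le> M * (w h)\<^sup>2)"

text \<open>The elements t p^n tend to 0. They show that no point of Y is isolated in Y, which makes
  the derivative in \<open>ddx\<close> unique.\<close>

lemma ex_small:
  assumes "0 < \<delta>"
  obtains h where "h \<noteq> 0" "w h < \<delta>" "w h \<le> w t"
proof -
  have "(\<lambda>n. (1 / real p) ^ n) \<longlonglongrightarrow> 0" using p_gt_1 by (intro LIMSEQ_realpow_zero) auto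
  then have "\<forall>\<^sub>F n in sequentially. (1 / real p) ^ n < \<delta> / w t" using assms wt by (intro order_tendstoD) auto
  then obtain n where n: "(1 / real p) ^ n < \<delta> / w t" by (auto simp: eventually_sequentially)
  define h where "h = t * of_nat p ^ n"
  have wh: "w h = w t * (1 / real p) ^ n" by (simp add: h_def w_mult w_power w_p)
  have "(1 / real p) ^ n \<le> 1" using p_gt_1 by (intro power_le_one) auto
  then have "w h \<le> w t" unfolding wh by (simp add: mult_left_le)
  moreover have "w h < \<delta>" unfolding wh using n wt by (simp add: pos_less_divide_eq mult.commute)
  moreover have "h \<noteq> 0" using t0 prime by (auto simp: h_def)
  ultimately show ?thesis using that by blast
qed

lemma has_d_ddx:
  assumes a: "a \<in> Y" and d: "has_d f a d"
  shows "ddx w Y f a = d"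
proof -
  obtain M0 where M0: "\<And>h. w h \<le> w t \<Longrightarrow> w (f (a + h) - f a - d * h) \<le> M0 * (w h)\<^sup>2"
    using d unfolding has_d_def by blast
  \<comment> \<open>Makes the constant positive, so that e / M can serve as a radius.\<close>
  define M where "M = \<bar>M0\<bar> + 1"
  have M: "0 < M" "\<And>h. w h \<le> w t \<Longrightarrow> w (f (a + h) - f a - d * h) \<le> M * (w h)\<^sup>2"
  proof -
    show "0 < M" by (simp add: M_def)
    fix h assume h: "w h \<le> w t"
    have "M0 * (w h)\<^sup>2 \<le> M * (w h)\<^sup>2" by (intro mult_right_mono) (auto simp: M_def)
    then show "w (f (a + h) - f a - d * h) \<le> M * (w h)\<^sup>2" using M0[OF h] by simp
  qed
  let ?P = "\<lambda>D. \<forall>e>0. \<exists>\<delta>>0. \<forall>b\<in>Y. b \<noteq> a \<and> w (b - a) < \<delta> \<longrightarrow> w ((f b - f a) / (b - a) - D) < e"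
  have ex: "?P d"
  proof (intro allI impI)
    fix e :: real assume e: "0 < e"
    have "w ((f b - f a) / (b - a) - d) < e" if b: "b \<noteq> a" "w (b - a) < min (w t) (e / M)" for b
    proof -
      define h where "h = b - a"
      have h: "h \<noteq> 0" "w h \<le> w t" "w h < e / M" and bh: "b = a + h" using b by (auto simp: h_def)
      have "(f b - f a) / h - d = (f (a + h) - f a - d * h) / h" using h by (simp add: bh field_simps)
      then have "w ((f b - f a) / h - d) \<le> M * (w h)\<^sup>2 / w h"
        using M(2)[OF h(2)] by (simp add: w_divide divide_right_mono)
      also have "\<dots> = M * w h" using h by (simp add: power2_eq_square)
      also have "\<dots> < e" using h M by (simp add: pos_less_divide_eq mult.commute)
      finally show ?thesis by (simp add: h_def)
    qed
    then show "\<exists>\<delta>>0. \<forall>b\<in>Y. b \<noteq> a \<and> w (b - a) < \<delta> \<longrightarrow> w ((f b - f a) / (b - a) - d) < e"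
      using e M wt by (intro exI[of _ "min (w t) (e / M)"]) auto
  qed
  \<comment> \<open>Two candidates are both approximated by one difference quotient at a + h with
    small nonzero h, so their distance would be smaller than itself.\<close>
  have "(THE D. ?P D) = d"
  proof (rule the_equality[of ?P, OF ex])
    fix D assume D: "?P D"
    show "D = d"
    proof (rule ccontr)
      assume "D \<noteq> d"
      then have e: "0 < w (D - d)" by simp
      obtain \<delta>1 where d1: "0 < \<delta>1" "\<And>b. b \<in> Y \<Longrightarrow> b \<noteq> a \<Longrightarrow> w (b - a) < \<delta>1 \<Longrightarrow> w ((f b - f a) / (b - a) - D) < w (D - d)"
        using D e by blast
      obtain \<delta>2 where d2: "0 < \<delta>2" "\<And>b. b \<in> Y \<Longrightarrow> b \<noteq> a \<Longrightarrow> w (b - a) < \<delta>2 \<Longrightarrow> w ((f b - f a) / (b - a) - d) < w (D - d)"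
        using ex e by blast
      obtain h where h: "h \<noteq> 0" "w h < min \<delta>1 \<delta>2" "w h \<le> w t" using ex_small[of "min \<delta>1 \<delta>2"] d1(1) d2(1) by auto
      have "w ((f (a + h) - f a) / h - D) < w (D - d)" "w ((f (a + h) - f a) / h - d) < w (D - d)"
        using d1(2)[of "a + h"] d2(2)[of "a + h"] h ball_add[OF a h(3)] by auto
      then show False
        using w_diff_trans_less[of D "(f (a + h) - f a) / h" "w (D - d)" d] w_diff_commute[of D "(f (a + h) - f a) / h"]
        by linarith
    qed
  qed
  then show ?thesis using a by (simp add: ddx_def)
qed

lemma has_d_diff:
  assumes "has_d f a d" "has_d g a d'"
  shows "has_d (f - g) a (d - d')"
proof -
  obtain M where M: "\<And>h. w h \<le> w t \<Longrightarrow> w (f (a + h) - f a - d * h) \<le> M * (w h)\<^sup>2"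
    using assms(1) unfolding has_d_def by blast
  obtain M' where M': "\<And>h. w h \<le> w t \<Longrightarrow> w (g (a + h) - g a - d' * h) \<le> M' * (w h)\<^sup>2"
    using assms(2) unfolding has_d_def by blast
  have "w ((f - g) (a + h) - (f - g) a - (d - d') * h) \<le> max M M' * (w h)\<^sup>2" if h: "w h \<le> w t" for h
  proof -
    have eq: "(f - g) (a + h) - (f - g) a - (d - d') * h = (f (a + h) - f a - d * h) - (g (a + h) - g a - d' * h)"
      by (simp add: algebra_simps)
    have "M * (w h)\<^sup>2 \<le> max M M' * (w h)\<^sup>2" "M' * (w h)\<^sup>2 \<le> max M M' * (w h)\<^sup>2"
      by (auto intro: mult_right_mono)
    then show ?thesis unfolding eq using M[OF h] M'[OF h] by (intro order_trans[OF w_diff]) auto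
  qed
  then show ?thesis unfolding has_d_def by blast
qed

lemma taylor_has_d:
  assumes "\<And>h. w h \<le> w t \<Longrightarrow> w (f (a + h) - f a - d * h) \<le> M * (w h / w t)\<^sup>2"
  shows "has_d f a d"
  unfolding has_d_def using assms by (intro exI[of _ "M / (w t)\<^sup>2"]) (simp add: power_divide)

text \<open>The derivatives of rational approximants converge uniformly, because the Cauchy estimate
  for F m - F n controls the difference of their derivatives. Both estimates of
  \<open>taylor\<close> hold for f up to an arbitrary error inherited from an approximant.\<close>

lemma holo_deriv:
  assumes f: "f \<in> holo w Y"
  shows "\<exists>g\<in>holo w Y. taylor f g"
proof -
  have "\<forall>n. \<exists>g. ratfun g \<and> (\<forall>a\<in>Y. w (f a - g a) < inverse (real (Suc n)))"
    using holo_approx[OF f] by (metis inverse_positive_iff_positive of_nat_0_less_iff zero_less_Suc)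
  then obtain F where F: "\<And>n. ratfun (F n)" "\<And>n a. a \<in> Y \<Longrightarrow> w (f a - F n a) < inverse (real (Suc n))" by metis
  obtain G where G: "\<And>n. ratfun (G n)" and FG_taylor: "\<And>n. taylor (F n) (G n)"
    using ratfun_taylor[OF F(1)] by metis
  have FG: "has_d (F n) a (G n a)" if "a \<in> Y" for n a
  proof -
    obtain M where M: "\<And>a. a \<in> Y \<Longrightarrow> w (F n a) \<le> M" using ratfun_bounded[OF F(1)] by blast
    show ?thesis using taylorD(2)[OF FG_taylor M that] by (rule taylor_has_d)
  qed
  have Gdiff: "w (G m a - G n a) \<le> e / w t" if a: "a \<in> Y" and e: "inverse (real (Suc m)) \<le> e" "inverse (real (Suc n)) \<le> e" for m n a e
  proof -
    \<comment> \<open>\<open>ratfun_taylor\<close> yields some derivative of F m - F n; uniqueness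
      identifies it with G m - G n.\<close>
    obtain g where g: "taylor (F m - F n) g" using ratfun_taylor[OF ratfun_diff[OF F(1) F(1)]] by blast
    have b: "w ((F m - F n) a) \<le> e" if "a \<in> Y" for a
    proof -
      have "w (F m a - f a) \<le> e" "w (f a - F n a) \<le> e"
        using F(2)[OF that, of m] F(2)[OF that, of n] e by (auto simp: w_diff_commute[of "F m a"])
      then have "w ((F m a - f a) + (f a - F n a)) \<le> e" by (rule w_add_le)
      then show ?thesis by simp
    qed
    have "has_d (F m - F n) a (g a)" using taylorD(2)[OF g b a] by (rule taylor_has_d)
    moreover have "has_d (F m - F n) a (G m a - G n a)" using FG[OF a] by (intro has_d_diff)
    ultimately have "g a = G m a - G n a" using has_d_ddx[OF a] by metis
    then show ?thesis using taylorD(1)[OF g b a] by simp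
  qed
  have "\<exists>g\<in>holo w Y. \<forall>e>0. \<exists>n0. \<forall>n\<ge>n0. \<forall>a\<in>Y. w (G n a - g a) < e"
  proof (rule holo_complete)
    show "G n \<in> holo w Y" for n using G by (rule ratfun_holo)
    fix e :: real assume e: "0 < e"
    then have "0 < e * w t / 2" using wt by simp
    then obtain n0 where n0: "\<And>n. n \<ge> n0 \<Longrightarrow> inverse (real (Suc n)) < e * w t / 2" using inverse_Suc_small by blast
    have "w (G m a - G n a) < e" if "m \<ge> n0" "n \<ge> n0" "a \<in> Y" for m n a
      using Gdiff[OF that(3) less_imp_le[OF n0[OF that(1)]] less_imp_le[OF n0[OF that(2)]]] e wt by simp
    then show "\<exists>n0. \<forall>m\<ge>n0. \<forall>n\<ge>n0. \<forall>a\<in>Y. w (G m a - G n a) < e" by blast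
  qed
  then obtain g where g: "g \<in> holo w Y" "\<And>e. 0 < e \<Longrightarrow> \<exists>n0. \<forall>n\<ge>n0. \<forall>a\<in>Y. w (G n a - g a) < e" by blast
  \<comment> \<open>A bound \<open>M\<close> of f becomes max M e for an approximant within e of
    f.\<close>
  have approx: "\<exists>n. (\<forall>a\<in>Y. w (F n a) \<le> max M e) \<and> (\<forall>a\<in>Y. w (f a - F n a) \<le> e) \<and> (\<forall>a\<in>Y. w (g a - G n a) \<le> e)"
    if e: "0 < e" and M: "\<And>a. a \<in> Y \<Longrightarrow> w (f a) \<le> M" for e M
  proof -
    obtain n0 where n0: "\<And>n. n \<ge> n0 \<Longrightarrow> inverse (real (Suc n)) < e" using inverse_Suc_small[OF e] by blast
    obtain n1 where n1: "\<And>n a. n \<ge> n1 \<Longrightarrow> a \<in> Y \<Longrightarrow> w (G n a - g a) < e" using g(2)[OF e] by blast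
    define n where "n = max n0 n1"
    have 1: "w (f a - F n a) \<le> e" if "a \<in> Y" for a using F(2)[OF that, of n] n0[of n] by (simp add: n_def)
    moreover have "w (g a - G n a) \<le> e" if "a \<in> Y" for a
      using n1[of n a] that by (simp add: n_def w_diff_commute[of "g a"])
    moreover have "w (F n a) \<le> max M e" if "a \<in> Y" for a
      using w_diff[of "f a" "f a - F n a"] 1[OF that] M[OF that] by simp
    ultimately show ?thesis by blast
  qed
  have "taylor f g"
  proof (rule taylorI)
    fix M a assume M: "\<And>a. a \<in> Y \<Longrightarrow> w (f a) \<le> M" and a: "a \<in> Y"
    have M0: "0 \<le> M" using M[OF a] order_trans[OF w_nonneg] by blast
    have "w (g a) \<le> M / w t + e" if e: "0 < e" for e
    proof -
      \<comment> \<open>The Cauchy estimate divides the error by |t|, hence the second entry of the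
        minimum.\<close>
      define e' where "e' = min e (e * w t)"
      have e': "0 < e'" "e' \<le> e" "e' \<le> e * w t" using e wt by (auto simp: e'_def)
      obtain n where n: "\<And>a. a \<in> Y \<Longrightarrow> w (F n a) \<le> max M e'" "\<And>a. a \<in> Y \<Longrightarrow> w (g a - G n a) \<le> e'"
        using approx[OF e'(1) M] by blast
      have "0 \<le> e * w t" using e by simp
      then have "max M e' \<le> M + e * w t" using e' M0 by linarith
      then have "max M e' / w t \<le> (M + e * w t) / w t" by (intro divide_right_mono) auto
      then have "max M e' / w t \<le> M / w t + e" using wt by (simp add: add_divide_distrib)
      then have "w (G n a) \<le> M / w t + e" using taylorD(1)[OF FG_taylor n(1) a] by simp
      moreover have "w (g a - G n a) \<le> M / w t + e" using n(2)[OF a] e'(2) M0 wt by (simp add: add_increasing)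
      ultimately have "w (g a - G n a + G n a) \<le> M / w t + e" by (intro w_add_le)
      then show ?thesis by simp
    qed
    then show "w (g a) \<le> M / w t" by (rule field_le_epsilon)
  next
    fix M a h assume M: "\<And>a. a \<in> Y \<Longrightarrow> w (f a) \<le> M" and a: "a \<in> Y" and h: "w h \<le> w t"
    have M0: "0 \<le> M" using M[OF a] order_trans[OF w_nonneg] by blast
    define \<rho> where "\<rho> = (w h / w t)\<^sup>2"
    have \<rho>: "0 \<le> \<rho>" "\<rho> \<le> 1" using h wt by (auto simp: \<rho>_def power_le_one)
    have "w (f (a + h) - f a - g a * h) \<le> M * \<rho> + e" if e: "0 < e" for e
    proof -
      \<comment> \<open>The error of the derivative is multiplied by |h| <= |t|, hence e / |t|
        here.\<close>
      define e' where "e' = min e (e / w t)"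
      have e': "0 < e'" "e' \<le> e" "e' \<le> e / w t" using e wt by (auto simp: e'_def)
      obtain n where n: "\<And>a. a \<in> Y \<Longrightarrow> w (F n a) \<le> max M e'" "\<And>a. a \<in> Y \<Longrightarrow> w (f a - F n a) \<le> e'" "\<And>a. a \<in> Y \<Longrightarrow> w (g a - G n a) \<le> e'"
        using approx[OF e'(1) M] by blast
      have M\<rho>: "0 \<le> M * \<rho>" using M0 \<rho> by simp
      have "max M e' * \<rho> \<le> (M + e) * \<rho>" using e' M0 \<rho> by (intro mult_right_mono) auto
      also have "\<dots> \<le> M * \<rho> + e" using e \<rho> by (simp add: distrib_right mult_left_le)
      finally have 1: "w (F n (a + h) - F n a - G n a * h) \<le> M * \<rho> + e"
        using taylorD(2)[OF FG_taylor n(1) a h] by (simp add: \<rho>_def)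
      have 2: "w (f (a + h) - F n (a + h)) \<le> M * \<rho> + e" "w (f a - F n a) \<le> M * \<rho> + e"
        using n(2)[OF a] n(2)[OF ball_add[OF a h]] e' M\<rho> by auto
      have "w (g a - G n a) * w h \<le> e' * w t" using n(3)[OF a] h e' by (intro mult_mono) auto
      also have "\<dots> \<le> e" using e'(3) wt by (simp add: pos_le_divide_eq)
      finally have 3: "w ((g a - G n a) * h) \<le> M * \<rho> + e" using M\<rho> by (simp add: w_mult)
      have "f (a + h) - f a - g a * h = (F n (a + h) - F n a - G n a * h) + (f (a + h) - F n (a + h)) - (f a - F n a) - (g a - G n a) * h"
        by (simp add: algebra_simps)
      then show ?thesis using w_diff_le[OF w_diff_le[OF w_add_le[OF 1 2(1)] 2(2)] 3] by (simp only:)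
    qed
    then show "w (f (a + h) - f a - g a * h) \<le> M * (w h / w t)\<^sup>2" unfolding \<rho>_def by (rule field_le_epsilon)
  qed
  then show ?thesis using g(1) by blast
qed

lemma ddx_holo_taylor:
  assumes f: "f \<in> holo w Y"
  shows "ddx w Y f \<in> holo w Y \<and> taylor f (ddx w Y f)"
proof -
  obtain g where g: "g \<in> holo w Y" "taylor f g" using holo_deriv[OF f] by blast
  have "ddx w Y f a = g a" for a
  proof (cases "a \<in> Y")
    case True
    obtain M where M: "\<And>a. a \<in> Y \<Longrightarrow> w (f a) \<le> M" using holo_bounded[OF f] by blast
    show ?thesis using taylorD(2)[OF g(2) M True] by (intro has_d_ddx[OF True] taylor_has_d)
  qed (simp add: ddx_def holo_outside[OF g(1)])
  then have "ddx w Y f = g" by blast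
  then show ?thesis using g by simp
qed

lemma ddx_holo: "f \<in> holo w Y \<Longrightarrow> ddx w Y f \<in> holo w Y"
  by (simp add: ddx_holo_taylor)

lemma ddx_taylor:
  assumes "f \<in> holo w Y" "\<And>a. a \<in> Y \<Longrightarrow> w (f a) \<le> M" "a \<in> Y"
  shows "w (ddx w Y f a) \<le> M / w t"
    "w h \<le> w t \<Longrightarrow> w (f (a + h) - f a - ddx w Y f a * h) \<le> M * (w h / w t)\<^sup>2"
proof -
  have T: "taylor f (ddx w Y f)" using assms(1) by (simp add: ddx_holo_taylor)
  show "w (ddx w Y f a) \<le> M / w t" using taylorD(1)[OF T assms(2,3)] .
  show "w h \<le> w t \<Longrightarrow> w (f (a + h) - f a - ddx w Y f a * h) \<le> M * (w h / w t)\<^sup>2"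
    using taylorD(2)[OF T assms(2,3)] .
qed

lemma ddx_has_d:
  assumes "f \<in> holo w Y" "a \<in> Y"
  shows "has_d f a (ddx w Y f a)"
proof -
  obtain M where M: "\<And>a. a \<in> Y \<Longrightarrow> w (f a) \<le> M" using holo_bounded[OF assms(1)] by blast
  show ?thesis using ddx_taylor(2)[OF assms(1) M assms(2)] by (rule taylor_has_d)
qed

text \<open>On the disc |h| / |t| is at most 1, so the quadratic remainder is dominated by the
  linear term.\<close>

lemma holo_lipschitz:
  assumes f: "f \<in> holo w Y" and M: "\<And>a. a \<in> Y \<Longrightarrow> w (f a) \<le> M" and a: "a \<in> Y" and h: "w h \<le> w t"
  shows "w (f (a + h) - f a) \<le> M * (w h / w t)"
proof -
  define \<rho> where "\<rho> = w h / w t"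
  have \<rho>: "0 \<le> \<rho>" "\<rho> \<le> 1" using h wt by (auto simp: \<rho>_def)
  have M0: "0 \<le> M" using M[OF a] order_trans[OF w_nonneg] by blast
  have "\<rho> * \<rho> \<le> \<rho>" using \<rho> by (simp add: mult_left_le)
  then have "M * \<rho>\<^sup>2 \<le> M * \<rho>" using M0 by (simp add: power2_eq_square mult_left_mono)
  then have 1: "w (f (a + h) - f a - ddx w Y f a * h) \<le> M * \<rho>"
    using ddx_taylor(2)[OF f M a h] by (simp add: \<rho>_def)
  have "w (ddx w Y f a) * w h \<le> M / w t * w h" using ddx_taylor(1)[OF f M a] by (intro mult_right_mono) auto
  then have 2: "w (ddx w Y f a * h) \<le> M * \<rho>" by (simp add: w_mult \<rho>_def)
  show ?thesis using w_add_le[OF 1 2] by (simp add: \<rho>_def)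
qed

lemma ddx_diff:
  assumes "f \<in> holo w Y" "g \<in> holo w Y"
  shows "ddx w Y (f - g) = ddx w Y f - ddx w Y g"
proof
  fix a
  show "ddx w Y (f - g) a = (ddx w Y f - ddx w Y g) a"
    using has_d_ddx[OF _ has_d_diff[OF ddx_has_d ddx_has_d]] assms by (cases "a \<in> Y") (auto simp: ddx_def)
qed

lemma ddx_mult:
  assumes f: "f \<in> holo w Y" and g: "g \<in> holo w Y"
  shows "ddx w Y (f * g) = ddx w Y f * g + f * ddx w Y g"
proof
  fix a
  show "ddx w Y (f * g) a = (ddx w Y f * g + f * ddx w Y g) a"
  proof (cases "a \<in> Y")
    case a: True
    obtain A where A: "0 < A" "\<And>a. a \<in> Y \<Longrightarrow> w (f a) \<le> A" using holo_bounded[OF f] by blast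
    obtain B where B: "0 < B" "\<And>a. a \<in> Y \<Longrightarrow> w (g a) \<le> B" using holo_bounded[OF g] by blast
    have "has_d (f * g) a ((ddx w Y f * g + f * ddx w Y g) a)"
    proof (rule taylor_has_d[of _ _ _ "A * B"])
      fix h assume h: "w h \<le> w t"
      define \<rho> where "\<rho> = w h / w t"
      have \<rho>: "0 \<le> \<rho>" using wt by (auto simp: \<rho>_def)
      have 1: "w ((f (a + h) - f a - ddx w Y f a * h) * g (a + h)) \<le> A * B * \<rho>\<^sup>2"
        using mult_mono[OF ddx_taylor(2)[OF f A(2) a h] B(2)[OF ball_add[OF a h]]] A by (simp add: w_mult \<rho>_def mult_ac)
      have 2: "w (f a * (g (a + h) - g a - ddx w Y g a * h)) \<le> A * B * \<rho>\<^sup>2"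
        using mult_mono[OF A(2)[OF a] ddx_taylor(2)[OF g B(2) a h]] A by (simp add: w_mult \<rho>_def mult_ac)
      have "w (ddx w Y f a) * w h \<le> A / w t * w h" using ddx_taylor(1)[OF f A(2) a] by (intro mult_right_mono) auto
      then have "w (ddx w Y f a) * w h \<le> A * \<rho>" by (simp add: \<rho>_def)
      then have 3: "w (ddx w Y f a * h * (g (a + h) - g a)) \<le> A * B * \<rho>\<^sup>2"
        using mult_mono[OF _ holo_lipschitz[OF g B(2) a h]] A \<rho> by (fastforce simp: w_mult \<rho>_def[symmetric] mult_ac power2_eq_square)
      \<comment> \<open>The remainders of f and of g, each times a bounded factor, plus a product of
        two first-order terms.\<close>
      have "(f * g) (a + h) - (f * g) a - (ddx w Y f * g + f * ddx w Y g) a * h =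
        (f (a + h) - f a - ddx w Y f a * h) * g (a + h) + f a * (g (a + h) - g a - ddx w Y g a * h)
        + ddx w Y f a * h * (g (a + h) - g a)" by (simp add: algebra_simps)
      then show "w ((f * g) (a + h) - (f * g) a - (ddx w Y f * g + f * ddx w Y g) a * h) \<le> A * B * (w h / w t)\<^sup>2"
        using w_add_le[OF w_add_le[OF 1 2] 3] unfolding \<rho>_def by (simp only:)
    qed
    then show ?thesis by (rule has_d_ddx[OF a])
  qed (simp add: ddx_def holo_outside[OF f])
qed

definition coord :: "'k alg_closure \<Rightarrow> 'k alg_closure" where
  "coord a = (if a \<in> Y then a else 0)"

definition unit_fun :: "'k alg_closure \<Rightarrow> 'k alg_closure" where
  "unit_fun a = (if a \<in> Y then 1 else 0)"

lemma const_holo: "(\<lambda>a. if a \<in> Y then to_ac c else 0) \<in> holo w Y"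
  using ratfun_holo[OF ratfun_poly[of "[:c:]"]] by (simp add: pol_pCons cong: if_cong)

lemma unit_holo: "unit_fun \<in> holo w Y"
  using const_holo[of 1] by (simp add: unit_fun_def[abs_def] cong: if_cong)

lemma coord_holo: "coord \<in> holo w Y"
  using ratfun_holo[OF ratfun_poly[of "[:0, 1:]"]] by (simp add: pol_pCons coord_def[abs_def] cong: if_cong)

lemma ddx_coord: "ddx w Y coord = unit_fun"
proof
  fix a
  show "ddx w Y coord a = unit_fun a"
  proof (cases "a \<in> Y")
    case True
    have "has_d coord a 1" unfolding has_d_def using True ball_add[OF True] by (intro exI[of _ 0]) (simp add: coord_def)
    then show ?thesis using has_d_ddx[OF True] True by (simp add: unit_fun_def)
  qed (simp add: ddx_def unit_fun_def)
qed

end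

subsection \<open>Affinoid subdomains\<close>

context ground
begin

text \<open>By the ultrametric inequality every point of a disc is a centre of it.\<close>

lemma disc_good: "c \<noteq> 0 \<Longrightarrow> good_domain p v w (closed_disc w c) (to_ac c)"
proof unfold_locales
  fix a b assume "a \<in> closed_disc w c" "w (b - a) \<le> w (to_ac c)"
  then have "w (a + (b - a)) \<le> w (to_ac c)" by (intro w_add_le) (auto simp: closed_disc_def)
  then show "b \<in> closed_disc w c" by (simp add: closed_disc_def)
qed (auto simp: closed_disc_def)

text \<open>On Z the function F 0 is bounded below, and functions on the disc are Lipschitz, so a
  small translation changes every F i by less than |F 0| and preserves the inequalities that define
  Z.\<close>

lemma rational_subdomain_good:
  assumes c: "c \<noteq> 0" and Z: "rational_subdomain w (closed_disc w c) Z"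
  shows "\<exists>t. good_domain p v w Z t"
proof (use Z[unfolded rational_subdomain_def] in \<open>elim exE conjE\<close>)
  interpret D: good_domain p v w "closed_disc w c" "to_ac c" using c by (rule disc_good)
  let ?D = "closed_disc w c"
  fix n :: nat and F G
  assume FG': "\<forall>i\<le>n. F i \<in> holo w ?D \<and> G i \<in> holo w ?D"
    and one: "\<forall>a\<in>?D. (\<Sum>i\<le>n. G i a * F i a) = 1"
    and Z_eq: "Z = {a \<in> ?D. \<forall>i\<le>n. w (F i a) \<le> w (F 0 a)}"
  from FG' have FG: "\<And>i. i \<le> n \<Longrightarrow> F i \<in> holo w ?D" "\<And>i. i \<le> n \<Longrightarrow> G i \<in> holo w ?D" by blast+
  have bound: "\<exists>M>0. \<forall>i\<le>n. \<forall>a\<in>?D. w (H i a) \<le> M" if H: "\<And>i. i \<le> n \<Longrightarrow> H i \<in> holo w ?D" for H :: "nat \<Rightarrow> 'k alg_closure \<Rightarrow> 'k alg_closure"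
  proof -
    have "\<forall>i. \<exists>M. i \<le> n \<longrightarrow> M > 0 \<and> (\<forall>a\<in>?D. w (H i a) \<le> M)" using H D.holo_bounded by blast
    then obtain M where M: "\<And>i. i \<le> n \<Longrightarrow> M i > 0" "\<And>i a. i \<le> n \<Longrightarrow> a \<in> ?D \<Longrightarrow> w (H i a) \<le> M i" by metis
    have "M i \<le> Max (M ` {..n})" if "i \<le> n" for i using that by (intro Max_ge) auto
    then show ?thesis using M by (intro exI[of _ "Max (M ` {..n})"]) (meson le0 less_le_trans order_trans)
  qed
  obtain A where A: "0 < A" "\<And>i a. i \<le> n \<Longrightarrow> a \<in> ?D \<Longrightarrow> w (F i a) \<le> A" using bound[of F] FG by blast
  obtain B where B: "0 < B" "\<And>i a. i \<le> n \<Longrightarrow> a \<in> ?D \<Longrightarrow> w (G i a) \<le> B" using bound[of G] FG by blast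
  \<comment> \<open>If |F 0| were below 1/B at a point of Z, so would be every |F i|, and the sum of
    the G i F i could not be 1.\<close>
  have big: "1 / B \<le> w (F 0 a)" if a: "a \<in> Z" for a
  proof (rule ccontr)
    assume "\<not> 1 / B \<le> w (F 0 a)"
    then have F0: "w (F 0 a) < 1 / B" by simp
    have aD: "a \<in> ?D" using a Z_eq by blast
    have "w (G i a * F i a) < 1" if i: "i \<in> {..n}" for i
    proof -
      have "w (F i a) < 1 / B" using a F0 i Z_eq by fastforce
      then have "B * w (F i a) < 1" using B(1) by (simp add: pos_less_divide_eq mult.commute)
      moreover have "w (G i a) * w (F i a) \<le> B * w (F i a)" using B(2)[of i a] i aD by (intro mult_right_mono) auto
      ultimately show ?thesis by (simp add: w_mult)
    qed
    then have "w (\<Sum>i\<le>n. G i a * F i a) < 1" by (intro w_sum_less) auto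
    then show False using one aD by simp
  qed
  \<comment> \<open>The F i have Lipschitz constant A / |c|; this radius keeps their variation below
    1/B and the translates inside the disc.\<close>
  obtain t where t: "t \<noteq> 0" "w t < w (to_ac c) / (A * B)" "w t \<le> w (to_ac c)"
    using D.ex_small[of "w (to_ac c) / (A * B)"] D.wt A B by auto
  have "good_domain p v w Z t"
  proof unfold_locales
    show "t \<noteq> 0" by (rule t)
    show "\<exists>B. \<forall>a\<in>Z. w a \<le> B" using D.bounded_domain Z_eq by blast
    fix a b assume a: "a \<in> Z" and b: "w (b - a) \<le> w t"
    have aD: "a \<in> ?D" using a Z_eq by blast
    have bD: "b \<in> ?D" using D.ball[OF aD, of b] b t(3) by linarith
    have close: "w (F i b - F i a) < w (F 0 a)" if i: "i \<le> n" for i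
    proof -
      have "w (F i (a + (b - a)) - F i a) \<le> A * (w (b - a) / w (to_ac c))"
        using D.holo_lipschitz[OF FG(1)[OF i] A(2)[OF i] aD, of "b - a"] b t(3) by linarith
      also have "\<dots> \<le> A * (w t / w (to_ac c))"
        using b A D.wt by (intro mult_left_mono divide_right_mono) auto
      also have "\<dots> < 1 / B" using t(2) A(1) B(1) D.wt by (simp add: field_simps)
      also have "\<dots> \<le> w (F 0 a)" using a by (rule big)
      finally show ?thesis by simp
    qed
    have F0b: "w (F 0 b) = w (F 0 a)" using w_add_eq[OF close[of 0]] by simp
    have "w (F i b) \<le> w (F 0 b)" if i: "i \<le> n" for i
    proof -
      have "w (F i a) \<le> w (F 0 a)" using a i Z_eq by blast
      then have "w (F i b - F i a + F i a) \<le> w (F 0 a)" using close[OF i] by (intro w_add_le) auto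
      then show ?thesis using F0b by simp
    qed
    then show "b \<in> Z" using bD Z_eq by blast
  qed
  then show ?thesis ..
qed

lemma good_union:
  assumes "finite S" "\<And>Z. Z \<in> S \<Longrightarrow> \<exists>t. good_domain p v w Z t"
  shows "\<exists>t. good_domain p v w (\<Union>S) t"
  using assms
proof (induction S)
  case empty
  have "good_domain p v w {} 1" by unfold_locales auto
  then show ?case by auto
next
  case (insert Z S)
  obtain t where "good_domain p v w Z t" using insert.prems by blast
  then interpret Z: good_domain p v w Z t .
  obtain t' where "good_domain p v w (\<Union>S) t'" using insert by blast
  then interpret S: good_domain p v w "\<Union>S" t' .
  obtain B B' where B: "\<And>a. a \<in> Z \<Longrightarrow> w a \<le> B" "\<And>a. a \<in> \<Union>S \<Longrightarrow> w a \<le> B'"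
    using Z.bounded_domain S.bounded_domain by blast
  define s where "s = (if w t \<le> w t' then t else t')"
  have s: "s \<noteq> 0" "w s \<le> w t" "w s \<le> w t'" using Z.t0 S.t0 by (auto simp: s_def)
  have "good_domain p v w (\<Union>(insert Z S)) s"
  proof unfold_locales
    show "s \<noteq> 0" by (rule s)
    show "\<exists>B. \<forall>a\<in>\<Union>(insert Z S). w a \<le> B" using B by (intro exI[of _ "max B B'"]) (fastforce simp: le_max_iff_disj)
    fix a b assume ab: "a \<in> \<Union>(insert Z S)" "w (b - a) \<le> w s"
    then have "w (b - a) \<le> w t" "w (b - a) \<le> w t'" using s by linarith+
    then show "b \<in> \<Union>(insert Z S)" using ab(1) Z.ball S.ball by blast
  qed
  then show ?case ..
qed

lemma affinoid_good: "affinoid_subdomain w Y \<Longrightarrow> \<exists>t. good_domain p v w Y t"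
  unfolding affinoid_subdomain_def using rational_subdomain_good good_union by metis

end

subsection \<open>The supremum norm and the spectral radius\<close>

context good_domain
begin

abbreviation N :: "('k alg_closure \<Rightarrow> 'k alg_closure) \<Rightarrow> real" where "N \<equiv> sup_norm w Y"
abbreviation D :: "('k alg_closure \<Rightarrow> 'k alg_closure) \<Rightarrow> 'k alg_closure \<Rightarrow> 'k alg_closure" where "D \<equiv> ddx w Y"

lemma N_least: "0 \<le> M \<Longrightarrow> (\<And>a. a \<in> Y \<Longrightarrow> w (f a) \<le> M) \<Longrightarrow> N f \<le> M"
  unfolding sup_norm_def by (intro cSup_least) auto

lemma N_upper:
  assumes "f \<in> holo w Y"
  shows "0 \<le> N f" "a \<in> Y \<Longrightarrow> w (f a) \<le> N f"
proof -
  obtain M where M: "M > 0" "\<And>a. a \<in> Y \<Longrightarrow> w (f a) \<le> M" using holo_bounded[OF assms] by blast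
  have "bdd_above (insert 0 ((\<lambda>a. w (f a)) ` Y))" using M by (intro bdd_aboveI[of _ M]) auto
  then show "0 \<le> N f" "a \<in> Y \<Longrightarrow> w (f a) \<le> N f" unfolding sup_norm_def by (auto intro: cSup_upper)
qed

lemma N_zero_iff:
  assumes "f \<in> holo w Y"
  shows "N f = 0 \<longleftrightarrow> f = 0"
proof
  assume "N f = 0"
  then have "w (f a) \<le> 0" if "a \<in> Y" for a using N_upper(2)[OF assms that] by simp
  then have "f a = 0" if "a \<in> Y" for a using that w_pos[of "f a"] by (metis not_le)
  then show "f = 0" using holo_outside[OF assms] by fastforce
next
  assume "f = 0"
  then have "N f \<le> 0" by (intro N_least) auto
  then show "N f = 0" using N_upper(1)[OF assms] by simp
qed

lemma N_diff_max:
  assumes "f \<in> holo w Y" "g \<in> holo w Y"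
  shows "N (f - g) \<le> max (N f) (N g)"
proof (rule N_least)
  fix a assume a: "a \<in> Y"
  show "w ((f - g) a) \<le> max (N f) (N g)"
    using w_diff[of "f a" "g a"] N_upper(2)[OF assms(1) a] N_upper(2)[OF assms(2) a] by simp
qed (use N_upper(1)[OF assms(1)] in simp)

lemma N_mult_le:
  assumes "f \<in> holo w Y" "g \<in> holo w Y"
  shows "N (f * g) \<le> N f * N g"
proof (rule N_least)
  fix a assume a: "a \<in> Y"
  show "w ((f * g) a) \<le> N f * N g"
    using N_upper[OF assms(1)] N_upper[OF assms(2)] a by (simp add: w_mult mult_mono)
qed (use N_upper(1) assms in simp)

lemma sum_fun_apply: "(\<Sum>i\<in>S. F i) a = (\<Sum>i\<in>S. F i a)" for F :: "'c \<Rightarrow> 'd \<Rightarrow> 'e::comm_monoid_add"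
  by (induction S rule: infinite_finite_induct) auto

lemma holo_zero: "0 \<in> holo w Y"
  using holo_diff[OF unit_holo unit_holo] by simp

lemma holo_add: "f \<in> holo w Y \<Longrightarrow> g \<in> holo w Y \<Longrightarrow> f + g \<in> holo w Y"
  using holo_diff[OF _ holo_diff[OF holo_zero]] by (metis diff_minus_eq_add diff_0)

lemma holo_sum: "(\<And>i. i \<in> S \<Longrightarrow> F i \<in> holo w Y) \<Longrightarrow> (\<Sum>i\<in>S. F i) \<in> holo w Y"
  by (induction S rule: infinite_finite_induct) (auto simp: holo_zero holo_add)

lemma holo_series_complete:
  assumes F: "\<And>i. F i \<in> holo w Y" and lim: "(\<lambda>i. N (F i)) \<longlonglongrightarrow> 0"
  shows "\<exists>g\<in>holo w Y. (\<lambda>n. N ((\<Sum>i<n. F i) - g)) \<longlonglongrightarrow> 0"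
proof -
  have "\<exists>g\<in>holo w Y. \<forall>e>0. \<exists>n0. \<forall>n\<ge>n0. \<forall>a\<in>Y. w ((\<Sum>i<n. F i) a - g a) < e"
  proof (rule holo_complete)
    show "(\<Sum>i<n. F i) \<in> holo w Y" for n using F by (intro holo_sum)
    fix e :: real assume e: "0 < e"
    have "\<forall>\<^sub>F i in sequentially. N (F i) < e" using lim e by (intro order_tendstoD) auto
    then obtain n0 where n0: "\<And>i. n0 \<le> i \<Longrightarrow> N (F i) < e" by (auto simp: eventually_sequentially)
    have small: "w ((\<Sum>i<m. F i) a - (\<Sum>i<n. F i) a) < e" if mn: "n0 \<le> n" "n \<le> m" and a: "a \<in> Y" for m n a
    proof -
      have "(\<Sum>i<m. F i) a - (\<Sum>i<n. F i) a = (\<Sum>i\<in>{..<m} - {..<n}. F i a)"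
        using mn sum_diff[of "{..<m}" "{..<n}" "\<lambda>i. F i a"] by (simp add: sum_fun_apply)
      also have "w \<dots> < e"
      proof (rule w_sum_less[OF e])
        fix i assume "i \<in> {..<m} - {..<n}"
        then show "w (F i a) < e" using N_upper(2)[OF F a, of i] n0[of i] mn by simp
      qed
      finally show ?thesis .
    qed
    have "w ((\<Sum>i<m. F i) a - (\<Sum>i<n. F i) a) < e" if "n0 \<le> m" "n0 \<le> n" "a \<in> Y" for m n a
      using small[of n m a] small[of m n a] that w_diff_commute[of "(\<Sum>i<m. F i) a"] by (cases "n \<le> m") auto
    then show "\<exists>n0. \<forall>m\<ge>n0. \<forall>n\<ge>n0. \<forall>a\<in>Y. w ((\<Sum>i<m. F i) a - (\<Sum>i<n. F i) a) < e" by blast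
  qed
  then obtain g where g: "g \<in> holo w Y" "\<And>e. 0 < e \<Longrightarrow> \<exists>n0. \<forall>n\<ge>n0. \<forall>a\<in>Y. w ((\<Sum>i<n. F i) a - g a) < e" by blast
  have "(\<lambda>n. N ((\<Sum>i<n. F i) - g)) \<longlonglongrightarrow> 0"
  proof (rule LIMSEQ_I)
    fix e :: real assume e: "0 < e"
    then have e2: "0 < e / 2" by simp
    obtain n0 where n0: "\<And>n a. n0 \<le> n \<Longrightarrow> a \<in> Y \<Longrightarrow> w ((\<Sum>i<n. F i) a - g a) < e / 2" using g(2)[OF e2] by blast
    have "norm (N ((\<Sum>i<n. F i) - g) - 0) < e" if n: "n0 \<le> n" for n
    proof -
      have "N ((\<Sum>i<n. F i) - g) \<le> e / 2" using n0[OF n] e by (intro N_least) (auto simp: less_imp_le)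
      moreover have "0 \<le> N ((\<Sum>i<n. F i) - g)" using F g(1) by (intro N_upper(1) holo_diff holo_sum)
      ultimately show ?thesis using e by simp
    qed
    then show "\<exists>n0. \<forall>n\<ge>n0. norm (N ((\<Sum>i<n. F i) - g) - 0) < e" by blast
  qed
  then show ?thesis using g(1) by blast
qed

lemma N_D: "f \<in> holo w Y \<Longrightarrow> N (D f) \<le> N f / w t"
  using ddx_taylor(1)[OF _ N_upper(2)] N_upper(1) wt by (intro N_least) auto

lemma Dpow_holo: "f \<in> holo w Y \<Longrightarrow> (D ^^ m) f \<in> holo w Y"
  by (induction m) (auto simp: ddx_holo)

lemma N_Dpow: "f \<in> holo w Y \<Longrightarrow> N ((D ^^ m) f) \<le> N f / w t ^ m"
proof (induction m)
  case (Suc m)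
  have "N (D ((D ^^ m) f)) \<le> N ((D ^^ m) f) / w t" using Dpow_holo[OF Suc.prems] by (rule N_D)
  also have "\<dots> \<le> (N f / w t ^ m) / w t" using Suc by (intro divide_right_mono) auto
  finally show ?case by (simp add: mult.commute)
qed simp

abbreviation op :: "nat \<Rightarrow> real" where "op m \<equiv> op_norm w Y (D ^^ m)"

text \<open>The Cauchy estimate bounds all quotients by 1 / |t|^m, so the supremum in
  \<open>op_norm\<close> is a genuine one. A function of norm 0 contributes 0 / 0 = 0.\<close>

lemma op_upper:
  assumes f: "f \<in> holo w Y"
  shows "N ((D ^^ m) f) \<le> op m * N f" "0 \<le> op m"
proof -
  have le: "N ((D ^^ m) f) / N f \<le> op m" if f: "f \<in> holo w Y" for f
    unfolding op_norm_def
  proof (rule cSup_upper)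
    show "N ((D ^^ m) f) / N f \<in> (\<lambda>f. N ((D ^^ m) f) / N f) ` holo w Y" using f by blast
    show "bdd_above ((\<lambda>f. N ((D ^^ m) f) / N f) ` holo w Y)"
    proof (rule bdd_aboveI)
      fix x assume "x \<in> (\<lambda>f. N ((D ^^ m) f) / N f) ` holo w Y"
      then obtain f where f: "f \<in> holo w Y" and x: "x = N ((D ^^ m) f) / N f" by blast
      show "x \<le> 1 / w t ^ m"
        unfolding x using N_Dpow[OF f, of m] N_upper(1)[OF f] wt by (cases "N f = 0") (auto simp: field_simps)
    qed
  qed
  have "0 \<le> N ((D ^^ m) f) / N f" using f by (intro divide_nonneg_nonneg N_upper(1) Dpow_holo)
  then show "0 \<le> op m" using le[OF f] by linarith
  show "N ((D ^^ m) f) \<le> op m * N f"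
  proof (cases "N f = 0")
    case True
    then show ?thesis using N_Dpow[OF f, of m] by simp
  next
    case False
    then have "0 < N f" using N_upper(1)[OF f] by simp
    then show ?thesis using le[OF f] by (simp add: pos_divide_le_eq)
  qed
qed

lemma op_nonneg: "0 \<le> op m"
  by (rule op_upper(2)[OF holo_zero])

lemma op_submult: "op (m + n) \<le> op m * op n"
  unfolding op_norm_def[of w Y "D ^^ (m + n)"]
proof (rule cSup_least)
  show "(\<lambda>f. N ((D ^^ (m + n)) f) / N f) ` holo w Y \<noteq> {}" using holo_zero by blast
  fix x assume "x \<in> (\<lambda>f. N ((D ^^ (m + n)) f) / N f) ` holo w Y"
  then obtain f where f: "f \<in> holo w Y" and x: "x = N ((D ^^ (m + n)) f) / N f" by blast
  show "x \<le> op m * op n"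
  proof (cases "N f = 0")
    case True
    then show ?thesis using x op_nonneg by simp
  next
    case False
    then have "0 < N f" using N_upper(1)[OF f] by simp
    have "N ((D ^^ (m + n)) f) \<le> op m * N ((D ^^ n) f)"
      using op_upper(1)[OF Dpow_holo[OF f]] by (simp add: funpow_add)
    also have "\<dots> \<le> op m * (op n * N f)" using op_upper(1)[OF f] op_nonneg by (intro mult_left_mono)
    finally show ?thesis unfolding x using \<open>0 < N f\<close> by (simp add: pos_divide_le_eq mult.assoc)
  qed
qed

text \<open>Submultiplicativity makes the roots converge, so \<open>lim\<close> in
  \<open>spectral_radius\<close> is an actual limit. r0 is the midpoint between it and r, which
  leaves room on both sides.\<close>

lemma spectral_bound:
  assumes "spectral_radius w Y < r" "0 < r"
  obtains r0 C where "0 < r0" "r0 < r" "\<And>f m. f \<in> holo w Y \<Longrightarrow> N ((D ^^ m) f) \<le> C * r0 ^ m * N f"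
proof -
  obtain L where L: "0 \<le> L" "(\<lambda>n. root n (op n)) \<longlonglongrightarrow> L"
    by (rule fekete_root[of op, OF op_nonneg op_submult]) (rule that; assumption)
  then have "L < r" using assms(1) limI[OF L(2)] by (simp add: spectral_radius_def)
  define r0 where "r0 = (L + r) / 2"
  have r0: "L < r0" "0 < r0" "r0 < r" using \<open>L < r\<close> L(1) by (auto simp: r0_def)
  obtain C where op_le: "\<And>n. op n \<le> C * r0 ^ n"
    using root_limit_growth[of op, OF op_nonneg L(2) r0(1,2)] by blast
  have "N ((D ^^ m) f) \<le> C * r0 ^ m * N f" if f: "f \<in> holo w Y" for f m
    using op_upper(1)[OF f, of m] mult_right_mono[OF op_le[of m] N_upper(1)[OF f]] by linarith
  then show ?thesis using that r0 by blast
qed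

lemma ddx_add:
  assumes "f \<in> holo w Y" "g \<in> holo w Y"
  shows "D (f + g) = D f + D g"
proof -
  have "D ((f + g) - g) = D (f + g) - D g" using assms by (intro ddx_diff holo_add)
  then show ?thesis by simp
qed

section \<open>Powers of the coordinate and faithfulness of differential operators\<close>

lemma D_unit: "D unit_fun = 0"
proof -
  have "unit_fun * unit_fun = unit_fun" by (simp add: unit_fun_def fun_eq_iff)
  then have "D unit_fun = D unit_fun * unit_fun + unit_fun * D unit_fun" using ddx_mult[OF unit_holo unit_holo] by simp
  moreover have "unit_fun * D unit_fun = D unit_fun"
    using holo_outside[OF ddx_holo[OF unit_holo]] by (auto simp: unit_fun_def fun_eq_iff)
  ultimately show ?thesis by (simp add: mult.commute)
qed

lemma unit_mult: "f \<in> holo w Y \<Longrightarrow> unit_fun * f = f"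
  using holo_outside[of f] by (auto simp: unit_fun_def fun_eq_iff)

text \<open>Powers of x cut off outside Y. The power operation of the function type would have the
  zeroth power 1 outside Y as well.\<close>

primrec cpow :: "nat \<Rightarrow> 'k alg_closure \<Rightarrow> 'k alg_closure" where
  "cpow 0 = unit_fun"
| "cpow (Suc n) = coord * cpow n"

lemma cpow_holo: "cpow n \<in> holo w Y"
  by (induction n) (simp_all only: cpow.simps unit_holo coord_holo holo_mult)

lemma D_zero: "D 0 = 0"
  using ddx_add[OF holo_zero holo_zero] by simp

lemma D_of_nat_mult:
  assumes f: "f \<in> holo w Y"
  shows "D (of_nat n * f) = of_nat n * D f \<and> of_nat n * f \<in> holo w Y"
proof (rule nat.induct[of "\<lambda>n. D (of_nat n * f) = of_nat n * D f \<and> of_nat n * f \<in> holo w Y"])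
  show "D (of_nat 0 * f) = of_nat 0 * D f \<and> of_nat 0 * f \<in> holo w Y" by (simp add: holo_zero D_zero)
  fix n assume "D (of_nat n * f) = of_nat n * D f \<and> of_nat n * f \<in> holo w Y"
  then show "D (of_nat (Suc n) * f) = of_nat (Suc n) * D f \<and> of_nat (Suc n) * f \<in> holo w Y"
    using f by (simp add: distrib_right ddx_add holo_add)
qed

lemma D_cpow: "D (cpow (Suc n)) = of_nat (Suc n) * cpow n"
proof (rule nat.induct[of "\<lambda>n. D (cpow (Suc n)) = of_nat (Suc n) * cpow n"])
  show "D (cpow (Suc 0)) = of_nat (Suc 0) * cpow 0"
    using ddx_mult[OF coord_holo unit_holo]
    by (simp add: ddx_coord D_unit unit_mult unit_holo)
  fix n assume IH: "D (cpow (Suc n)) = of_nat (Suc n) * cpow n"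
  have "D (cpow (Suc (Suc n))) = unit_fun * cpow (Suc n) + coord * D (cpow (Suc n))"
    using ddx_mult[OF coord_holo cpow_holo[of "Suc n"]] by (simp only: ddx_coord cpow.simps)
  also have "\<dots> = cpow (Suc n) + of_nat (Suc n) * (coord * cpow n)"
    by (simp only: IH unit_mult[OF cpow_holo] mult.left_commute)
  also have "\<dots> = of_nat (Suc (Suc n)) * cpow (Suc n)"
    by (simp add: algebra_simps)
  finally show "D (cpow (Suc (Suc n))) = of_nat (Suc (Suc n)) * cpow (Suc n)" .
qed

text \<open>The scalar is (n+1)(n+2)...(n+k); for n = 0 it is k!, the factor that
  \<open>operator_faithful\<close> cancels.\<close>

lemma Dpow_cpow: "(D ^^ k) (cpow (k + n)) = of_nat (pochhammer (Suc n) k) * cpow n"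
proof (induction k arbitrary: n)
  case 0
  have "(D ^^ 0) (cpow (0 + n)) = of_nat (pochhammer (Suc n) 0) * cpow n" by simp
  then show ?case .
next
  case (Suc k)
  have "(D ^^ Suc k) (cpow (Suc k + n)) = D ((D ^^ k) (cpow (k + Suc n)))" by (simp only: funpow.simps comp_apply add_Suc add_Suc_right)
  also have "\<dots> = of_nat (pochhammer (Suc (Suc n)) k) * D (cpow (Suc n))"
    using D_of_nat_mult[OF cpow_holo[of "Suc n"]] by (simp only: Suc.IH[of "Suc n"])
  also have "\<dots> = of_nat (pochhammer (Suc n) (Suc k)) * cpow n"
    unfolding D_cpow pochhammer_rec by (simp only: of_nat_mult mult_ac Suc_eq_plus1[symmetric])
  finally show ?case .
qed

lemma Dpow_cpow_zero:
  assumes "k < j"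
  shows "(D ^^ j) (cpow k) = 0"
proof -
  obtain i where j: "j = i + Suc k" using assms less_iff_Suc_add[of k j] by (auto simp: add.commute)
  have "(D ^^ Suc k) (cpow k) = D (of_nat (pochhammer (Suc 0) k) * unit_fun)"
    using Dpow_cpow[of k 0] by simp
  also have "\<dots> = 0" using D_of_nat_mult[OF unit_holo] D_unit by simp
  finally have *: "(D ^^ Suc k) (cpow k) = 0" .
  have "(D ^^ i) 0 = 0" by (induction i) (simp_all only: funpow.simps comp_apply id_apply D_zero)
  then show ?thesis unfolding j funpow_add comp_apply * .
qed

text \<open>Apply the operator to x^k: coefficients below k vanish by induction, derivatives of
  order above k kill x^k, and k! a_k remains, with k! nonzero in characteristic zero.\<close>

lemma operator_faithful:
  assumes a: "\<And>j. a j \<in> holo w Y" and fin: "finite {j. a j \<noteq> 0}"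
    and zero: "\<And>f. f \<in> holo w Y \<Longrightarrow> (\<Sum>j | a j \<noteq> 0. a j * (D ^^ j) f) = 0"
  shows "a j = 0"
proof (induction j rule: less_induct)
  case (less k)
  have "(\<Sum>j | a j \<noteq> 0. a j * (D ^^ j) (cpow k)) = (\<Sum>j\<in>{k}. a j * (D ^^ j) (cpow k))"
  proof (cases "a k = 0")
    case True
    have "a j * (D ^^ j) (cpow k) = 0" if "a j \<noteq> 0" for j
      using that less[of j] Dpow_cpow_zero[of k j] True by (cases j k rule: linorder_cases) auto
    then show ?thesis using True by (simp add: sum.neutral)
  next
    case False
    have "a j * (D ^^ j) (cpow k) = 0" if "a j \<noteq> 0" "j \<noteq> k" for j
      using that less[of j] Dpow_cpow_zero[of k j] by (cases j k rule: linorder_cases) auto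
    then show ?thesis using False fin by (intro sum.mono_neutral_right) auto
  qed
  then have "a k * (of_nat (pochhammer (Suc 0) k) * unit_fun) = 0"
    using zero[OF cpow_holo[of k]] Dpow_cpow[of k 0] by simp
  then have "(of_nat (pochhammer (Suc 0) k) :: 'k alg_closure \<Rightarrow> 'k alg_closure) * (unit_fun * a k) = 0" by (simp add: mult_ac)
  then have "of_nat (pochhammer (Suc 0) k) * a k = 0" using unit_mult[OF a[of k]] by simp
  moreover have "pochhammer (Suc 0) k \<noteq> 0" by (simp add: pochhammer_fact[symmetric, where ?'a = nat, simplified])
  ultimately show "a k = 0" by (simp add: fun_eq_iff)
qed

lemma nonarch_diff_algebra:
  assumes "0 < r" "\<And>f m. f \<in> holo w Y \<Longrightarrow> N ((D ^^ m) f) \<le> C * r ^ m * N f"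
  shows "nonarch_diff_algebra (holo w Y) unit_fun N D r"
proof
  show "\<exists>C. \<forall>a\<in>holo w Y. \<forall>m. N ((D ^^ m) a) \<le> C * r ^ m * N a" using assms(2) by blast
  show "\<And>a j. (\<And>j. a j \<in> holo w Y) \<Longrightarrow> finite {j. a j \<noteq> 0} \<Longrightarrow>
    (\<And>f. f \<in> holo w Y \<Longrightarrow> (\<Sum>j | a j \<noteq> 0. a j * (D ^^ j) f) = 0) \<Longrightarrow> a j = 0"
    by (rule operator_faithful)
  show "\<And>F. (\<And>i. F i \<in> holo w Y) \<Longrightarrow> (\<lambda>i. N (F i)) \<longlonglongrightarrow> 0 \<Longrightarrow>
    \<exists>g\<in>holo w Y. (\<lambda>n. N ((\<Sum>i<n. F i) - g)) \<longlonglongrightarrow> 0"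
    by (rule holo_series_complete)
qed (fact unit_holo holo_diff holo_mult unit_mult N_upper(1) N_zero_iff N_diff_max N_mult_le ddx_holo ddx_add ddx_mult assms(1))+

end

section \<open>The twisted automorphism\<close>

context nonarch_diff_algebra
begin

subsection \<open>The ring of differential operators\<close>

text \<open>\<open>dop\<close>, \<open>dring\<close>, \<open>sring\<close> and \<open>emb\<close>
  are the abstract counterparts of \<open>diff_op\<close>, \<open>diff_ring\<close>,
  \<open>completed_diff_ring\<close> and \<open>diff_embed\<close>; \<open>dictionary\<close>
  identifies them.\<close>

definition dop :: "(nat \<Rightarrow> 'a) \<Rightarrow> 'a \<Rightarrow> 'a" where
  "dop a = (\<lambda>f\<in>A. opL D a f)"

definition dring :: "('a \<Rightarrow> 'a) ring" where
  "dring = \<lparr>carrier = dop ` fin, monoid.mult = compose A, one = (\<lambda>f\<in>A. f),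
     zero = (\<lambda>f\<in>A. 0), add = (\<lambda>S T. \<lambda>f\<in>A. S f + T f)\<rparr>"

definition sring :: "(nat \<Rightarrow> 'a) ring" where
  "sring = \<lparr>carrier = Car, monoid.mult = prod, one = (\<lambda>j. if j = 0 then e else 0),
     zero = (\<lambda>j. 0), add = (\<lambda>u v. u + v)\<rparr>"

definition emb :: "('a \<Rightarrow> 'a) \<Rightarrow> nat \<Rightarrow> 'a" where
  "emb P = (THE a. a \<in> fin \<and> dop a = P)"

definition mono_symbol :: "'a \<Rightarrow> nat \<Rightarrow> nat \<Rightarrow> 'a" where
  "mono_symbol g k = (\<lambda>j. if j = k then g else 0)"

text \<open>The condition inside \<open>theta\<close>, with c in the place of -(1/d) u'/u.\<close>

definition is_theta :: "'a \<Rightarrow> (('a \<Rightarrow> 'a) \<Rightarrow> ('a \<Rightarrow> 'a)) \<Rightarrow> bool" where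
  "is_theta c \<theta> \<longleftrightarrow> \<theta> \<in> extensional (carrier dring) \<and> \<theta> \<in> ring_iso dring dring \<and>
     (\<forall>g\<in>A. \<forall>P\<in>carrier dring. \<theta> ((\<lambda>f\<in>A. g * f) \<otimes>\<^bsub>dring\<^esub> P) = (\<lambda>f\<in>A. g * f) \<otimes>\<^bsub>dring\<^esub> \<theta> P) \<and>
     \<theta> (\<lambda>f\<in>A. D f) = (\<lambda>f\<in>A. D f + c * f)"

lemma dop_inj:
  assumes "a \<in> fin" "b \<in> fin" "dop a = dop b"
  shows "a = b"
  using assms(1,2)
proof (rule opL_faithful)
  fix f assume "f \<in> A"
  then show "opL D a f = opL D b f" using fun_cong[OF assms(3), of f] by (simp add: dop_def)
qed

lemma emb_dop: "a \<in> fin \<Longrightarrow> emb (dop a) = a"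
  unfolding emb_def using dop_inj by (intro the_equality) auto

lemma mono_symbol_fin: "g \<in> A \<Longrightarrow> mono_symbol g k \<in> fin"
  by (intro finI[of _ "Suc k"]) (auto simp: mono_symbol_def)

lemma opL_mono_symbol: "opL L (mono_symbol g k) f = g * (L ^^ k) f"
proof -
  have "opL L (mono_symbol g k) f = (\<Sum>j<Suc k. mono_symbol g k j * (L ^^ j) f)"
    by (rule opL_eq) (simp add: mono_symbol_def)
  also have "\<dots> = g * (L ^^ k) f" by (simp add: mono_symbol_def)
  finally show ?thesis .
qed

lemma dop_compose:
  assumes "u \<in> fin" "v \<in> fin"
  shows "compose A (dop u) (dop v) = dop (prod u v)"
proof
  fix f
  show "compose A (dop u) (dop v) f = dop (prod u v) f"
    using assms opL_prod[OF twisted_D assms, of f] opL_in[OF twisted_D assms(2), of f]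
    by (cases "f \<in> A") (simp_all add: compose_def dop_def)
qed

lemma dop_add:
  assumes "u \<in> fin" "v \<in> fin"
  shows "(\<lambda>f\<in>A. dop u f + dop v f) = dop (u + v)"
  by (rule ext) (simp add: dop_def opL_add[OF assms])

lemma dop_one: "(\<lambda>f\<in>A. f) = dop (mono_symbol e 0)"
  by (rule ext) (simp add: dop_def opL_mono_symbol)

lemma dop_mult: "(\<lambda>f\<in>A. g * f) = dop (mono_symbol g 0)"
  by (rule ext) (simp add: dop_def opL_mono_symbol)

lemma dop_D: "(\<lambda>f\<in>A. D f) = dop (mono_symbol e 1)"
  by (rule ext) (simp add: dop_def opL_mono_symbol)

lemma dop_mono_symbol_Suc: "dop (mono_symbol e (Suc k)) = compose A (dop (mono_symbol e 1)) (dop (mono_symbol e k))"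
  by (rule ext) (simp add: dop_def opL_mono_symbol compose_def)

lemma dop_mono_symbol: "dop (mono_symbol g k) = compose A (\<lambda>f\<in>A. g * f) (dop (mono_symbol e k))"
  by (rule ext) (simp add: dop_def opL_mono_symbol compose_def)

lemma is_thetaD:
  assumes "is_theta c \<theta>"
  shows "\<theta> \<in> extensional (carrier dring)"
    "\<And>u v. u \<in> fin \<Longrightarrow> v \<in> fin \<Longrightarrow> \<theta> (compose A (dop u) (dop v)) = compose A (\<theta> (dop u)) (\<theta> (dop v))"
    "\<And>u v. u \<in> fin \<Longrightarrow> v \<in> fin \<Longrightarrow> \<theta> (dop (u + v)) = (\<lambda>f\<in>A. \<theta> (dop u) f + \<theta> (dop v) f)"
    "\<theta> (dop (mono_symbol e 0)) = (\<lambda>f\<in>A. f)"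
    "\<And>g u. g \<in> A \<Longrightarrow> u \<in> fin \<Longrightarrow> \<theta> (compose A (\<lambda>f\<in>A. g * f) (dop u)) = compose A (\<lambda>f\<in>A. g * f) (\<theta> (dop u))"
    "\<theta> (dop (mono_symbol e 1)) = (\<lambda>f\<in>A. D f + c * f)"
proof -
  have h: "\<theta> \<in> ring_hom dring dring" using assms by (simp add: is_theta_def ring_iso_def)
  show "\<theta> \<in> extensional (carrier dring)" using assms by (simp add: is_theta_def)
  show "\<And>u v. u \<in> fin \<Longrightarrow> v \<in> fin \<Longrightarrow> \<theta> (compose A (dop u) (dop v)) = compose A (\<theta> (dop u)) (\<theta> (dop v))"
    using ring_hom_mult[OF h] by (simp add: dring_def)
  show "\<And>u v. u \<in> fin \<Longrightarrow> v \<in> fin \<Longrightarrow> \<theta> (dop (u + v)) = (\<lambda>f\<in>A. \<theta> (dop u) f + \<theta> (dop v) f)"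
    using ring_hom_add[OF h] by (simp add: dring_def flip: dop_add)
  show "\<theta> (dop (mono_symbol e 0)) = (\<lambda>f\<in>A. f)"
    using ring_hom_one[OF h] by (simp add: dring_def flip: dop_one)
  show "\<And>g u. g \<in> A \<Longrightarrow> u \<in> fin \<Longrightarrow> \<theta> (compose A (\<lambda>f\<in>A. g * f) (dop u)) = compose A (\<lambda>f\<in>A. g * f) (\<theta> (dop u))"
    using assms by (simp add: is_theta_def dring_def)
  show "\<theta> (dop (mono_symbol e 1)) = (\<lambda>f\<in>A. D f + c * f)"
    unfolding dop_D[symmetric] using assms by (simp only: is_theta_def)
qed

text \<open>Multiplicativity fixes \<theta> on the powers of D, linearity over A fixes it on g D^k,
  and additivity on finite sums, by induction on the length of the symbol.\<close>

lemma is_theta_unique: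
  assumes 1: "is_theta c \<theta>" and 2: "is_theta c \<theta>'"
  shows "\<theta> = \<theta>'"
proof -
  note T1 = is_thetaD[OF 1] and T2 = is_thetaD[OF 2]
  have D_power: "\<theta> (dop (mono_symbol e k)) = \<theta>' (dop (mono_symbol e k))" for k
  proof (induction k)
    case 0
    show ?case by (simp only: T1(4) T2(4))
  next
    case (Suc k)
    have m: "mono_symbol e 1 \<in> fin" "mono_symbol e k \<in> fin" by (auto intro: mono_symbol_fin)
    show ?case unfolding dop_mono_symbol_Suc by (simp only: T1(2)[OF m] T2(2)[OF m] T1(6) T2(6) Suc)
  qed
  have mon: "\<theta> (dop (mono_symbol g k)) = \<theta>' (dop (mono_symbol g k))" if g: "g \<in> A" for g k
  proof -
    have m: "mono_symbol e k \<in> fin" by (auto intro: mono_symbol_fin)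
    show ?thesis unfolding dop_mono_symbol[of g] by (simp only: T1(5)[OF g m] T2(5)[OF g m] D_power)
  qed
  have bounded: "\<theta> (dop a) = \<theta>' (dop a)" if "a \<in> fin" "\<And>j. n \<le> j \<Longrightarrow> a j = 0" for a n
    using that
  proof (induction n arbitrary: a)
    case 0
    then have "a = mono_symbol 0 0" by (auto simp: mono_symbol_def)
    then show ?case using mon[of 0 0] by simp
  next
    case (Suc n)
    define b where "b j = (if j < n then a j else 0)" for j
    have aA: "a j \<in> A" for j using Suc.prems by (simp add: fin_def)
    have b: "b \<in> fin" using aA by (intro finI[of _ n]) (auto simp: b_def)
    have b0: "b j = 0" if "n \<le> j" for j using that by (simp add: b_def)
    have m: "mono_symbol (a n) n \<in> fin" using aA by (rule mono_symbol_fin)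
    have ab: "a = b + mono_symbol (a n) n"
    proof
      fix j
      show "a j = (b + mono_symbol (a n) n) j"
        using Suc.prems(2)[of j] by (cases j n rule: linorder_cases) (auto simp: b_def mono_symbol_def)
    qed
    have "\<theta> (dop b) = \<theta>' (dop b)" using b b0 by (rule Suc.IH)
    then have "\<theta> (dop (b + mono_symbol (a n) n)) = \<theta>' (dop (b + mono_symbol (a n) n))"
      by (simp only: T1(3)[OF b m] T2(3)[OF b m] mon[OF aA])
    then show ?case using ab by simp
  qed
  show ?thesis
  proof (rule extensionalityI[OF T1(1) T2(1)])
    fix P assume "P \<in> carrier dring"
    then obtain a where a: "a \<in> fin" "P = dop a" by (auto simp: dring_def)
    then show "\<theta> P = \<theta>' P" using fin_bound[OF a(1)] bounded by blast
  qed
qed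

text \<open>By faithfulness a substitution is computed by comparing operators, the original symbol
  being evaluated at D + c.\<close>

lemma opL_conj_fin_eqI:
  assumes "a \<in> fin" "b \<in> fin" "c \<in> A" "\<And>f. f \<in> A \<Longrightarrow> opL (\<lambda>f. D f + c * f) a f = opL D b f"
  shows "conj (bet c) a = b"
  by (rule opL_faithful) (use assms in \<open>auto intro: conj_fin simp: opL_conj[OF twisted_D]\<close>)

lemma conj_mono_symbol_0:
  assumes "c \<in> A" "g \<in> A"
  shows "conj (bet c) (mono_symbol g 0) = mono_symbol g 0"
  by (rule opL_conj_fin_eqI) (use assms in \<open>auto intro: mono_symbol_fin simp: opL_mono_symbol\<close>)

lemma conj_add_fin:
  assumes "a \<in> fin" "b \<in> fin" "c \<in> A"
  shows "conj (bet c) (a + b) = conj (bet c) a + conj (bet c) b"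
  by (rule opL_conj_fin_eqI) (use assms in \<open>auto intro: conj_fin fin_add simp: opL_add conj_fin opL_conj[OF twisted_D]\<close>)

text \<open>The substitution on finite symbols, carried over to operators; its inverse is the
  substitution for -c. With uniqueness, this is what the description in \<open>theta\<close>
  denotes.\<close>

lemma is_theta_conj:
  assumes c: "c \<in> A"
  shows "is_theta c (\<lambda>P\<in>carrier dring. dop (conj (bet c) (emb P)))" (is "is_theta c ?\<theta>")
proof -
  have \<theta>: "?\<theta> (dop a) = dop (conj (bet c) a)" if "a \<in> fin" for a
    using that by (simp add: dring_def emb_dop)
  have carrier: "P \<in> carrier dring \<longleftrightarrow> (\<exists>a\<in>fin. P = dop a)" for P by (auto simp: dring_def)
  have mult: "?\<theta> (compose A (dop u) (dop v)) = compose A (?\<theta> (dop u)) (?\<theta> (dop v))" if "u \<in> fin" "v \<in> fin" for u v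
    using that c by (simp only: dop_compose \<theta> prod_fin conj_fin conj_prod_fin)
  have "?\<theta> \<in> ring_hom dring dring"
  proof (rule ring_hom_memI)
    fix P assume "P \<in> carrier dring"
    then show "?\<theta> P \<in> carrier dring" using \<theta> conj_fin[OF _ c] carrier by metis
  next
    fix P Q assume "P \<in> carrier dring" "Q \<in> carrier dring"
    then obtain u v where uv: "u \<in> fin" "v \<in> fin" "P = dop u" "Q = dop v" using carrier by blast
    show "?\<theta> (P \<otimes>\<^bsub>dring\<^esub> Q) = ?\<theta> P \<otimes>\<^bsub>dring\<^esub> ?\<theta> Q"
      using mult[OF uv(1,2)] uv(3,4) by (simp only: dring_def monoid.simps)
    have "?\<theta> (dop (u + v)) = (\<lambda>f\<in>A. ?\<theta> (dop u) f + ?\<theta> (dop v) f)"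
      using uv c by (simp only: \<theta> fin_add conj_add_fin conj_fin dop_add)
    then show "?\<theta> (P \<oplus>\<^bsub>dring\<^esub> Q) = ?\<theta> P \<oplus>\<^bsub>dring\<^esub> ?\<theta> Q"
      using uv by (simp only: dring_def ring.simps dop_add)
  next
    have "?\<theta> (\<lambda>f\<in>A. f) = (\<lambda>f\<in>A. f)"
      using c by (simp only: dop_one \<theta> mono_symbol_fin e_in conj_mono_symbol_0)
    then show "?\<theta> \<one>\<^bsub>dring\<^esub> = \<one>\<^bsub>dring\<^esub>" by (simp only: dring_def monoid.simps)
  qed
  moreover have "bij_betw ?\<theta> (carrier dring) (carrier dring)"
  proof (rule bij_betwI[where g = "\<lambda>P\<in>carrier dring. dop (conj (bet (- c)) (emb P))"])
    let ?\<theta>' = "\<lambda>P\<in>carrier dring. dop (conj (bet (- c)) (emb P))"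
    have c': "- c \<in> A" using c by (rule uminus_in)
    have \<theta>': "?\<theta>' (dop a) = dop (conj (bet (- c)) a)" if "a \<in> fin" for a
      using that by (simp add: dring_def emb_dop)
    show "?\<theta> \<in> carrier dring \<rightarrow> carrier dring"
    proof (rule Pi_I)
      fix P assume "P \<in> carrier dring"
      then show "?\<theta> P \<in> carrier dring" using \<theta> conj_fin[OF _ c] carrier by metis
    qed
    show "?\<theta>' \<in> carrier dring \<rightarrow> carrier dring"
    proof (rule Pi_I)
      fix P assume "P \<in> carrier dring"
      then show "?\<theta>' P \<in> carrier dring" using \<theta>' conj_fin[OF _ c'] carrier by metis
    qed
    show "?\<theta>' (?\<theta> P) = P" if P: "P \<in> carrier dring" for P
    proof -
      obtain a where a: "a \<in> fin" "P = dop a" using P carrier by blast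
      show ?thesis unfolding a(2) \<theta>[OF a(1)] \<theta>'[OF conj_fin[OF a(1) c]] conj_conj_fin[OF a(1) c] ..
    qed
    show "?\<theta> (?\<theta>' P) = P" if P: "P \<in> carrier dring" for P
    proof -
      obtain a where a: "a \<in> fin" "P = dop a" using P carrier by blast
      show ?thesis unfolding a(2) \<theta>'[OF a(1)] \<theta>[OF conj_fin[OF a(1) c']]
        using conj_conj_fin[OF a(1) c'] by simp
    qed
  qed
  moreover have "?\<theta> ((\<lambda>f\<in>A. g * f) \<otimes>\<^bsub>dring\<^esub> P) = (\<lambda>f\<in>A. g * f) \<otimes>\<^bsub>dring\<^esub> ?\<theta> P"
    if g: "g \<in> A" and P: "P \<in> carrier dring" for g P
  proof -
    obtain a where a: "a \<in> fin" "P = dop a" using P carrier by blast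
    have "?\<theta> (compose A (\<lambda>f\<in>A. g * f) (dop a)) = compose A (\<lambda>f\<in>A. g * f) (?\<theta> (dop a))"
      unfolding dop_mult mult[OF mono_symbol_fin[OF g] a(1)]
      by (simp only: \<theta>[OF mono_symbol_fin[OF g]] conj_mono_symbol_0[OF c g])
    then show ?thesis unfolding a(2) by (simp only: dring_def monoid.simps)
  qed
  moreover have "?\<theta> (\<lambda>f\<in>A. D f) = (\<lambda>f\<in>A. D f + c * f)"
  proof -
    have m: "mono_symbol e 1 \<in> fin" by (auto intro: mono_symbol_fin)
    have "dop (conj (bet c) (mono_symbol e 1)) = (\<lambda>f\<in>A. D f + c * f)"
    proof
      fix f
      show "dop (conj (bet c) (mono_symbol e 1)) f = (\<lambda>f\<in>A. D f + c * f) f"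
      proof (cases "f \<in> A")
        case True
        have "opL D (conj (bet c) (mono_symbol e 1)) f = e * ((\<lambda>f. D f + c * f) ^^ 1) f"
          by (simp only: opL_conj[OF twisted_D m c True] opL_mono_symbol)
        then show ?thesis using True c by (simp add: dop_def)
      qed (simp add: dop_def)
    qed
    then show ?thesis by (simp only: dop_D \<theta>[OF m])
  qed
  ultimately show ?thesis by (simp add: is_theta_def ring_iso_def)
qed

lemma theta_eq:
  assumes "c \<in> A"
  shows "(THE \<theta>. is_theta c \<theta>) = (\<lambda>P\<in>carrier dring. dop (conj (bet c) (emb P)))"
  using is_theta_conj[OF assms] is_theta_unique by blast

text \<open>On coefficient sequences \<open>theta\<close> is the substitution itself, so the
  substitution on all of \<open>Car\<close> extends it.\<close>

lemma emb_theta: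
  assumes "c \<in> A" "P \<in> carrier dring"
  shows "emb ((THE \<theta>. is_theta c \<theta>) P) = conj (bet c) (emb P)"
proof -
  obtain a where a: "a \<in> fin" "P = dop a" using assms(2) by (auto simp: dring_def)
  then show ?thesis using assms conj_fin[OF a(1)] by (simp add: theta_eq emb_dop)
qed

lemma conj_ring_iso:
  assumes "bounded_shift A e N D r c B" "bounded_shift A e N D r (- c) B'"
  shows "conj (bet c) \<in> ring_iso sring sring"
proof -
  interpret plus: bounded_shift A e N D r c B by (rule assms(1))
  interpret minus: bounded_shift A e N D r "- c" B' by (rule assms(2))
  have "bij_betw (conj (bet c)) Car Car"
  proof (rule bij_betwI[where g = "conj (bet (- c))"])
    show "conj (bet (- c)) (conj (bet c) a) = a" if "a \<in> Car" for a
      using plus.conj_conj[OF assms(2) that] .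
    show "conj (bet c) (conj (bet (- c)) a) = a" if "a \<in> Car" for a
      using minus.conj_conj[of B a] assms(1) that by simp
  qed (use plus.conj_Car minus.conj_Car in auto)
  moreover have "conj (bet c) (mono_symbol e 0) = mono_symbol e 0"
    using plus.c_in by (simp add: conj_mono_symbol_0)
  ultimately show ?thesis
    unfolding ring_iso_def ring_hom_def sring_def mono_symbol_def
    using plus.conj_Car plus.conj_prod plus.conj_add by auto
qed

subsection \<open>Growth of the conjugating sequence\<close>

text \<open>Powers carry the factor \<open>e\<close> because u^0 is the \<open>1\<close> of the
  type, which need not lie in A.\<close>

lemma unit_power_in [simp]: "u \<in> A \<Longrightarrow> u ^ n * e \<in> A"
  by (induction n) (auto simp: mult.assoc)

lemma D_unit_power:
  assumes "u \<in> A" "v \<in> A" "u * v = e"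
  shows "D (u ^ n * e) = of_nat n * (D u * v * (u ^ n * e))"
proof (induction n)
  case (Suc n)
  have "D (u ^ Suc n * e) = D (u * (u ^ n * e))" by (simp add: mult.assoc)
  also have "\<dots> = D u * (u ^ n * e) + u * (of_nat n * (D u * v * (u ^ n * e)))"
    using assms by (simp only: D_mult unit_power_in Suc)
  also have "D u * (u ^ n * e) = D u * (u * v) * (u ^ n * e)" using assms by simp
  finally show ?case by (simp add: algebra_simps)
qed simp

lemma unit_power_inverse:
  assumes "u \<in> A" "v \<in> A" "u * v = e"
  shows "(u ^ n * e) * (v ^ n * e) = e"
proof -
  have "(u ^ n * e) * (v ^ n * e) = (u * v) ^ n * (e * e)" by (simp only: power_mult_distrib mult_ac)
  also have "\<dots> = (u * v) ^ n * e" by simp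
  also have "\<dots> = e" unfolding assms(3) by (induction n) (auto simp: mult.assoc)
  finally show ?thesis .
qed

text \<open>For c = -n u'/u the recursion is solved by u^n D^j(u^(-n)): the derivative of u^n
  cancels against the term with c. Here v is the inverse of u.\<close>

lemma bet_nat:
  assumes u: "u \<in> A" and v: "v \<in> A" and uv: "u * v = e"
  shows "bet (- (of_nat n * (D u * v))) j = (u ^ n * e) * (D ^^ j) (v ^ n * e)"
proof (induction j)
  case 0
  show ?case using unit_power_inverse[OF assms] by simp
next
  case (Suc j)
  let ?U = "u ^ n * e" and ?V = "(D ^^ j) (v ^ n * e)"
  have V: "?V \<in> A" using v by simp
  have "D (?U * ?V) = of_nat n * (D u * v * ?U) * ?V + ?U * D ?V"
    using D_mult[OF unit_power_in[OF u] V] by (simp only: D_unit_power[OF assms])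
  then show ?case using Suc by (simp add: algebra_simps)
qed

text \<open>b_j is a differential polynomial in c, hence Lipschitz on bounded sets. The constant may
  depend on j, since c is approximated with j fixed.\<close>

lemma bet_continuous:
  "\<exists>K\<ge>0. \<forall>c\<in>A. \<forall>c'\<in>A. N c \<le> M \<longrightarrow> N c' \<le> M \<longrightarrow> N (bet c j) \<le> K \<and> N (bet c j - bet c' j) \<le> K * N (c - c')"
proof (induction j)
  case 0
  show ?case by (intro exI[of _ "N e"]) (auto simp: diff_in)
next
  case (Suc j)
  then obtain K where K0: "0 \<le> K" and K: "\<And>c c'. c \<in> A \<Longrightarrow> c' \<in> A \<Longrightarrow> N c \<le> M \<Longrightarrow> N c' \<le> M \<Longrightarrow>
     N (bet c j) \<le> K \<and> N (bet c j - bet c' j) \<le> K * N (c - c')" by blast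
  obtain C where C: "\<And>a m. a \<in> A \<Longrightarrow> N ((D ^^ m) a) \<le> C * r ^ m * N a" using D_bound by blast
  \<comment> \<open>The summands account for the norm of D, the norm of c, and the term (c - c')
    b'_j.\<close>
  define K' where "K' = (\<bar>C * r\<bar> + \<bar>M\<bar> + 1) * K"
  have ND: "N (D a) \<le> \<bar>C * r\<bar> * N a" if "a \<in> A" for a
  proof -
    have "C * r * N a \<le> \<bar>C * r\<bar> * N a" using that by (intro mult_right_mono) auto
    then show ?thesis using C[OF that, of 1] by simp
  qed
  have K': "\<bar>C * r\<bar> * K \<le> K'" "\<bar>M\<bar> * K \<le> K'" "K \<le> K'" "0 \<le> K'"
    using K0 by (auto simp: K'_def distrib_right)
  have "N (bet c (Suc j)) \<le> K' \<and> N (bet c (Suc j) - bet c' (Suc j)) \<le> K' * N (c - c')"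
    if c: "c \<in> A" "c' \<in> A" "N c \<le> M" "N c' \<le> M" for c c'
  proof
    have b: "bet c j \<in> A" "bet c' j \<in> A" "bet c j - bet c' j \<in> A" using c by (auto simp: diff_in)
    have cc: "c - c' \<in> A" using c by (simp add: diff_in)
    note Kc = K[OF c]
    have K2: "N (bet c' j) \<le> K" using K[of c' c'] c by blast
    have M: "N c \<le> \<bar>M\<bar>" using c(3) by linarith
    have "N (D (bet c j)) \<le> \<bar>C * r\<bar> * K" using ND[OF b(1)] Kc by (meson abs_ge_zero mult_left_mono order_trans)
    then have 1: "N (D (bet c j)) \<le> K'" using K'(1) by linarith
    have "N (c * bet c j) \<le> N c * N (bet c j)" using c b by (intro N_mult)
    also have "\<dots> \<le> \<bar>M\<bar> * K" using M Kc b by (intro mult_mono) auto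
    finally have 2: "N (c * bet c j) \<le> K'" using K'(2) by linarith
    show "N (bet c (Suc j)) \<le> K'" using 1 2 c b by (simp add: N_add_le)
    have nn: "0 \<le> N (c - c')" using cc by (rule N_nonneg)
    have "N (D (bet c j - bet c' j)) \<le> \<bar>C * r\<bar> * (K * N (c - c'))"
      using ND[OF b(3)] Kc by (meson abs_ge_zero mult_left_mono order_trans)
    also have "\<dots> \<le> K' * N (c - c')" using K'(1) nn by (simp add: mult_right_mono flip: mult.assoc)
    finally have 3: "N (D (bet c j - bet c' j)) \<le> K' * N (c - c')" .
    have "N (c * (bet c j - bet c' j)) \<le> N c * N (bet c j - bet c' j)" using c b by (intro N_mult)
    also have "\<dots> \<le> \<bar>M\<bar> * (K * N (c - c'))" using M Kc b(3) by (intro mult_mono) auto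
    also have "\<dots> \<le> K' * N (c - c')" using K'(2) nn by (simp add: mult_right_mono flip: mult.assoc)
    finally have 4: "N (c * (bet c j - bet c' j)) \<le> K' * N (c - c')" .
    have "N ((c - c') * bet c' j) \<le> N (c - c') * N (bet c' j)" using cc b by (intro N_mult)
    also have "\<dots> \<le> N (c - c') * K'" using K2 K'(3) nn by (intro mult_left_mono) auto
    finally have 5: "N ((c - c') * bet c' j) \<le> K' * N (c - c')" by (simp add: mult.commute)
    have "D (bet c j) = D (bet c j - bet c' j) + D (bet c' j)" using D_add[OF b(3) b(2)] by simp
    then have eq: "bet c (Suc j) - bet c' (Suc j) = D (bet c j - bet c' j) + c * (bet c j - bet c' j) + (c - c') * bet c' j"
      by (simp add: algebra_simps)
    show "N (bet c (Suc j) - bet c' (Suc j)) \<le> K' * N (c - c')"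
      unfolding eq using 3 4 5 c b cc by (intro N_add_le add_in mult_in D_in)
  qed
  then show ?case using K'(4) by blast
qed

end

text \<open>\<open>ev\<close> is evaluation at a point. Gauss norms over the field of values are
  multiplicative, while \<open>N\<close> is only assumed submultiplicative, so growth is estimated
  after evaluation. \<open>N_p\<close> makes multiples by p-adically small integers small.\<close>

locale eval_diff_algebra = nonarch_diff_algebra A e N D r + padic_field w p
  for A :: "'a::comm_ring_1 set" and e N D r and w :: "'b::field_char_0 \<Rightarrow> real" and p +
  fixes ev :: "'a \<Rightarrow> 'b"
  assumes ev_add: "a \<in> A \<Longrightarrow> b \<in> A \<Longrightarrow> ev (a + b) = ev a + ev b"
    and ev_mult: "a \<in> A \<Longrightarrow> b \<in> A \<Longrightarrow> ev (a * b) = ev a * ev b"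
    and ev_e: "ev e = 1"
    and ev_bound: "a \<in> A \<Longrightarrow> w (ev a) \<le> N a"
    and N_p: "a \<in> A \<Longrightarrow> N (of_nat p * a) \<le> N a / real p"
begin

lemma ev_0: "ev 0 = 0"
  using ev_add[of 0 0] by simp

lemma ev_sum: "(\<And>i. i \<in> S \<Longrightarrow> f i \<in> A) \<Longrightarrow> ev (sum f S) = (\<Sum>i\<in>S. ev (f i))"
  by (induction S rule: infinite_finite_induct) (auto simp: ev_0 ev_add)

lemma ev_of_nat: "a \<in> A \<Longrightarrow> ev (of_nat n * a) = of_nat n * ev a"
  by (induction n) (auto simp: ev_0 ev_add distrib_right)

text \<open>The Taylor series at the point; division by j! turns the Leibniz formula into
  multiplicativity.\<close>

definition tay :: "'a \<Rightarrow> 'b fps" where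
  "tay f = Abs_fps (\<lambda>j. ev ((D ^^ j) f) / fact j)"

lemma tay_mult:
  assumes "f \<in> A" "g \<in> A"
  shows "tay (f * g) = tay f * tay g"
proof (rule fps_ext)
  fix n
  have "ev ((D ^^ n) (f * g)) = (\<Sum>m\<le>n. of_nat (n choose m) * (ev ((D ^^ m) f) * ev ((D ^^ (n - m)) g)))"
    using assms by (simp add: twisted_leibniz[OF twisted_D] ev_sum ev_of_nat ev_mult)
  then have "ev ((D ^^ n) (f * g)) / fact n =
    (\<Sum>m\<le>n. of_nat (n choose m) * (ev ((D ^^ m) f) * ev ((D ^^ (n - m)) g)) / fact n)"
    by (simp add: sum_divide_distrib)
  also have "\<dots> = (\<Sum>m\<le>n. ev ((D ^^ m) f) / fact m * (ev ((D ^^ (n - m)) g) / fact (n - m)))"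
    by (intro sum.cong refl) (simp add: binomial_fact)
  finally show "fps_nth (tay (f * g)) n = fps_nth (tay f * tay g) n"
    by (simp add: tay_def fps_mult_nth atLeast0AtMost)
qed

lemma tay_e: "tay e = 1"
proof (rule fps_ext)
  fix n
  have "(D ^^ Suc m) e = 0" for m by (simp add: funpow_Suc_right del: funpow.simps)
  then show "fps_nth (tay e) n = fps_nth 1 n" by (cases n) (auto simp: tay_def ev_e ev_0)
qed

lemma tay_power: "v \<in> A \<Longrightarrow> tay (v ^ n * e) = tay v ^ n"
  by (induction n) (simp_all add: tay_e tay_mult mult.assoc)

lemma ev_power: "u \<in> A \<Longrightarrow> ev (u ^ n * e) = ev u ^ n"
  by (induction n) (simp_all add: ev_e ev_mult mult.assoc)

lemma ev_bet_nat_bound: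
  assumes u: "u \<in> A" and v: "v \<in> A" and uv: "u * v = e"
    and r0: "0 < r0" "r0 < r1" and bound: "\<And>a m. a \<in> A \<Longrightarrow> N ((D ^^ m) a) \<le> C * r0 ^ m * N a"
    and L: "0 < L" "\<And>n. L ^ n \<le> w (fact n)"
  shows "w (ev (bet (- (of_nat n * (D u * v))) j)) \<le> w (fact j) * (r1 / L) ^ j"
proof -
  have r1: "0 < r1" using r0 by linarith
  define s where "s = L / r1"
  have s: "0 < s" using L r1 by (simp add: s_def)
  \<comment> \<open>For u v = e this is the series of u(x) / u(x + z), and exchanging u and v gives
    its inverse.\<close>
  define F where "F u v = fps_const (ev u) * tay v" for u v
  have F0: "fps_nth (F u v) 0 = 1" if "u \<in> A" "v \<in> A" "u * v = e" for u v
    using ev_mult[OF that(1,2)] that(3) by (simp add: F_def tay_def ev_e)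
  have F_lim: "(\<lambda>j. w (fps_nth (F u v) j) * s ^ j) \<longlonglongrightarrow> 0" if v: "v \<in> A" for u v
  proof (rule tendsto_0_le)
    \<comment> \<open>|D^j v| grows at most like r0^j and |j!| is at least L^j, so at radius L / r1
      the coefficients decay like (r0 / r1)^j.\<close>
    have "norm (r0 / r1) < 1" using r0 r1 by simp
    then have "(\<lambda>j. (r0 / r1) ^ j) \<longlonglongrightarrow> 0" by (rule LIMSEQ_power_zero)
    then show "(\<lambda>j. w (ev u) * C * N v * (r0 / r1) ^ j) \<longlonglongrightarrow> 0" by (rule tendsto_mult_right_zero)
    fix j
    show "0 \<le> w (fps_nth (F u v) j) * s ^ j" using s by simp
    have Lj: "0 < L ^ j" using L by simp
    have "w (ev ((D ^^ j) v)) \<le> C * r0 ^ j * N v" using ev_bound[of "(D ^^ j) v"] bound[OF v, of j] v by simp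
    moreover have "0 \<le> w (ev ((D ^^ j) v))" by simp
    ultimately have "w (ev ((D ^^ j) v)) / w (fact j) \<le> C * r0 ^ j * N v / L ^ j"
      using L(2)[of j] Lj by (intro frac_le) linarith+
    then have "w (ev u) * (w (ev ((D ^^ j) v)) / w (fact j)) * s ^ j \<le> w (ev u) * (C * r0 ^ j * N v / L ^ j) * s ^ j"
      using s by (intro mult_right_mono mult_left_mono) auto
    also have "\<dots> = w (ev u) * C * N v * (r0 / r1) ^ j" using L r1 by (simp add: s_def power_divide)
    finally show "w (fps_nth (F u v) j) * s ^ j \<le> w (ev u) * C * N v * (r0 / r1) ^ j"
      by (simp add: F_def tay_def w_mult w_divide)
  qed
  have "F u v * F v u = fps_const (ev u * ev v) * (tay v * tay u)" by (simp add: F_def mult_ac)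
  also have "\<dots> = 1" using u v uv tay_mult[OF v u] ev_mult[OF u v] by (simp add: mult.commute[of v] ev_e tay_e)
  finally have FF: "F u v * F v u = 1" .
  have vu: "v * u = e" using uv by (simp add: mult.commute)
  have F1: "w (fps_nth (F u v) j) * s ^ j \<le> 1" for j
    using FF F0[OF u v uv] F0[OF v u vu] s F_lim[OF v] F_lim[OF u] by (rule fps_inverse_coeff_le_1)
  \<comment> \<open>The scalar u(x)^n and the Taylor series of u^(-n) combine to b_j / j! by
    \<open>bet_nat\<close>.\<close>
  have "F u v ^ n = fps_const (ev (u ^ n * e)) * tay (v ^ n * e)"
    by (simp add: F_def power_mult_distrib tay_power[OF v] ev_power[OF u] fps_const_power)
  then have "fps_nth (F u v ^ n) j = ev ((u ^ n * e) * (D ^^ j) (v ^ n * e)) / fact j"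
    using u v by (simp add: tay_def ev_mult)
  then have "ev (bet (- (of_nat n * (D u * v))) j) = fps_nth (F u v ^ n) j * fact j"
    by (simp add: bet_nat[OF u v uv])
  moreover have "w (fps_nth (F u v ^ n) j) * s ^ j \<le> 1" using s F1 by (rule fps_power_coeff_le_1)
  then have "w (fps_nth (F u v ^ n) j) \<le> (r1 / L) ^ j"
    using L r1 by (simp add: s_def field_simps)
  ultimately show ?thesis using w_nonneg[of "fact j"] by (simp add: w_mult mult.commute mult_left_mono)
qed

lemma N_p_power: "a \<in> A \<Longrightarrow> N (of_nat (p ^ m) * a) \<le> N a / real p ^ m"
proof (induction m)
  case (Suc m)
  have "N (of_nat (p ^ Suc m) * a) = N (of_nat p * (of_nat (p ^ m) * a))" by (simp add: mult.assoc)
  also have "\<dots> \<le> N (of_nat (p ^ m) * a) / real p" using Suc.prems by (intro N_p of_nat_mult_in)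
  also have "\<dots> \<le> (N a / real p ^ m) / real p" using Suc by (intro divide_right_mono) auto
  finally show ?case by (simp add: mult.commute)
qed simp

lemma ev_bet_bound:
  assumes u: "u \<in> A" and v: "v \<in> A" and uv: "u * v = e"
    and r0: "0 < r0" "r0 < r1" and bound: "\<And>a m. a \<in> A \<Longrightarrow> N ((D ^^ m) a) \<le> C * r0 ^ m * N a"
    and L: "0 < L" "\<And>n. L ^ n \<le> w (fact n)"
    and c: "c \<in> A" "of_int d * c = - (D u * v)" and d: "\<not> int p dvd d"
  shows "w (ev (bet c j)) \<le> w (fact j) * (r1 / L) ^ j"
proof -
  have bnd_pos: "0 < w (fact j) * (r1 / L) ^ j" using r0 L by simp
  \<comment> \<open>Bounds c and all approximants -n u'/u at once, since multiplication by an
    integer does not increase the norm.\<close>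
  define M where "M = max (N c) (N (D u * v))"
  obtain K where K: "0 \<le> K" "\<And>c c'. c \<in> A \<Longrightarrow> c' \<in> A \<Longrightarrow> N c \<le> M \<Longrightarrow> N c' \<le> M \<Longrightarrow> N (bet c j - bet c' j) \<le> K * N (c - c')"
    using bet_continuous[of M j] by blast
  have "(\<lambda>m. K * N c * (1 / real p) ^ m) \<longlonglongrightarrow> 0"
    using p_gt_1 by (intro tendsto_mult_right_zero LIMSEQ_realpow_zero) auto
  then have "\<forall>\<^sub>F m in sequentially. K * N c * (1 / real p) ^ m < w (fact j) * (r1 / L) ^ j"
    using bnd_pos by (rule order_tendstoD)
  then obtain m where m: "K * N c * (1 / real p) ^ m < w (fact j) * (r1 / L) ^ j"
    by (auto simp: eventually_sequentially)
  \<comment> \<open>n will be an inverse of d modulo p^m, so that c - c' = (1 - n d) c is a multiple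
    of p^m; m was chosen to keep the resulting error in b_j below the target.\<close>
  have "coprime (int p ^ m) d"
    using prime d by (simp add: prime_imp_coprime)
  then obtain x y where xy: "x * int p ^ m + y * d = 1" by (metis bezout_int coprime_iff_gcd_eq_1)
  define n where "n = nat (y mod int p ^ m)"
  have pm: "0 < int p ^ m" using prime prime_gt_0_nat by simp
  have n: "int n = y mod int p ^ m" using pm by (simp add: n_def)
  have "int p ^ m dvd 1 - int n * d"
  proof -
    have "1 - int n * d = int p ^ m * (x + (y div int p ^ m) * d)"
      using xy unfolding n by (simp add: minus_mult_div_eq_mod[symmetric] algebra_simps)
    then show ?thesis by simp
  qed
  then obtain k where k: "1 - int n * d = int p ^ m * k" by (elim dvdE)
  define c' where "c' = - (of_nat n * (D u * v))"
  have c': "c' \<in> A" using u v by (auto simp: c'_def intro: uminus_in)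
  have "c - c' = of_int (1 - int n * d) * c"
  proof -
    have "c' = of_nat n * (of_int d * c)" by (simp add: c'_def c(2))
    then show ?thesis by (simp add: algebra_simps)
  qed
  then have cc: "c - c' = of_nat (p ^ m) * (of_int k * c)" unfolding k by simp
  have of_int: "of_int i * a \<in> A \<and> N (of_int i * a) \<le> N a" if "a \<in> A" for i a
    by (cases i rule: int_cases2) (use that in \<open>auto simp: uminus_in N_minus N_of_nat_mult\<close>)
  have "N (c - c') \<le> N (of_int k * c) / real p ^ m"
    unfolding cc using of_int c by (intro N_p_power) auto
  also have "\<dots> \<le> N c / real p ^ m" using of_int c by (intro divide_right_mono) auto
  finally have Ncc: "N (c - c') \<le> N c * (1 / real p) ^ m" by (simp add: power_divide)
  have "N c' \<le> N (D u * v)" unfolding c'_def using u v by (simp add: N_minus N_of_nat_mult)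
  then have "N (bet c j - bet c' j) \<le> K * N (c - c')" using c c' by (intro K) (auto simp: M_def)
  also have "\<dots> \<le> K * (N c * (1 / real p) ^ m)" using Ncc K by (intro mult_left_mono)
  also have "\<dots> \<le> w (fact j) * (r1 / L) ^ j" using m by (simp add: mult.assoc)
  finally have N1: "N (bet c j - bet c' j) \<le> w (fact j) * (r1 / L) ^ j" .
  have b: "bet c j \<in> A" "bet c' j \<in> A" "bet c j - bet c' j \<in> A" using c c' by (auto simp: diff_in)
  then have 1: "w (ev (bet c j - bet c' j)) \<le> w (fact j) * (r1 / L) ^ j"
    using ev_bound[OF b(3)] N1 by linarith
  have 2: "w (ev (bet c' j)) \<le> w (fact j) * (r1 / L) ^ j"
    unfolding c'_def using u v uv r0 bound L by (rule ev_bet_nat_bound)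
  have "ev (bet c j) = ev (bet c j - bet c' j) + ev (bet c' j)" using ev_add[OF b(3) b(2)] by simp
  then show ?thesis using w_add_le[OF 1 2] by simp
qed

end

section \<open>The growth bound and the extension on an affinoid subdomain\<close>

context padic_field
begin

text \<open>As |n!|^(1/n) tends to L, |n!| grows at most like q^n for any q > L; q = L r / r1
  qualifies because r1 < r.\<close>

lemma fact_growth:
  assumes L: "0 < L" "(\<lambda>n. root n (w (fact n))) \<longlonglongrightarrow> L" and r: "0 < r1" "r1 < r"
  obtains B where "\<And>n. w (fact n) * (r1 / L) ^ n \<le> B * r ^ n"
proof -
  have "L < L * r / r1" "0 < L * r / r1" using L r by (simp_all add: field_simps)
  then obtain B where B: "\<And>n. w (fact n) \<le> B * (L * r / r1) ^ n"
    using root_limit_growth[of "\<lambda>n. w (fact n)", OF w_nonneg L(2)] by blast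
  have "w (fact n) * (r1 / L) ^ n \<le> B * r ^ n" for n
  proof -
    have "w (fact n) * (r1 / L) ^ n \<le> B * (L * r / r1) ^ n * (r1 / L) ^ n"
      using B[of n] L r by (intro mult_right_mono) auto
    also have "\<dots> = B * r ^ n" using L r by (simp add: power_divide power_mult_distrib)
    finally show ?thesis .
  qed
  then show ?thesis using that by blast
qed

end

context good_domain
begin

lemma eval_diff_algebra:
  assumes "nonarch_diff_algebra (holo w Y) unit_fun N D r" "x \<in> Y"
  shows "eval_diff_algebra (holo w Y) unit_fun N D r w p (\<lambda>f. f x)"
proof -
  interpret nonarch_diff_algebra "holo w Y" unit_fun N D r by (rule assms)
  show ?thesis
  proof unfold_locales
    show "w (f x) \<le> N f" if "f \<in> holo w Y" for f using N_upper(2)[OF that assms(2)] .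
    show "N (of_nat p * f) \<le> N f / real p" if f: "f \<in> holo w Y" for f
    proof (rule N_least)
      show "0 \<le> N f / real p" using N_upper(1)[OF f] by simp
      fix a assume "a \<in> Y"
      then show "w ((of_nat p * f) a) \<le> N f / real p"
        using N_upper(2)[OF f] by (simp add: w_mult w_p divide_right_mono)
    qed
  qed (use assms(2) in \<open>simp_all add: unit_fun_def\<close>)
qed

text \<open>The bound of \<open>ev_bet_bound\<close> is the same at every point of Y, so it bounds
  the supremum norm, and \<open>fact_growth\<close> turns it into B r^j. Here \<open>u'\<close> is
  the inverse of u.\<close>

lemma shift_bounded:
  assumes alg: "nonarch_diff_algebra (holo w Y) unit_fun N D r"
    and r0: "0 < r0" "r0 < r" "\<And>f m. f \<in> holo w Y \<Longrightarrow> N ((D ^^ m) f) \<le> C * r0 ^ m * N f"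
    and u: "u \<in> holo w Y" "u' \<in> holo w Y" "u * u' = unit_fun"
    and c: "c \<in> holo w Y" "of_int d * c = - (D u * u')" and d: "\<not> int p dvd d"
  shows "\<exists>B. bounded_shift (holo w Y) unit_fun N D r c B"
proof -
  interpret A: nonarch_diff_algebra "holo w Y" unit_fun N D r by (rule alg)
  obtain L where L: "0 < L" "(\<lambda>n. root n (w (fact n))) \<longlonglongrightarrow> L" "\<And>n. L ^ n \<le> w (fact n)"
    by (rule fact_radius) blast
  define r1 where "r1 = (r0 + r) / 2"
  have r1: "0 < r1" "r0 < r1" "r1 < r" using r0 by (auto simp: r1_def)
  obtain B where B: "\<And>n. w (fact n) * (r1 / L) ^ n \<le> B * r ^ n"
    by (rule fact_growth[OF L(1,2) r1(1,3)]) blast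
  have "N (A.bet c j) \<le> B * r ^ j" for j
  proof -
    have "N (A.bet c j) \<le> w (fact j) * (r1 / L) ^ j"
    proof (rule N_least)
      show "0 \<le> w (fact j) * (r1 / L) ^ j" using r1 L by simp
      fix x assume x: "x \<in> Y"
      interpret E: eval_diff_algebra "holo w Y" unit_fun N D r w p "\<lambda>f. f x"
        using alg x by (rule eval_diff_algebra)
      show "w (A.bet c j x) \<le> w (fact j) * (r1 / L) ^ j"
        using u r0(1) r1(2) r0(3) L(1,3) c d by (rule E.ev_bet_bound)
    qed
    then show ?thesis using B[of j] by linarith
  qed
  then have "bounded_shift (holo w Y) unit_fun N D r c B"
    using c(1) by unfold_locales
  then show ?thesis ..
qed

text \<open>Both descriptions differ in form only: operations written pointwise against operations
  of the function type.\<close>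

lemma dictionary:
  assumes "nonarch_diff_algebra (holo w Y) unit_fun N D r"
  defines "fin \<equiv> nonarch_diff_algebra.fin (holo w Y)"
    and "dop \<equiv> nonarch_diff_algebra.dop (holo w Y) D"
  shows "completed_diff_ring w Y r = nonarch_diff_algebra.sring (holo w Y) unit_fun N D r"
    and "diff_ring w Y = nonarch_diff_algebra.dring (holo w Y) D"
    and "diff_embed w Y = nonarch_diff_algebra.emb (holo w Y) D"
    and "(\<And>x. c x = - (1 / of_int d * (D u x / u x))) \<Longrightarrow>
      theta w Y u d = (THE \<theta>. nonarch_diff_algebra.is_theta (holo w Y) D c \<theta>)"
proof -
  interpret A: nonarch_diff_algebra "holo w Y" unit_fun N D r by (rule assms)
  have suminf: "holo_suminf w Y F = A.lsum F" for F
  proof -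
    have "(\<lambda>x. (\<Sum>i<n. F i x) - g x) = (\<Sum>i<n. F i) - g" for n g
      by (rule ext) (simp add: sum_fun_apply)
    then show ?thesis by (simp only: holo_suminf_def A.lsum_def)
  qed
  have prod: "(\<lambda>x. a i x * (\<Sum>m | m \<le> i \<and> i \<le> k + m. of_nat (i choose m) * (D ^^ m) (b (k + m - i)) x))
      = a i * A.prod_term b k i" for a b i k
    by (rule ext) (simp add: A.prod_term_def sum_fun_apply)
  have one: "(\<lambda>j x. if j = 0 \<and> x \<in> Y then 1 else 0) = (\<lambda>j::nat. if j = 0 then unit_fun else 0)"
    by (intro ext) (simp add: unit_fun_def)
  have add: "(\<lambda>a b j x. a j x + b j x) = ((+) :: (nat \<Rightarrow> 'k alg_closure \<Rightarrow> 'k alg_closure) \<Rightarrow> _)"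
    by (intro ext) simp
  show "completed_diff_ring w Y r = A.sring"
    unfolding completed_diff_ring_def A.sring_def A.Car_def A.prod_def[abs_def] suminf prod one add
    by (simp only: zero_fun_def)
  have fin: "fin_symbols w Y = A.fin"
    by (simp add: fin_symbols_def A.fin_def zero_fun_def)
  have dop: "diff_op w Y a = A.dop a" for a
    unfolding diff_op_def A.dop_def A.opL_def
    by (intro restrict_ext ext) (simp add: sum_fun_apply zero_fun_def)
  show dring: "diff_ring w Y = A.dring"
    unfolding diff_ring_def A.dring_def fin using dop by (simp add: plus_fun_def zero_fun_def)
  show "diff_embed w Y = A.emb"
    by (rule ext) (simp only: diff_embed_def A.emb_def fin dop)
  assume c: "\<And>x. c x = - (1 / of_int d * (D u x / u x))"
  have mop: "mult_op w Y g = (\<lambda>f\<in>holo w Y. g * f)" for g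
    by (simp only: mult_op_def times_fun_def)
  have shift: "(\<lambda>f\<in>holo w Y. \<lambda>x. D f x - 1 / of_int d * (D u x / u x) * f x) = (\<lambda>f\<in>holo w Y. D f + c * f)"
    by (intro restrict_ext ext) (simp add: c)
  show "theta w Y u d = (THE \<theta>. A.is_theta c \<theta>)"
    unfolding theta_def A.is_theta_def dring mop shift ..
qed

lemma theta_extends:
  assumes sr: "spectral_radius w Y < r" and r: "0 < r" and u: "u \<in> Units (holo_ring w Y)"
    and d: "d \<noteq> 0" "\<not> int p dvd d"
  shows "\<exists>\<Theta>. bounded_algebra_automorphism w Y r \<Theta> \<and>
           (\<forall>P\<in>carrier (diff_ring w Y). \<Theta> (diff_embed w Y P) = diff_embed w Y (theta w Y u d P))"
proof -
  obtain r0 C where r0: "0 < r0" "r0 < r" and D_pow: "\<And>f m. f \<in> holo w Y \<Longrightarrow> N ((D ^^ m) f) \<le> C * r0 ^ m * N f"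
    by (rule spectral_bound[OF sr r]) blast
  have alg: "nonarch_diff_algebra (holo w Y) unit_fun N D r"
  proof (rule nonarch_diff_algebra[OF r])
    fix f m assume f: "f \<in> holo w Y"
    have "C * r0 ^ m * N f \<le> \<bar>C\<bar> * r ^ m * N f"
      using r0 N_upper(1)[OF f] by (intro mult_right_mono mult_mono power_mono) auto
    then show "N ((D ^^ m) f) \<le> \<bar>C\<bar> * r ^ m * N f" using D_pow[OF f, of m] by linarith
  qed
  interpret A: nonarch_diff_algebra "holo w Y" unit_fun N D r by (rule alg)
  obtain u' where uv: "u \<in> holo w Y" "u' \<in> holo w Y" "u * u' = unit_fun"
    using u by (auto simp: Units_def holo_ring_def times_fun_def unit_fun_def[abs_def])
  \<comment> \<open>Written as a product of elements of O(Y) to make membership visible: a constant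
    from K cut off outside Y, the derivative of u, and the inverse \<open>u'\<close>.\<close>
  define c where "c = (\<lambda>a. if a \<in> Y then to_ac (- (1 / of_int d)) else 0) * (D u * u')"
  have c_in: "c \<in> holo w Y"
    unfolding c_def using uv by (intro holo_mult const_holo ddx_holo)
  have u_v: "u x * u' x = 1" if "x \<in> Y" for x
    using fun_cong[OF uv(3), of x] that by (simp add: unit_fun_def)
  \<comment> \<open>Outside Y both sides are 0, by the default value of \<open>ddx\<close>.\<close>
  have c_eq: "c x = - (1 / of_int d * (D u x / u x))" for x
  proof (cases "x \<in> Y")
    case True
    then have "u' x = 1 / u x" using u_v[OF True] by (metis nonzero_mult_div_cancel_left mult_zero_left zero_neq_one)
    then show ?thesis using True by (simp add: c_def)
  qed (simp add: c_def ddx_def)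
  have of_int_apply: "of_int i x = of_int i" for i :: int and x :: "'k alg_closure"
    by (cases i rule: int_cases2) simp_all
  have dc: "of_int d * c = - (D u * u')"
  proof
    fix x
    show "(of_int d * c) x = (- (D u * u')) x"
      using d(1) by (cases "x \<in> Y") (simp_all add: of_int_apply c_def ddx_def)
  qed
  obtain B where B: "bounded_shift (holo w Y) unit_fun N D r c B"
    using shift_bounded[OF alg r0 D_pow uv c_in dc d(2)] by blast
  \<comment> \<open>The inverse substitution, for -c, belongs to -d, which is prime to p as
    well.\<close>
  have "of_int (- d) * (- c) = - (D u * u')" using dc by simp
  then obtain B' where B': "bounded_shift (holo w Y) unit_fun N D r (- c) B'"
    using shift_bounded[OF alg r0 D_pow uv A.uminus_in[OF c_in], of "- d"] d(2) by auto
  interpret S: bounded_shift "holo w Y" unit_fun N D r c B by (rule B)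
  note dict = dictionary[OF alg]
  let ?\<Theta> = "A.conj (A.bet c)"
  have carrier: "carrier (completed_diff_ring w Y r) = A.Car"
    by (simp add: dict(1) A.sring_def)
  have "?\<Theta> (\<lambda>j x. to_ac s * a j x) = (\<lambda>j x. to_ac s * ?\<Theta> a j x)" if a: "a \<in> A.Car" for s a
  proof -
    \<comment> \<open>Scalars of K act as multiplication by constant functions cut off outside Y, so
      \<open>conj_mult\<close> applies.\<close>
    have scale: "(\<lambda>j x. to_ac s * b j x) = (\<lambda>j. (\<lambda>a. if a \<in> Y then to_ac s else 0) * b j)" if "b \<in> A.Car" for b
    proof (intro ext)
      fix j x
      have "b j \<in> holo w Y" using that by (simp add: A.Car_def)
      then show "to_ac s * b j x = ((\<lambda>a. if a \<in> Y then to_ac s else 0) * b j) x"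
        using holo_outside[of "b j" x] by simp
    qed
    show ?thesis unfolding scale[OF a] scale[OF S.conj_Car[OF a]] by (rule S.conj_mult[OF a const_holo])
  qed
  moreover have "completed_norm w Y r (?\<Theta> a) \<le> B * completed_norm w Y r a" if a: "a \<in> A.Car" for a
  proof -
    obtain M where M: "A.bnd M a" using A.Car_bnd[OF a] ..
    then have "bdd_above (range (\<lambda>j. N (a j) * r ^ j))" by (intro bdd_aboveI[of _ M]) (auto simp: A.bnd_def)
    then have "A.bnd (completed_norm w Y r a) a"
      using M by (auto simp: A.bnd_def completed_norm_def intro: cSup_upper)
    then have "A.bnd (B * completed_norm w Y r a) (?\<Theta> a)" using a by (intro S.conj_bnd)
    then show ?thesis unfolding completed_norm_def[of w Y r "?\<Theta> a"]
      by (intro cSup_least) (auto simp: A.bnd_def)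
  qed
  ultimately have "bounded_algebra_automorphism w Y r ?\<Theta>"
    unfolding bounded_algebra_automorphism_def carrier using A.conj_ring_iso[OF B B'] dict(1) by auto
  moreover have "?\<Theta> (diff_embed w Y P) = diff_embed w Y (theta w Y u d P)" if P: "P \<in> carrier (diff_ring w Y)" for P
    using A.emb_theta[OF c_in, of P] P unfolding dict(2,3) dict(4)[OF c_eq] by simp
  ultimately show ?thesis by blast
qed

end

theorem theorem2p4p9:
  fixes p :: nat
    and v :: "'k::field_char_0 \<Rightarrow> real"
    and w :: "'k alg_closure \<Rightarrow> real"
    and r :: real
    and Y :: "'k alg_closure set"
    and u :: "'k alg_closure \<Rightarrow> 'k alg_closure"
    and d :: int
  assumes "ground_field p v w"
    and "r > 0"
    and "affinoid_subdomain w Y"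
    and "spectral_radius w Y < r"
    and "u \<in> Units (holo_ring w Y)"
    and "d \<noteq> 0"
    and "\<not> int p dvd d"
  shows "\<exists>\<Theta>. bounded_algebra_automorphism w Y r \<Theta> \<and>
           (\<forall>P\<in>carrier (diff_ring w Y).
              \<Theta> (diff_embed w Y P) = diff_embed w Y (theta w Y u d P))"
proof -
  interpret ground p v w using assms(1) by unfold_locales
  obtain t where "good_domain p v w Y t" using affinoid_good[OF assms(3)] by blast
  then interpret good_domain p v w Y t .
  show ?thesis using assms(4,2,5,6,7) by (rule theta_extends)
qed

end
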